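(* The bottleneck network flow problem (BNFP) on a unit capacity directed graph $G=(V,E)$ (i.e. $u_{ij}=1$ for all $(i,j)\in E$) with $n=|V|$ and $m=|E|$ can be solved in $O\big(\min\{m(n\log n)^{2/3},\ m^{3/2}\sqrt{\log n}\}\big)$ time.
   Context: BNFP: given a directed graph $G=(V,E)$ without multiple arcs, integer weights $c_{ij}$ and integer capacities $u_{ij}$ on arcs, and integers $b_i$ ($i\in V$) with $\sum_i b_i=0$, minimize $\max\{c_{ij}:x_{ij}>0\}$ subject to $\sum_{j:(i,j)\in E}x_{ij}-\sum_{j:(j,i)\in E}x_{ji}=b_i$ for all $i\in V$ and $0\le x_{ij}\le u_{ij}$ for all $(i,j)\in E$.
   Formalization: The time bound is asserted for n ≥ 2 and n = O(m) (constant depending on the ratio n/m), since it fails literally for n = 1 or when almost all vertices are isolated: all n supplies must be read. Correctness is proved for all unit-capacity instances. *)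

theory Defs
  imports
    "HOL-Analysis.Analysis"
    "HOL-Library.Landau_Symbols"
    "Graph_Theory.Pair_Digraph"
begin

section \<open>The bottleneck network flow problem\<close>

text \<open>
  A \<open>pair_pre_digraph\<close> has a set of ordered pairs as arcs, so multiple arcs are excluded by its type.
\<close>

record 'v bnfp =
  network :: "'v pair_pre_digraph"
  weight :: "'v \<times> 'v \<Rightarrow> int"
  capacity :: "'v \<times> 'v \<Rightarrow> int"
  net_supply :: "'v \<Rightarrow> int"

definition is_bnfp :: "'v bnfp \<Rightarrow> bool" where
  "is_bnfp I \<longleftrightarrow> pair_fin_digraph (network I) \<and> (\<Sum>i\<in>pverts (network I). net_supply I i) = 0"

definition feasible_flow :: "'v bnfp \<Rightarrow> ('v \<times> 'v \<Rightarrow> real) \<Rightarrow> bool" where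
  "feasible_flow I x \<longleftrightarrow>
     (\<forall>i\<in>pverts (network I).
        (\<Sum>j | (i, j) \<in> parcs (network I). x (i, j)) - (\<Sum>j | (j, i) \<in> parcs (network I). x (j, i))
          = real_of_int (net_supply I i)) \<and>
     (\<forall>e\<in>parcs (network I). 0 \<le> x e \<and> x e \<le> real_of_int (capacity I e))"

text \<open>
  For the zero flow the maximum ranges over the empty set; as a supremum in \<open>ereal\<close> its value
  is \<open>-\<infinity>\<close>. Otherwise the supremum is over a finite nonempty set, hence a maximum.
\<close>

definition bottleneck :: "'v bnfp \<Rightarrow> ('v \<times> 'v \<Rightarrow> real) \<Rightarrow> ereal" where
  "bottleneck I x = (SUP e\<in>{e \<in> parcs (network I). x e > 0}. ereal (real_of_int (weight I e)))"

definition optimal_flow :: "'v bnfp \<Rightarrow> ('v \<times> 'v \<Rightarrow> real) \<Rightarrow> bool" where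
  "optimal_flow I x \<longleftrightarrow>
     feasible_flow I x \<and> (\<forall>y. feasible_flow I y \<longrightarrow> bottleneck I x \<le> bottleneck I y)"

definition unit_capacity :: "'v bnfp \<Rightarrow> bool" where
  "unit_capacity I \<longleftrightarrow> (\<forall>e\<in>parcs (network I). capacity I e = 1)"


section \<open>Unit-cost random access machine\<close>

text \<open>
  The machine model is the random access machine with unit-cost addition, subtraction and sign test
  on integers and with indirect addressing; there is no multiplication, division or bit operation.
  Programs are structured instead of using jumps, and the memory is split into arrays.
  A program mentions only finitely many array names, so interleaving the arrays in a single memory
  changes running times by a constant factor only. A scalar variable is cell 0 of an array.
\<close>

type_synonym state = "string \<Rightarrow> int \<Rightarrow> int"

datatype exp =
    Const int
  | Cell string exp
  | Add exp exp
  | Sub exp exp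

datatype com =
    Skip
  | Store string exp exp  \<comment> \<open>array name, index, value\<close>
  | Seq com com
  | IfPos exp com com     \<comment> \<open>tests whether the value is positive\<close>
  | WhilePos exp com

fun eval :: "exp \<Rightarrow> state \<Rightarrow> int" where
  "eval (Const k) s = k"
| "eval (Cell a e) s = s a (eval e s)"
| "eval (Add e f) s = eval e s + eval f s"
| "eval (Sub e f) s = eval e s - eval f s"

fun eval_cost :: "exp \<Rightarrow> nat" where
  "eval_cost (Const k) = 1"
| "eval_cost (Cell a e) = 1 + eval_cost e"
| "eval_cost (Add e f) = 1 + eval_cost e + eval_cost f"
| "eval_cost (Sub e f) = 1 + eval_cost e + eval_cost f"

text \<open>
  \<open>exec c s t s'\<close>: program \<open>c\<close> started in \<open>s\<close> halts in \<open>s'\<close> after exactly \<open>t\<close> elementary steps.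
\<close>

inductive exec :: "com \<Rightarrow> state \<Rightarrow> nat \<Rightarrow> state \<Rightarrow> bool" where
  Skip: "exec Skip s 1 s"
| Store: "exec (Store a e f) s (1 + eval_cost e + eval_cost f)
            (s(a := (s a)(eval e s := eval f s)))"
| Seq: "exec c s t s' \<Longrightarrow> exec d s' t' s'' \<Longrightarrow> exec (Seq c d) s (t + t') s''"
| IfTrue: "eval e s > 0 \<Longrightarrow> exec c s t s' \<Longrightarrow> exec (IfPos e c d) s (1 + eval_cost e + t) s'"
| IfFalse: "eval e s \<le> 0 \<Longrightarrow> exec d s t s' \<Longrightarrow> exec (IfPos e c d) s (1 + eval_cost e + t) s'"
| WhileFalse: "eval e s \<le> 0 \<Longrightarrow> exec (WhilePos e c) s (1 + eval_cost e) s"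
| WhileTrue: "eval e s > 0 \<Longrightarrow> exec c s t s' \<Longrightarrow> exec (WhilePos e c) s' t' s'' \<Longrightarrow>
    exec (WhilePos e c) s (1 + eval_cost e + t + t') s''"

lemma exec_deterministic:
  "exec c s t s' \<Longrightarrow> exec c s u s'' \<Longrightarrow> t = u \<and> s' = s''"
proof (induction arbitrary: u s'' rule: exec.induct)
  case (Skip s)
  then show ?case by cases auto
next
  case (Store a e f s)
  then show ?case by cases auto
next
  case (Seq c s t s' d t' s3)
  note IH = Seq.IH
  from Seq.prems show ?case
  proof cases
    case (Seq v s1 v')
    with IH show ?thesis by metis
  qed
next
  case (IfTrue e s c t s' d)
  note IH = IfTrue.IH
  from IfTrue.prems show ?case
  proof cases
    case (IfTrue v)
    with IH show ?thesis by simp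
  next
    case IfFalse
    with IfTrue.hyps show ?thesis by simp
  qed
next
  case (IfFalse e s d t s' c)
  note IH = IfFalse.IH
  from IfFalse.prems show ?case
  proof cases
    case IfTrue
    with IfFalse.hyps show ?thesis by simp
  next
    case (IfFalse v)
    with IH show ?thesis by simp
  qed
next
  case (WhileFalse e s c)
  from WhileFalse.prems show ?case
  proof cases
    case WhileFalse
    then show ?thesis by simp
  next
    case WhileTrue
    with WhileFalse.hyps show ?thesis by simp
  qed
next
  case (WhileTrue e s c t s' t' s3)
  note IH = WhileTrue.IH
  from WhileTrue.prems show ?case
  proof cases
    case WhileFalse
    with WhileTrue.hyps show ?thesis by simp
  next
    case (WhileTrue v s1 v')
    with IH show ?thesis by metis
  qed
qed


section \<open>Solving the problem on the machine\<close>

text \<open>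
  The vertices are numbered \<open>0, \<dots>, n - 1\<close> and the arcs are given by a duplicate-free list \<open>es\<close>
  in arbitrary order. Memory cells not mentioned have arbitrary initial contents.
\<close>

definition input_state :: "nat bnfp \<Rightarrow> (nat \<times> nat) list \<Rightarrow> state \<Rightarrow> bool" where
  "input_state I es s \<longleftrightarrow>
     pverts (network I) = {..<card (pverts (network I))} \<and>
     distinct es \<and> set es = parcs (network I) \<and>
     s ''n'' 0 = int (card (pverts (network I))) \<and>
     s ''m'' 0 = int (card (parcs (network I))) \<and>
     (\<forall>i\<in>pverts (network I). s ''supply'' (int i) = net_supply I i) \<and>
     (\<forall>k<length es.
        s ''tail'' (int k) = int (fst (es ! k)) \<and>
        s ''head'' (int k) = int (snd (es ! k)) \<and>
        s ''weight'' (int k) = weight I (es ! k) \<and>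
        s ''capacity'' (int k) = capacity I (es ! k))"

text \<open>
  The output is a feasibility flag together with, in the feasible case, an optimal flow. The flow is
  necessarily integral, but it has to be optimal among all real-valued feasible flows.
\<close>

definition output_state :: "nat bnfp \<Rightarrow> (nat \<times> nat) list \<Rightarrow> state \<Rightarrow> bool" where
  "output_state I es s \<longleftrightarrow>
     (if \<exists>y. feasible_flow I y
      then s ''feasible'' 0 = 1 \<and>
        (\<exists>x. optimal_flow I x \<and> (\<forall>k<length es. x (es ! k) = real_of_int (s ''flow'' (int k))))
      else s ''feasible'' 0 = 0)"

definition solves_within :: "com \<Rightarrow> nat bnfp set \<Rightarrow> (nat \<Rightarrow> nat \<Rightarrow> nat) \<Rightarrow> bool" where
  "solves_within P \<I> T \<longleftrightarrow>
     (\<forall>I\<in>\<I>. \<forall>es s. input_state I es s \<longrightarrow>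
        (\<exists>t s'. exec P s t s' \<and> output_state I es s' \<and>
           t \<le> T (card (pverts (network I))) (card (parcs (network I)))))"

text \<open>
  The vertex supplies alone occupy \<open>n\<close> cells, all of which have to be inspected, whereas the
  time bound we are interested in does not dominate \<open>n\<close> if most vertices are isolated. The usual
  convention that the input size is governed by the number of arcs, \<open>n = O(m)\<close>, is made explicit
  by the parameter \<open>K\<close>: asymptotic bounds in \<open>n\<close> and \<open>m\<close> are uniform in \<open>2 \<le> n \<le> K m\<close>. Graphs
  without isolated vertices satisfy \<open>n \<le> 2 m\<close>. The requirement \<open>2 \<le> n\<close> makes \<open>log n\<close> positive.
\<close>

definition size_regime :: "nat \<Rightarrow> (nat \<times> nat) filter" where
  "size_regime K = principal {(n, m). 2 \<le> n \<and> n \<le> K * m}"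

end

theory Submission
  imports Defs
begin

text \<open>
  Sort the arcs by weight and let \<open>feas r\<close> mean that some real flow uses only the \<open>r\<close> lightest arcs;
  the task is to find the least such \<open>r\<close> together with an integral flow.

  For a fixed \<open>r\<close>, push-relabel with distance labels cut off at \<open>k\<close> takes time \<open>O(k (n + m))\<close>, because
  on unit capacities every push can also advance the current-arc pointer. In the end all excess sits
  at label \<open>k\<close> or above. If \<open>feas r\<close> holds, then each of the \<open>k\<close> cuts between consecutive labels bounds
  the remaining excess \<open>F\<close> by its number of residual arcs; there are \<open>m\<close> residual arcs altogether, and
  no two parallel arcs, whence \<open>F \<le> m / k\<close> and \<open>F \<le> 2 n\<^sup>2 / k\<^sup>2\<close>. With \<open>L \<approx> log n\<close> and \<open>k\<close> the least
  number satisfying \<open>m \<le> k\<^sup>2 L\<close> or \<open>n\<^sup>2 \<le> k\<^sup>3 L\<close>, this gives \<open>F \<le> 2 k L\<close>.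

  A binary search with this one-sided test (\<open>F > 2 k L\<close> refutes \<open>feas r\<close>) ends in a threshold that is
  not above the optimum, with a pseudoflow of excess at most \<open>2 k L\<close>. The excess is then
  removed one unit at a time by graph searches of cost \<open>O(n + m)\<close>; whenever a search gets stuck, the
  reached set proves \<open>feas r\<close> false and \<open>r\<close> is raised by one within the same search. Both parts take
  time \<open>O(k L (n + m))\<close>, and the choice of \<open>k\<close> turns \<open>k L\<close> into the minimum of \<open>(n log n)\<^bsup>2/3\<^esup>\<close> and
  \<open>(m log n)\<^bsup>1/2\<^esup>\<close>.
\<close>

section \<open>A calculus for timed total correctness\<close>

text \<open>The test is one-sided by nature: excess stranded at label \<open>k\<close> says nothing
  unless there is too much of it, so a passed test proves neither feasibility nor infeasibility. The
  binary search is therefore asymmetric. Below \<open>lo\<close> infeasibility is proved, while at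
  \<open>hi\<close> there is only a pseudoflow of small excess. This is harmless: the final phase
  starts with \<open>hi <= lo\<close> and raises the threshold only on a proof of infeasibility, so
  it stops exactly at the least feasible threshold. Neither an integrality theorem nor max-flow
  min-cut is invoked: cuts compare the integral pseudoflow directly with an arbitrary real flow, and
  the integral optimum is constructed. The choice of \<open>k\<close> balances two costs: about
  \<open>L\<close> tests of cost \<open>k (n + m)\<close> each, against at most \<open>2 k L\<close>
  units of leftover excess at \<open>n + m\<close> each. \<open>L\<close> counts the binary digits
  of \<open>m\<close>; it is \<open>O(log n)\<close> because a graph without multiple arcs has
  \<open>m <= n^2\<close>, and \<open>n + m\<close> is \<open>O(m)\<close> by the size regime. Time
  is an absolute clock inside postconditions, paid for by integer potentials.\<close>

definition wp :: "com \<Rightarrow> (state \<Rightarrow> int \<Rightarrow> bool) \<Rightarrow> state \<Rightarrow> int \<Rightarrow> bool" where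
  "wp c Q s t \<longleftrightarrow> (\<exists>u s'. exec c s u s' \<and> Q s' (t + int u))"

fun writes :: "com \<Rightarrow> string set" where
  "writes Skip = {}"
| "writes (Store a e f) = {a}"
| "writes (Seq c d) = writes c \<union> writes d"
| "writes (IfPos e c d) = writes c \<union> writes d"
| "writes (WhilePos e c) = writes c"

definition cost :: "exp \<Rightarrow> int" where
  "cost e = int (eval_cost e)"

lemma cost_simps [simp]:
  "cost (Const k) = 1"
  "cost (Cell a e) = 1 + cost e"
  "cost (Add e f) = 1 + cost e + cost f"
  "cost (Sub e f) = 1 + cost e + cost f"
  by (simp_all add: cost_def)

text \<open>A frame condition by whole arrays: with \<open>W\<close> the arrays that a program
  writes, every fact about other arrays survives its run.\<close>

definition agree :: "string set \<Rightarrow> state \<Rightarrow> state \<Rightarrow> bool" where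
  "agree W s s0 \<longleftrightarrow> (\<forall>a. a \<notin> W \<longrightarrow> s a = s0 a)"

lemma agree_refl: "agree W s s"
  by (simp add: agree_def)

lemma agree_trans: "agree W s s1 \<Longrightarrow> agree W' s1 s0 \<Longrightarrow> W \<union> W' \<subseteq> W'' \<Longrightarrow> agree W'' s s0"
  unfolding agree_def by (metis subsetD Un_iff)

lemma exec_agree: "exec c s t s' \<Longrightarrow> agree (writes c) s' s"
  by (induction rule: exec.induct) (auto simp: agree_def)

text \<open>The frame fact comes for free, so the specification of a subprogram mentions only what
  it changes; everything else is recovered from \<open>writes\<close> at each use.\<close>

lemma wp_mono:
  "wp c Q s t \<Longrightarrow> (\<And>s' t'. Q s' t' \<Longrightarrow> agree (writes c) s' s \<Longrightarrow> Q' s' t') \<Longrightarrow> wp c Q' s t"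
  unfolding wp_def using exec_agree by blast

text \<open>As equivalences, this and the next rules let the simplifier execute loop-free code
  symbolically; here determinism pins down the only outcome.\<close>

lemma wp_Skip [simp]: "wp Skip Q s t \<longleftrightarrow> Q s (t + 1)"
proof -
  have "exec Skip s u s' \<longleftrightarrow> u = 1 \<and> s' = s" for u s'
    by (metis exec.Skip exec_deterministic)
  then show ?thesis by (simp add: wp_def)
qed

lemma wp_Store [simp]:
  "wp (Store a e f) Q s t \<longleftrightarrow>
    Q (s(a := (s a)(eval e s := eval f s))) (t + (1 + cost e + cost f))"
proof -
  have "exec (Store a e f) s u s' \<longleftrightarrow>
      u = 1 + eval_cost e + eval_cost f \<and> s' = s(a := (s a)(eval e s := eval f s))" for u s'
    by (metis exec.Store exec_deterministic)
  then show ?thesis by (simp add: wp_def cost_def add.assoc)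
qed

text \<open>Since postconditions see the absolute clock rather than a duration, sequencing is plain
  nesting and no durations have to be added.\<close>

lemma wp_Seq [simp]: "wp (Seq c d) Q s t \<longleftrightarrow> wp c (wp d Q) s t"
proof
  assume "wp (Seq c d) Q s t"
  then obtain u s' where e: "exec (Seq c d) s u s'" and q: "Q s' (t + int u)"
    by (auto simp: wp_def)
  from e show "wp c (wp d Q) s t"
  proof cases
    case (Seq u1 s1 u2)
    then show ?thesis using q by (auto simp: wp_def add.assoc intro!: exI)
  qed
next
  assume "wp c (wp d Q) s t"
  then obtain u1 s1 u2 s2 where "exec c s u1 s1" "exec d s1 u2 s2" "Q s2 (t + int u1 + int u2)"
    by (auto simp: wp_def)
  then show "wp (Seq c d) Q s t"
    using exec.Seq unfolding wp_def by (metis add.assoc of_nat_add)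
qed

lemma wp_IfPos [simp]:
  "wp (IfPos e c d) Q s t \<longleftrightarrow>
    (if eval e s > 0 then wp c Q s (t + (1 + cost e))
     else wp d Q s (t + (1 + cost e)))"
proof (cases "eval e s > 0")
  case True
  then have "exec (IfPos e c d) s u s' \<longleftrightarrow> (\<exists>v. u = 1 + eval_cost e + v \<and> exec c s v s')" for u s'
    using exec.IfTrue by (auto elim: exec.cases simp del: add_Suc One_nat_def)
  with True show ?thesis
    by (simp add: wp_def cost_def del: add_Suc One_nat_def)
      (metis add.assoc of_nat_1 of_nat_add)
next
  case False
  then have "exec (IfPos e c d) s u s' \<longleftrightarrow> (\<exists>v. u = 1 + eval_cost e + v \<and> exec d s v s')" for u s'
    using exec.IfFalse by (auto elim: exec.cases simp del: add_Suc One_nat_def)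
  with False show ?thesis
    by (simp add: wp_def cost_def del: add_Suc One_nat_def)
      (metis add.assoc of_nat_1 of_nat_add)
qed

text \<open>
  The bound \<open>B\<close> on the clock makes a separate termination measure unnecessary, since every
  iteration takes time.
\<close>

lemma wp_While:
  assumes I0: "I s0 t0"
    and bound: "\<And>s t. I s t \<Longrightarrow> agree (writes c) s s0 \<Longrightarrow> t \<le> B"
    and body: "\<And>s t. I s t \<Longrightarrow> agree (writes c) s s0 \<Longrightarrow> eval e s > 0 \<Longrightarrow>
      wp c I s (t + (1 + cost e))"
    and exit: "\<And>s t. I s t \<Longrightarrow> agree (writes c) s s0 \<Longrightarrow> eval e s \<le> 0 \<Longrightarrow>
      Q s (t + (1 + cost e))"
  shows "wp (WhilePos e c) Q s0 t0"
proof -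
  have "I s t \<Longrightarrow> agree (writes c) s s0 \<Longrightarrow> wp (WhilePos e c) Q s t" for s t
  proof (induction "nat (B - t)" arbitrary: s t rule: less_induct)
    case less
    show ?case
    proof (cases "eval e s > 0")
      case True
      with body less.prems obtain u s' where
        e: "exec c s u s'" and i: "I s' (t + (1 + cost e) + int u)"
        unfolding wp_def by blast
      from exec_agree[OF e] less.prems(2) have f: "agree (writes c) s' s0"
        by (auto intro: agree_trans)
      let ?t = "t + (1 + cost e) + int u"
      have "?t \<le> B" using bound i f by blast
      then have "nat (B - ?t) < nat (B - t)" by (simp add: cost_def)
      from less.hyps[OF this i f] obtain u' s'' where
        "exec (WhilePos e c) s' u' s''" "Q s'' (?t + int u')"
        unfolding wp_def by blast
      with exec.WhileTrue[OF True e] show ?thesis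
        unfolding wp_def by (intro exI[of _ "1 + eval_cost e + u + u'"] exI[of _ s''])
          (simp add: cost_def add.assoc)
    next
      case False
      with exit[OF less.prems] show ?thesis
        unfolding wp_def by (intro exI[of _ "1 + eval_cost e"] exI[of _ s])
          (simp add: cost_def exec.WhileFalse del: add_Suc One_nat_def)
    qed
  qed
  with I0 show ?thesis by (simp add: agree_refl)
qed

abbreviation Var :: "string \<Rightarrow> exp" where "Var a \<equiv> Cell a (Const 0)"
abbreviation Assign :: "string \<Rightarrow> exp \<Rightarrow> com" (infix "::=" 62) where "a ::= e \<equiv> Store a (Const 0) e"
abbreviation Semi :: "com \<Rightarrow> com \<Rightarrow> com" (infixr ";;" 60) where "c ;; d \<equiv> Seq c d"
abbreviation One :: exp where "One \<equiv> Const 1"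

section \<open>Cuts and distance labels\<close>

text \<open>Vertices and arcs are intervals of machine integers. In the intended instance the arcs
  are numbered by increasing weight, so a threshold is a bound on arc indices. The bound quadratic
  in \<open>N\<close> rests on \<open>simple\<close>; loops are permitted and cancel in the
  balance.\<close>

locale flow_network =
  fixes N M :: int and src dst b :: "int \<Rightarrow> int"
  assumes N_nonneg: "0 \<le> N" and M_nonneg: "0 \<le> M"
    and src_range: "j \<in> {0..<M} \<Longrightarrow> src j \<in> {0..<N}"
    and dst_range: "j \<in> {0..<M} \<Longrightarrow> dst j \<in> {0..<N}"
    and simple: "i \<in> {0..<M} \<Longrightarrow> j \<in> {0..<M} \<Longrightarrow> src i = src j \<Longrightarrow> dst i = dst j \<Longrightarrow> i = j"
    and balanced: "(\<Sum>v\<in>{0..<N}. b v) = 0"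
begin

text \<open>
  Half-edge \<open>g < M\<close> is arc \<open>g\<close> traversed forwards, half-edge \<open>g \<ge> M\<close> is arc \<open>g - M\<close> traversed
  backwards. A half-edge is residual if the current flow on its arc equals \<open>dir g\<close>.
\<close>

definition hv :: "int \<Rightarrow> int" where "hv g = (if g < M then src g else dst (g - M))"
definition hw :: "int \<Rightarrow> int" where "hw g = (if g < M then dst g else src (g - M))"
definition arc :: "int \<Rightarrow> int" where "arc g = (if g < M then g else g - M)"
definition dir :: "int \<Rightarrow> int" where "dir g = (if g < M then 0 else 1)"

definition incid :: "int \<Rightarrow> int \<Rightarrow> int" where
  "incid j v = of_bool (src j = v) - of_bool (dst j = v)"

definition excess :: "(int \<Rightarrow> int) \<Rightarrow> int \<Rightarrow> int" where
  "excess x v = b v - (\<Sum>j\<in>{0..<M}. x j * incid j v)"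

definition total_excess :: "(int \<Rightarrow> int) \<Rightarrow> int" where
  "total_excess e = (\<Sum>v\<in>{0..<N}. max 0 (e v))"

definition real_flow :: "int \<Rightarrow> (int \<Rightarrow> real) \<Rightarrow> bool" where
  "real_flow r y \<longleftrightarrow>
    (\<forall>v\<in>{0..<N}. (\<Sum>j\<in>{0..<M}. y j * of_int (incid j v)) = of_int (b v)) \<and>
    (\<forall>j\<in>{0..<M}. 0 \<le> y j \<and> y j \<le> 1) \<and> (\<forall>j\<in>{r..<M}. y j = 0)"

definition feas :: "int \<Rightarrow> bool" where "feas r \<longleftrightarrow> (\<exists>y. real_flow r y)"

definition unit_flow :: "int \<Rightarrow> (int \<Rightarrow> int) \<Rightarrow> bool" where
  "unit_flow r x \<longleftrightarrow> (\<forall>j\<in>{0..<M}. x j = 0 \<or> x j = 1 \<and> j < r)"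

definition residual :: "int \<Rightarrow> (int \<Rightarrow> int) \<Rightarrow> int \<Rightarrow> bool" where
  "residual r x g \<longleftrightarrow> g \<in> {0..<2*M} \<and> arc g < r \<and> x (arc g) = dir g"

lemma arc_range: "g \<in> {0..<2*M} \<Longrightarrow> arc g \<in> {0..<M}"
  by (auto simp: arc_def)

lemma hv_range: "g \<in> {0..<2*M} \<Longrightarrow> hv g \<in> {0..<N}"
  unfolding hv_def using src_range[of g] dst_range[of "g - M"] by auto

lemma hw_range: "g \<in> {0..<2*M} \<Longrightarrow> hw g \<in> {0..<N}"
  unfolding hw_def using dst_range[of g] src_range[of "g - M"] by auto

lemma dir_cases: "dir g = 0 \<or> dir g = 1"
  by (auto simp: dir_def)

lemma half_edge_eqI: "arc g = arc h \<Longrightarrow> dir g = dir h \<Longrightarrow> g = h"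
  by (auto simp: arc_def dir_def split: if_splits)

lemma opposite:
  assumes "arc g = arc h" "dir g \<noteq> dir h"
  shows "hv g = hw h" "hw g = hv h"
  using assms by (auto simp: arc_def dir_def hv_def hw_def split: if_splits)

text \<open>The flow value on a unit arc is matched by only one of its two directions, so there are
  at most \<open>M\<close> residual half-edges in all.\<close>

lemma residual_unique: "residual r x g \<Longrightarrow> residual r x h \<Longrightarrow> arc g = arc h \<Longrightarrow> g = h"
  by (simp add: residual_def half_edge_eqI)

text \<open>Every push saturates its unit arc: \<open>h\<close> disappears and only its reverse can
  be new.\<close>

lemma residual_push:
  assumes "residual r x h" "residual r (x(arc h := 1 - dir h)) g"
  shows "residual r x g \<and> g \<noteq> h \<or> hv g = hw h \<and> hw g = hv h"
proof (cases "arc g = arc h")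
  case True
  then have "dir g \<noteq> dir h" using assms dir_cases[of h] by (auto simp: residual_def)
  with True opposite show ?thesis by blast
qed (use assms in \<open>auto simp: residual_def\<close>)

lemma residual_push_keep:
  assumes "residual r x h" "residual r x g" "g \<noteq> h"
  shows "residual r (x(arc h := 1 - dir h)) g"
  using assms residual_unique[OF assms(2,1)] by (auto simp: residual_def)

lemma unit_flow_push:
  "residual r x h \<Longrightarrow> unit_flow r x \<Longrightarrow> unit_flow r (x(arc h := 1 - dir h))"
  using dir_cases[of h] by (auto simp: unit_flow_def residual_def)

lemma excess_push:
  assumes "residual r x h"
  shows "excess (x(arc h := 1 - dir h)) v = excess x v - of_bool (v = hv h) + of_bool (v = hw h)"
proof -
  let ?a = "arc h"
  have a: "?a \<in> {0..<M}" using assms arc_range by (auto simp: residual_def)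
  have "(\<Sum>j\<in>{0..<M}. (x(?a := 1 - dir h)) j * incid j v)
      = (1 - dir h) * incid ?a v + (\<Sum>j\<in>{0..<M} - {?a}. x j * incid j v)"
    using a by (subst sum.remove[of _ ?a]) (auto intro!: sum.cong)
  moreover have "(\<Sum>j\<in>{0..<M}. x j * incid j v)
      = dir h * incid ?a v + (\<Sum>j\<in>{0..<M} - {?a}. x j * incid j v)"
    using a assms by (subst sum.remove[of _ ?a]) (auto simp: residual_def)
  \<comment> \<open>\<open>1 - 2 * dir h\<close> is the change of the flow value on the arc: 1 for a
    forward half-edge, -1 for a backward one.\<close>
  moreover have "(1 - 2 * dir h) * incid ?a v = of_bool (v = hv h) - of_bool (v = hw h)"
    by (auto simp: incid_def dir_def arc_def hv_def hw_def)
  ultimately show ?thesis by (simp add: excess_def algebra_simps)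
qed

lemma sum_excess: "(\<Sum>v\<in>{0..<N}. excess x v) = 0"
proof -
  have "(\<Sum>v\<in>{0..<N}. incid j v) = 0" if "j \<in> {0..<M}" for j
    using src_range[OF that] dst_range[OF that]
    by (simp add: incid_def sum_subtractf of_bool_def)
  then have "(\<Sum>v\<in>{0..<N}. \<Sum>j\<in>{0..<M}. x j * incid j v) = 0"
    by (subst sum.swap) (simp flip: sum_distrib_left)
  then show ?thesis by (simp add: excess_def sum_subtractf balanced)
qed

section \<open>Total excess and cuts\<close>

lemma total_excess_nonneg: "0 \<le> total_excess e"
  by (auto simp: total_excess_def intro: sum_nonneg)

text \<open>All excesses sum to zero, so without positive excess there is no deficit either, and the
  pseudoflow is a flow.\<close>

lemma total_excess_eq_0:
  assumes "total_excess (excess x) = 0" "v \<in> {0..<N}"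
  shows "excess x v = 0"
proof -
  have "\<forall>u\<in>{0..<N}. max 0 (excess x u) = 0"
    using assms(1) unfolding total_excess_def by (subst (asm) sum_nonneg_eq_0_iff) auto
  then have le: "excess x u \<le> 0" if "u \<in> {0..<N}" for u
    using that by (metis max.cobounded2)
  then have "(\<Sum>v\<in>{0..<N}. - excess x v) = 0 \<longleftrightarrow> (\<forall>v\<in>{0..<N}. - excess x v = 0)"
    by (intro sum_nonneg_eq_0_iff) auto
  then show ?thesis using assms(2) sum_excess[of x] by (simp add: sum_negf)
qed

text \<open>Conservation of the real flow \<open>y\<close> makes the excess in \<open>S\<close>
  equal to the net amount that \<open>y - x\<close> carries out of \<open>S\<close>. Arc by arc this
  is at most 1, and it can be positive only where \<open>x\<close> has a residual half-edge leaving
  \<open>S\<close>.\<close>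

lemma cut_bound:
  assumes "feas r" "unit_flow r x" "S \<subseteq> {0..<N}"
  shows "(\<Sum>v\<in>S. excess x v) \<le> int (card {g. residual r x g \<and> hv g \<in> S \<and> hw g \<notin> S})"
proof -
  let ?C = "{g. residual r x g \<and> hv g \<in> S \<and> hw g \<notin> S}"
  have finC: "finite ?C" by (rule finite_subset[of _ "{0..<2*M}"]) (auto simp: residual_def)
  have finS: "finite S" using assms(3) finite_subset by blast
  from assms(1) obtain y where y: "real_flow r y" by (auto simp: feas_def)
  have "real_of_int (\<Sum>v\<in>S. excess x v)
      = (\<Sum>v\<in>S. \<Sum>j\<in>{0..<M}. (y j - of_int (x j)) * of_int (incid j v))"
    unfolding of_int_sum
  proof (rule sum.cong[OF refl])
    fix v assume "v \<in> S"
    then have "(\<Sum>j\<in>{0..<M}. y j * of_int (incid j v)) = of_int (b v)"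
      using y assms(3) by (auto simp: real_flow_def)
    then show "real_of_int (excess x v) = (\<Sum>j\<in>{0..<M}. (y j - of_int (x j)) * of_int (incid j v))"
      by (simp add: excess_def left_diff_distrib sum_subtractf)
  qed
  also have "\<dots> = (\<Sum>j\<in>{0..<M}. (y j - of_int (x j)) * (\<Sum>v\<in>S. of_int (incid j v)))"
    by (subst sum.swap) (simp add: sum_distrib_left)
  also have "\<dots> \<le> (\<Sum>j\<in>{0..<M}. of_bool (j \<in> arc ` ?C))"
  proof (rule sum_mono)
    fix j assume j: "j \<in> {0..<M}"
    have "(\<Sum>v\<in>S. real_of_int (incid j v)) = of_bool (src j \<in> S) - of_bool (dst j \<in> S)"
      using finS by (simp add: incid_def sum_subtractf of_bool_def if_distrib[of real_of_int] cong: if_cong)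
    moreover have "j \<in> arc ` ?C" if "src j \<in> S" "dst j \<notin> S" "x j = 0" "j < r"
      by (rule image_eqI[of _ _ j]) (use that j in \<open>auto simp: residual_def arc_def dir_def hv_def hw_def\<close>)
    moreover have "j \<in> arc ` ?C" if "src j \<notin> S" "dst j \<in> S" "x j = 1" "j < r"
      by (rule image_eqI[of _ _ "j + M"])
        (use that j in \<open>auto simp: residual_def arc_def dir_def hv_def hw_def\<close>)
    moreover have "0 \<le> y j" "y j \<le> 1" "r \<le> j \<longrightarrow> y j = 0" "x j = 0 \<or> x j = 1 \<and> j < r"
      using y j assms(2) by (auto simp: real_flow_def unit_flow_def)
    ultimately show "(y j - of_int (x j)) * (\<Sum>v\<in>S. of_int (incid j v)) \<le> of_bool (j \<in> arc ` ?C)"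
      by (cases "src j \<in> S"; cases "dst j \<in> S"; cases "j < r") auto
  qed
  also have "\<dots> = real (card ({0..<M} \<inter> arc ` ?C))"
    by (simp add: of_bool_def flip: sum.inter_restrict)
  also have "\<dots> \<le> real (card ?C)"
    using finC by (meson card_image_le card_mono finite_imageI inf_le2 le_trans of_nat_mono)
  finally show ?thesis by linarith
qed

lemma total_excess_cut:
  assumes "S \<subseteq> {0..<N}" "\<And>v. v \<in> {0..<N} \<Longrightarrow> 0 < e v \<Longrightarrow> v \<in> S" "\<And>v. v \<in> S \<Longrightarrow> 0 \<le> e v"
  shows "total_excess e = (\<Sum>v\<in>S. e v)"
proof -
  have "total_excess e = (\<Sum>v\<in>S. max 0 (e v))"
    unfolding total_excess_def
  proof (intro sum.mono_neutral_right ballI)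
    fix v assume "v \<in> {0..<N} - S"
    then show "max 0 (e v) = 0" using assms(2)[of v] by force
  qed (use assms(1) in auto)
  also have "\<dots> = (\<Sum>v\<in>S. e v)" using assms(3) by (intro sum.cong) auto
  finally show ?thesis .
qed

text \<open>The certificate read off from a stuck search: no residual half-edge crosses the cut, so
  a flow would force the excess of \<open>S\<close> to be at most 0, yet \<open>S\<close> carries
  the entire positive excess.\<close>

lemma closed_set_infeasible:
  assumes "unit_flow r x" "S \<subseteq> {0..<N}"
    and "\<And>v. v \<in> {0..<N} \<Longrightarrow> 0 < excess x v \<Longrightarrow> v \<in> S" "\<And>v. v \<in> S \<Longrightarrow> 0 \<le> excess x v"
    and "\<And>g. residual r x g \<Longrightarrow> hv g \<in> S \<Longrightarrow> hw g \<in> S"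
    and "0 < total_excess (excess x)"
  shows "\<not> feas r"
proof
  assume "feas r"
  have "(\<Sum>v\<in>S. excess x v) \<le> 0"
  proof -
    have empty: "{g. residual r x g \<and> hv g \<in> S \<and> hw g \<notin> S} = {}"
      using assms(5) by blast
    show ?thesis using cut_bound[OF \<open>feas r\<close> assms(1,2)] by (simp add: empty)
  qed
  moreover have "total_excess (excess x) = (\<Sum>v\<in>S. excess x v)"
    by (rule total_excess_cut[OF assms(2-4)])
  ultimately show False using assms(6) by linarith
qed

text \<open>The valid labels of push-relabel: lower bounds on the residual distance to a deficit
  vertex.\<close>

definition labelling :: "int \<Rightarrow> (int \<Rightarrow> int) \<Rightarrow> (int \<Rightarrow> int) \<Rightarrow> bool" where
  "labelling r x d \<longleftrightarrow> (\<forall>v\<in>{0..<N}. 0 \<le> d v \<and> (excess x v < 0 \<longrightarrow> d v = 0)) \<and>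
     (\<forall>g. residual r x g \<longrightarrow> d (hv g) \<le> d (hw g) + 1)"

text \<open>Excess sits at level \<open>k\<close> or above and deficits at level 0, so each level
  \<open>j\<close> in \<open>{1..k}\<close> gives a cut for \<open>cut_bound\<close>, and valid
  labels confine its residual half-edges to the levels \<open>j\<close> and \<open>j - 1\<close>.
  The first bound counts half-edges over these disjoint cuts, the second counts vertices on the
  levels.\<close>

lemma level_bounds:
  assumes "feas r" "unit_flow r x" "labelling r x d" "1 \<le> k"
    and exc: "\<And>v. v \<in> {0..<N} \<Longrightarrow> 0 < excess x v \<Longrightarrow> k \<le> d v"
  shows "total_excess (excess x) * k \<le> M" "total_excess (excess x) * k\<^sup>2 \<le> 2 * N\<^sup>2"
proof -
  let ?F = "total_excess (excess x)"
  let ?V = "\<lambda>j. {v \<in> {0..<N}. d v = j}"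
  let ?C = "\<lambda>j. {g. residual r x g \<and> d (hv g) = j \<and> d (hw g) = j - 1}"
  have fin: "finite {g. residual r x g}"
    by (rule finite_subset[of _ "{0..<2*M}"]) (auto simp: residual_def)
  have finC: "finite (?C j)" for j by (rule finite_subset[OF _ fin]) auto
  have FC: "?F \<le> int (card (?C j))" if j: "j \<in> {1..k}" for j
  proof -
    let ?S = "{v \<in> {0..<N}. j \<le> d v}"
    have "?F = (\<Sum>v\<in>?S. excess x v)"
    proof (rule total_excess_cut)
      show "v \<in> ?S" if "v \<in> {0..<N}" "0 < excess x v" for v
        using exc[OF that] that j by simp
      show "0 \<le> excess x v" if "v \<in> ?S" for v
        using assms(3) that j by (force simp: labelling_def)
    qed auto
    also have "\<dots> \<le> int (card {g. residual r x g \<and> hv g \<in> ?S \<and> hw g \<notin> ?S})"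
      using assms(1,2) by (intro cut_bound) auto
    also have "\<dots> \<le> int (card (?C j))"
    proof -
      have "{g. residual r x g \<and> hv g \<in> ?S \<and> hw g \<notin> ?S} \<subseteq> ?C j"
      proof
        fix g assume "g \<in> {g. residual r x g \<and> hv g \<in> ?S \<and> hw g \<notin> ?S}"
        then have g: "residual r x g" "j \<le> d (hv g)" "hw g \<notin> ?S" by auto
        then have "hw g \<in> {0..<N}" "d (hv g) \<le> d (hw g) + 1"
          using assms(3) hw_range by (auto simp: labelling_def residual_def)
        with g show "g \<in> ?C j" by simp
      qed
      then show ?thesis using card_mono[OF finC] by simp
    qed
    finally show ?thesis .
  qed
  have "?F * k \<le> (\<Sum>j\<in>{1..k}. int (card (?C j)))"
    using sum_mono[of "{1..k}" "\<lambda>_. ?F", OF FC] assms(4) by (simp add: mult.commute)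
  also have "\<dots> = int (card (\<Union>j\<in>{1..k}. ?C j))"
    using finC by (subst card_UN_disjoint) auto
  also have "\<dots> \<le> int (card {g. residual r x g})"
    using card_mono[OF fin, of "\<Union>j\<in>{1..k}. ?C j"] by auto
  also have "\<dots> = int (card (arc ` {g. residual r x g}))"
  proof -
    have "inj_on arc {g. residual r x g}"
      by (rule inj_onI) (use residual_unique in blast)
    then show ?thesis by (simp add: card_image)
  qed
  also have "\<dots> \<le> int (card {0..<M})"
    using arc_range by (intro of_nat_mono card_mono) (auto simp: residual_def)
  finally show "?F * k \<le> M" using M_nonneg by simp
  have finV: "finite (?V j)" for j by (rule finite_subset[of _ "{0..<N}"]) auto
  \<comment> \<open>The factor 2: an ordered pair of endpoints can be joined both by an arc taken
    forwards and by an antiparallel arc taken backwards.\<close>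
  have CV: "card (?C j) \<le> 2 * (card (?V j) * card (?V (j - 1)))" for j
  proof -
    have "card (?C j) = card ((\<lambda>g. (dir g, hv g, hw g)) ` ?C j)"
    proof (rule card_image[symmetric])
      show "inj_on (\<lambda>g. (dir g, hv g, hw g)) (?C j)"
      proof (rule inj_onI)
        fix g h assume "g \<in> ?C j" "h \<in> ?C j" and eq: "(dir g, hv g, hw g) = (dir h, hv h, hw h)"
        then have "g \<in> {0..<2*M}" "h \<in> {0..<2*M}" by (auto simp: residual_def)
        with eq have "arc g = arc h"
          by (intro simple[OF arc_range arc_range]) (auto simp: dir_def hv_def hw_def arc_def split: if_splits)
        with eq show "g = h" by (simp add: half_edge_eqI)
      qed
    qed
    also have "\<dots> \<le> card ({0, 1::int} \<times> ?V j \<times> ?V (j - 1))"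
    proof (rule card_mono)
      show "(\<lambda>g. (dir g, hv g, hw g)) ` ?C j \<subseteq> {0, 1::int} \<times> ?V j \<times> ?V (j - 1)"
      proof (rule image_subsetI)
        fix g assume "g \<in> ?C j"
        then show "(dir g, hv g, hw g) \<in> {0, 1::int} \<times> ?V j \<times> ?V (j - 1)"
          using dir_cases[of g] hv_range[of g] hw_range[of g] by (simp add: residual_def)
      qed
    qed (intro finite_cartesian_product finV finite.intros)
    finally show ?thesis by (simp add: card_cartesian_product)
  qed
  \<comment> \<open>The offset \<open>i\<close> is 0 or 1, for the upper and the lower level of each
    cut; a vertex lies on only one level, so either sum is at most \<open>N\<close>.\<close>
  have V: "(\<Sum>j\<in>{1..k}. card (?V (j - i))) \<le> nat N" for i
  proof -
    have "(\<Sum>j\<in>{1..k}. card (?V (j - i))) = card (\<Union>j\<in>{1..k}. ?V (j - i))"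
      using finV by (subst card_UN_disjoint) auto
    also have "\<dots> \<le> card {0..<N}" by (intro card_mono) auto
    finally show ?thesis by simp
  qed
  \<comment> \<open>Arithmetic-geometric mean: \<open>2 F <= 4 p q <= (p + q)^2\<close>. Taking
    roots makes the right side linear in the level sizes, which can be summed.\<close>
  have s: "sqrt (2 * ?F) \<le> real (card (?V j) + card (?V (j - 1)))" if "j \<in> {1..k}" for j
  proof (rule real_le_lsqrt)
    let ?p = "card (?V j)" and ?q = "card (?V (j - 1))"
    have "real_of_int ?F \<le> real (card (?C j))" using FC[OF that] by linarith
    also have "\<dots> \<le> real (2 * (?p * ?q))" using CV by (intro of_nat_mono)
    finally have "real_of_int ?F \<le> 2 * (real ?p * real ?q)" by simp
    moreover have "0 \<le> (real ?p - real ?q)\<^sup>2" by simp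
    ultimately show "real_of_int (2 * ?F) \<le> (real (?p + ?q))\<^sup>2"
      by (simp add: power2_eq_square algebra_simps)
  qed simp
  have "k * sqrt (2 * ?F) = (\<Sum>j\<in>{1..k}. sqrt (2 * ?F))" using assms(4) by simp
  also have "\<dots> \<le> (\<Sum>j\<in>{1..k}. real (card (?V j) + card (?V (j - 1))))"
    by (intro sum_mono s)
  also have "\<dots> = real ((\<Sum>j\<in>{1..k}. card (?V (j - 0))) + (\<Sum>j\<in>{1..k}. card (?V (j - 1))))"
    by (simp add: sum.distrib)
  also have "\<dots> \<le> real (nat N + nat N)" by (intro of_nat_mono add_mono V)
  also have "\<dots> = 2 * N" using N_nonneg by simp
  finally have "(k * sqrt (2 * ?F))\<^sup>2 \<le> (real_of_int (2 * N))\<^sup>2"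
    using assms(4) total_excess_nonneg by (intro power_mono) auto
  then have "real_of_int (2 * (?F * k\<^sup>2)) \<le> real_of_int (2 * (2 * N\<^sup>2))"
    using total_excess_nonneg[of "excess x"] by (simp add: power_mult_distrib)
  then show "?F * k\<^sup>2 \<le> 2 * N\<^sup>2" by linarith
qed

end

section \<open>Loops and parameters\<close>

definition For :: "string \<Rightarrow> string \<Rightarrow> com \<Rightarrow> com" where
  "For v u c = (v ::= Const 0 ;; WhilePos (Sub (Var u) (Var v)) (c ;; v ::= Add (Var v) One))"

lemma writes_For [simp]: "writes (For v u c) = insert v (writes c)"
  by (auto simp: For_def)

text \<open>\<open>k\<close> bounds one run of the body. The 12 is loop test plus increment (6
  each), the 9 is initialisation plus final test (3 and 6). The invariant is re-established with
  \<open>v\<close> already set to \<open>i + 1\<close>, because the increment follows the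
  body.\<close>

lemma wp_For:
  assumes frame: "v \<notin> writes c" "u \<notin> writes c" "u \<noteq> v"
    and h: "s0 u 0 = h" "0 \<le> h" and "0 \<le> k"
    and init: "I 0 (s0(v := (s0 v)(0 := 0)))"
    and body: "\<And>i s t. 0 \<le> i \<Longrightarrow> i < h \<Longrightarrow> I i s \<Longrightarrow> s v 0 = i \<Longrightarrow> agree (insert v (writes c)) s s0 \<Longrightarrow>
      wp c (\<lambda>s' t'. t' \<le> t + k \<and> I (i + 1) (s'(v := (s' v)(0 := i + 1)))) s t"
    and exit: "\<And>s t. I h s \<Longrightarrow> s v 0 = h \<Longrightarrow> agree (insert v (writes c)) s s0 \<Longrightarrow>
      t \<le> t0 + (k + 12) * h + 9 \<Longrightarrow> Q s t"
  shows "wp (For v u c) Q s0 t0"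
proof -
  let ?s = "s0(v := (s0 v)(0 := 0))"
  let ?J = "\<lambda>s t. 0 \<le> s v 0 \<and> s v 0 \<le> h \<and> I (s v 0) s \<and> t \<le> t0 + 3 + (k + 12) * s v 0"
  have ag: "agree (insert v (writes c)) s s0"
    if "agree (writes (c ;; v ::= Add (Var v) One)) s ?s" for s
    using that by (auto simp: agree_def)
  then have u: "s u 0 = h" if "agree (writes (c ;; v ::= Add (Var v) One)) s ?s" for s
    using that frame h by (simp add: agree_def)
  have "wp (WhilePos (Sub (Var u) (Var v)) (c ;; v ::= Add (Var v) One)) Q ?s (t0 + 3)"
  proof (rule wp_While[where I = ?J and B = "t0 + 3 + (k + 12) * h"])
    show "?J ?s (t0 + 3)" using init h by simp
    show "t \<le> t0 + 3 + (k + 12) * h" if "?J s t" for s t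
    proof -
      have "(k + 12) * s v 0 \<le> (k + 12) * h" using that \<open>0 \<le> k\<close> by (intro mult_left_mono) auto
      with that show ?thesis by linarith
    qed
    show "wp (c ;; v ::= Add (Var v) One) ?J s (t + (1 + cost (Sub (Var u) (Var v))))"
      if J: "?J s t" and a: "agree (writes (c ;; v ::= Add (Var v) One)) s ?s"
        and pos: "eval (Sub (Var u) (Var v)) s > 0" for s t
    proof -
      have lt: "s v 0 < h" using pos u[OF a] by simp
      have "wp c (\<lambda>s' t'. t' \<le> t + 6 + k \<and> I (s v 0 + 1) (s'(v := (s' v)(0 := s v 0 + 1)))) s (t + 6)"
        using body[OF _ lt _ refl ag[OF a], of "t + 6"] J by simp
      then have "wp c (wp (v ::= Add (Var v) One) ?J) s (t + 6)"
      proof (rule wp_mono)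
        fix s' t'
        assume I': "t' \<le> t + 6 + k \<and> I (s v 0 + 1) (s'(v := (s' v)(0 := s v 0 + 1)))"
          and "agree (writes c) s' s"
        then have "s' v 0 = s v 0" using frame by (simp add: agree_def)
        with I' J lt show "wp (v ::= Add (Var v) One) ?J s' t'" by (simp add: algebra_simps)
      qed
      then show ?thesis by simp
    qed
    show "Q s (t + (1 + cost (Sub (Var u) (Var v))))"
      if J: "?J s t" and a: "agree (writes (c ;; v ::= Add (Var v) One)) s ?s"
        and pos: "eval (Sub (Var u) (Var v)) s \<le> 0" for s t
    proof -
      have "s v 0 = h" using J pos u[OF a] by simp
      with J exit[OF _ _ ag[OF a]] show ?thesis by simp
    qed
  qed
  then show ?thesis by (simp add: For_def)
qed

text \<open>The table replaces shifts and divisions: it gives the block widths of the sorting passes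
  and the step sizes of the binary search. \<open>L - 1\<close> becomes the number of binary digits
  of \<open>m\<close>.\<close>

definition powers :: com where
  "powers = (Store ''pow'' (Const 0) One ;; ''L'' ::= One ;;
    WhilePos (Sub (Add (Var ''m'') One) (Cell ''pow'' (Sub (Var ''L'') One)))
      (Store ''pow'' (Var ''L'') (Add (Cell ''pow'' (Sub (Var ''L'') One)) (Cell ''pow'' (Sub (Var ''L'') One))) ;;
       ''L'' ::= Add (Var ''L'') One))"

lemma writes_powers: "writes powers = {''pow'', ''L''}"
  by (auto simp: powers_def)

lemma less_two_power_int: "0 \<le> i \<Longrightarrow> i < (2::int) ^ nat i"
  using of_nat_less_two_power[of "nat i", where ?'a = int] by simp

lemma wp_powers:
  assumes m: "s ''m'' 0 = m" "0 \<le> m"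
  shows "wp powers (\<lambda>s' t'. \<exists>L. s' ''L'' 0 = L \<and> 1 \<le> L \<and> (\<forall>i\<in>{0..<L}. s' ''pow'' i = 2 ^ nat i) \<and>
    m < 2 ^ nat (L - 1) \<and> (2 \<le> L \<longrightarrow> 2 ^ nat (L - 2) \<le> m) \<and> t' \<le> t + 40 * L) s t"
proof -
  let ?J = "\<lambda>s' t'. \<exists>L. s' ''m'' 0 = m \<and> s' ''L'' 0 = L \<and> 1 \<le> L \<and> (\<forall>i\<in>{0..<L}. s' ''pow'' i = 2 ^ nat i) \<and>
    (2 \<le> L \<longrightarrow> 2 ^ nat (L - 2) \<le> m) \<and> t' \<le> t + 40 * L - 30"
  show ?thesis
    unfolding powers_def wp_Seq
    apply simp
    \<comment> \<open>The bound on the clock serves termination only: for \<open>L >= 2\<close> the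
      invariant \<open>2 ^ nat (L - 2) <= m\<close> keeps \<open>L\<close> below
      \<open>m + 2\<close>.\<close>
    apply (rule wp_While[where I = ?J and B = "t + 40 * (m + 2)"])
    subgoal using m by simp
    subgoal for s' t'
      apply clarsimp
      subgoal using less_two_power_int[of "s' ''L'' 0 - 2"] m by (cases "2 \<le> s' ''L'' 0") auto
      done
    subgoal for s' t'
    proof -
      assume "?J s' t'" and pos: "eval (Sub (Add (Var ''m'') One) (Cell ''pow'' (Sub (Var ''L'') One))) s' > 0"
      then obtain L where L: "s' ''m'' 0 = m" "s' ''L'' 0 = L" "1 \<le> L"
        "\<And>i. 0 \<le> i \<Longrightarrow> i < L \<Longrightarrow> s' ''pow'' i = 2 ^ nat i" "t' \<le> t + 40 * L - 30" by auto
      have "nat L = Suc (nat (L - 1))" using L(3) by simp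
      then have dbl: "2 ^ nat (L - 1) + 2 ^ nat (L - 1) = (2::int) ^ nat L" by simp
      have "2 ^ nat (L - 1) \<le> m" using pos L by simp
      then show ?thesis using L dbl by auto
    qed
    subgoal by auto
    done
qed

text \<open>
  Without multiplication, \<open>k1 = k L\<close>, \<open>k2 = k\<^sup>2 L\<close> and \<open>k3 = k\<^sup>3 L\<close> are maintained by finite differences.
\<close>

definition increase_k :: com where
  "increase_k =
    (IfPos (Sub (Var ''m'') (Var ''k2''))
      (IfPos (Sub (Var ''nn'') (Var ''k3''))
        (''k3'' ::= Add (Add (Var ''k3'') (Var ''L''))
            (Add (Add (Var ''k2'') (Add (Var ''k2'') (Var ''k2''))) (Add (Var ''k1'') (Add (Var ''k1'') (Var ''k1'')))) ;;
         ''k2'' ::= Add (Add (Var ''k2'') (Var ''L'')) (Add (Var ''k1'') (Var ''k1'')) ;;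
         ''k1'' ::= Add (Var ''k1'') (Var ''L'') ;;
         ''k'' ::= Add (Var ''k'') One)
        (''go'' ::= Const 0))
      (''go'' ::= Const 0))"

definition choose_k :: com where
  "choose_k = (''nn'' ::= Const 0 ;; For ''i'' ''n'' (''nn'' ::= Add (Var ''nn'') (Var ''n'')) ;;
    ''k'' ::= One ;; ''k1'' ::= Var ''L'' ;; ''k2'' ::= Var ''L'' ;; ''k3'' ::= Var ''L'' ;;
    ''go'' ::= One ;;
    WhilePos (Var ''go'') increase_k)"

lemma writes_increase_k: "writes increase_k = {''k'', ''k1'', ''k2'', ''k3'', ''go''}"
  by (auto simp: increase_k_def)

lemma writes_choose_k: "writes choose_k = {''nn'', ''i'', ''k'', ''k1'', ''k2'', ''k3'', ''go''}"
  by (auto simp: choose_k_def writes_increase_k)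

text \<open>Minimality is phrased as failure of all smaller \<open>j\<close>, which is what the loop
  has tested; \<open>label_bound_unique\<close> later identifies this \<open>k\<close> as a function
  of the input size.\<close>

definition balanced_k :: "int \<Rightarrow> int \<Rightarrow> int \<Rightarrow> int \<Rightarrow> bool" where
  "balanced_k n m L k \<longleftrightarrow> 1 \<le> k \<and> (m \<le> k\<^sup>2 * L \<or> n\<^sup>2 \<le> k ^ 3 * L) \<and>
    (\<forall>j. 1 \<le> j \<longrightarrow> j < k \<longrightarrow> j\<^sup>2 * L < m \<and> j ^ 3 * L < n\<^sup>2)"

lemma wp_choose_k:
  assumes "s ''n'' 0 = n" "0 \<le> n" "s ''m'' 0 = m" "0 \<le> m" "s ''L'' 0 = L" "1 \<le> L"
  shows "wp choose_k (\<lambda>s' t'. \<exists>k. s' ''k'' 0 = k \<and> s' ''k1'' 0 = k * L \<and> balanced_k n m L k \<and>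
    t' \<le> t + 100 * (n + k + 1)) s t"
    (is "wp _ ?Q s t")
proof -
  have 1: "wp (For ''i'' ''n'' (''nn'' ::= Add (Var ''nn'') (Var ''n'')))
     (\<lambda>s' t'. s' ''nn'' 0 = n\<^sup>2 \<and> t' \<le> t + 25 * n + 12) (s(''nn'' := (s ''nn'')(0 := 0))) (t + 3)"
    by (rule wp_For[where h = n and k = 10 and I = "\<lambda>i s. s ''nn'' 0 = i * n"])
      (use assms in \<open>auto simp: algebra_simps power2_eq_square agree_def\<close>)
  \<comment> \<open>The reserve of 25 pays for the last round, which clears \<open>go\<close>
    without increasing \<open>k\<close>.\<close>
  let ?J = "\<lambda>s' t'. \<exists>k. s' ''k'' 0 = k \<and> s' ''k1'' 0 = k * L \<and> s' ''k2'' 0 = k\<^sup>2 * L \<and> s' ''k3'' 0 = k ^ 3 * L \<and>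
    1 \<le> k \<and> (\<forall>j. 1 \<le> j \<longrightarrow> j < k \<longrightarrow> j\<^sup>2 * L < m \<and> j ^ 3 * L < n\<^sup>2) \<and>
    (s' ''go'' 0 \<le> 0 \<longrightarrow> m \<le> k\<^sup>2 * L \<or> n\<^sup>2 \<le> k ^ 3 * L) \<and>
    t' + (if 0 < s' ''go'' 0 then 25 else 0) \<le> t + 25 * n + 90 * k"
  have 2: "wp (WhilePos (Var ''go'') increase_k) ?Q s1 t1"
    if init: "?J s1 t1" and f1: "s1 ''m'' 0 = m" "s1 ''nn'' 0 = n\<^sup>2" "s1 ''L'' 0 = L" for s1 t1
  proof (rule wp_While[where I = ?J and B = "t + 25 * n + 90 * (m + 1)"])
    show "?J s1 t1" by (rule init)
  next
    fix s' t' assume "?J s' t'"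
    then obtain k where k: "1 \<le> k" "\<And>j. 1 \<le> j \<Longrightarrow> j < k \<Longrightarrow> j\<^sup>2 * L < m" "t' \<le> t + 25 * n + 90 * k"
      by (auto split: if_splits)
    \<comment> \<open>For termination only: unless \<open>k = 1\<close>, one has
      \<open>k - 1 <= (k - 1)^2 * L < m\<close>.\<close>
    have "k \<le> m + 1"
    proof (cases "k = 1")
      case False
      then have "(k - 1)\<^sup>2 * L < m" using k by simp
      moreover have "(k - 1) * 1 \<le> (k - 1)\<^sup>2 * L"
        unfolding power2_eq_square mult.assoc using k False assms(6)
        using mult_mono[of 1 "k - 1" 1 L] by (intro mult_left_mono) auto
      ultimately show ?thesis by simp
    qed (use assms in simp)
    with k(3) show "t' \<le> t + 25 * n + 90 * (m + 1)" by simp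
  next
    fix s' t' assume "?J s' t'" and ag: "agree (writes increase_k) s' s1" and go: "0 < eval (Var ''go'') s'"
    then obtain k where k: "s' ''k'' 0 = k" "s' ''k1'' 0 = k * L" "s' ''k2'' 0 = k\<^sup>2 * L" "s' ''k3'' 0 = k ^ 3 * L"
      "1 \<le> k" "\<And>j. 1 \<le> j \<Longrightarrow> j < k \<Longrightarrow> j\<^sup>2 * L < m \<and> j ^ 3 * L < n\<^sup>2" "t' + 25 \<le> t + 25 * n + 90 * k"
      by auto
    have f: "s' ''m'' 0 = m" "s' ''nn'' 0 = n\<^sup>2" "s' ''L'' 0 = L"
      using ag f1 by (auto simp: agree_def writes_increase_k)
    have "j\<^sup>2 * L < m \<and> j ^ 3 * L < n\<^sup>2"
      if "k\<^sup>2 * L < m" "k ^ 3 * L < n\<^sup>2" "1 \<le> j" "j < k + 1" for j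
      using k(6)[of j] that by (cases "j = k") auto
    then show "wp increase_k ?J s' (t' + (1 + cost (Var ''go'')))" using k f go
      by (auto simp: increase_k_def algebra_simps power2_eq_square power3_eq_cube)
  qed (use assms(2) in \<open>auto simp: balanced_k_def\<close>)
  have "wp (For ''i'' ''n'' (''nn'' ::= Add (Var ''nn'') (Var ''n'')))
      (wp (''k'' ::= One ;; ''k1'' ::= Var ''L'' ;; ''k2'' ::= Var ''L'' ;; ''k3'' ::= Var ''L'' ;; ''go'' ::= One ;;
        WhilePos (Var ''go'') increase_k) ?Q) (s(''nn'' := (s ''nn'')(0 := 0))) (t + 3)"
  proof (rule wp_mono[OF 1])
    fix s1 t1
    assume h: "s1 ''nn'' 0 = n\<^sup>2 \<and> t1 \<le> t + 25 * n + 12"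
      and ag: "agree (writes (For ''i'' ''n'' (''nn'' ::= Add (Var ''nn'') (Var ''n'')))) s1 (s(''nn'' := (s ''nn'')(0 := 0)))"
    then have f1: "s1 ''m'' 0 = m" "s1 ''L'' 0 = L" using assms by (auto simp: agree_def)
    have "wp (WhilePos (Var ''go'') increase_k) ?Q (s1(''k'' := (s1 ''k'')(0 := 1), ''k1'' := (s1 ''k1'')(0 := L),
        ''k2'' := (s1 ''k2'')(0 := L), ''k3'' := (s1 ''k3'')(0 := L), ''go'' := (s1 ''go'')(0 := 1))) u"
      if "u \<le> t1 + 30" for u
      by (rule 2) (use that h f1 in auto)
    then show "wp (''k'' ::= One ;; ''k1'' ::= Var ''L'' ;; ''k2'' ::= Var ''L'' ;; ''k3'' ::= Var ''L'' ;; ''go'' ::= One ;;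
        WhilePos (Var ''go'') increase_k) ?Q s1 t1"
      using f1 by simp
  qed
  then show ?thesis by (simp add: choose_k_def)
qed

section \<open>Merge sort\<close>

definition new_blocks :: com where
  "new_blocks = (''i'' ::= Var ''hi'' ;;
     ''mid'' ::= Add (Var ''hi'') (Var ''width'') ;;
     IfPos (Sub (Var ''mid'') (Var ''m'')) (''mid'' ::= Var ''m'') Skip ;;
     ''j'' ::= Var ''mid'' ;;
     ''hi'' ::= Add (Var ''mid'') (Var ''width'') ;;
     IfPos (Sub (Var ''hi'') (Var ''m'')) (''hi'' ::= Var ''m'') Skip)"

text \<open>Adding \<open>One\<close> before the sign test turns the strict comparison of integers
  into a weak one. An exhausted block loses automatically.\<close>

definition compare_heads :: com where
  "compare_heads = (''left'' ::= Const 0 ;;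
     IfPos (Sub (Var ''mid'') (Var ''i''))
       (IfPos (Sub (Var ''hi'') (Var ''j''))
         (IfPos (Sub (Add (Cell ''weight'' (Cell ''perm'' (Var ''j''))) One) (Cell ''weight'' (Cell ''perm'' (Var ''i''))))
           (''left'' ::= One) Skip)
         (''left'' ::= One))
       Skip)"

text \<open>A pass is a single loop over the output position \<open>q\<close>. Opening the next pair
  of blocks is folded into the step that finds \<open>q\<close> at \<open>hi\<close>, so each
  iteration emits exactly one element and linear time is evident.\<close>

definition merge_step :: com where
  "merge_step =
    (IfPos (Sub (Add (Var ''q'') One) (Var ''hi'')) new_blocks Skip ;;
     compare_heads ;;
     IfPos (Var ''left'')
       (Store ''buf'' (Var ''q'') (Cell ''perm'' (Var ''i'')) ;; ''i'' ::= Add (Var ''i'') One)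
       (Store ''buf'' (Var ''q'') (Cell ''perm'' (Var ''j'')) ;; ''j'' ::= Add (Var ''j'') One))"

definition merge_pass :: com where
  "merge_pass = (''i'' ::= Const 0 ;; ''mid'' ::= Const 0 ;; ''j'' ::= Const 0 ;; ''hi'' ::= Const 0 ;;
     For ''q'' ''m'' merge_step ;;
     For ''q'' ''m'' (Store ''perm'' (Var ''q'') (Cell ''buf'' (Var ''q''))))"

definition merge_sort :: com where
  "merge_sort = (For ''q'' ''m'' (Store ''perm'' (Var ''q'') (Var ''q'')) ;;
     For ''p'' ''L'' (''width'' ::= Cell ''pow'' (Var ''p'') ;; merge_pass))"

lemma writes_merge_step: "writes merge_step = {''i'', ''mid'', ''j'', ''hi'', ''left'', ''buf''}"
  by (auto simp: merge_step_def new_blocks_def compare_heads_def)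

lemma writes_merge_pass: "writes merge_pass = {''q'', ''i'', ''mid'', ''j'', ''hi'', ''left'', ''buf'', ''perm''}"
  by (auto simp: merge_pass_def writes_merge_step)

lemma writes_merge_sort:
  "writes merge_sort = {''p'', ''width'', ''q'', ''i'', ''mid'', ''j'', ''hi'', ''left'', ''buf'', ''perm''}"
  by (auto simp: merge_sort_def writes_merge_pass)

text \<open>Blocks are aligned at multiples of \<open>w\<close> and indexed by \<open>c\<close>, so
  that no integer division occurs.\<close>

definition sorted_blocks :: "(int \<Rightarrow> int) \<Rightarrow> int \<Rightarrow> int \<Rightarrow> (int \<Rightarrow> int) \<Rightarrow> bool" where
  "sorted_blocks W w m A \<longleftrightarrow>
    (\<forall>c a b. w * c \<le> a \<longrightarrow> 0 \<le> a \<longrightarrow> a \<le> b \<longrightarrow> b < w * (c + 1) \<longrightarrow> b < m \<longrightarrow> W (A a) \<le> W (A b))"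

lemma sorted_blocks_1: "sorted_blocks W 1 m A"
  unfolding sorted_blocks_def
proof (intro allI impI)
  fix c a b :: int assume "1 * c \<le> a" "a \<le> b" "b < 1 * (c + 1)"
  then have "a = b" by simp
  then show "W (A a) \<le> W (A b)" by simp
qed

lemma block_unique:
  fixes w :: int
  assumes "0 < w" "w * c \<le> q" "q < w * (c + 1)" "w * d \<le> q" "q < w * (d + 1)"
  shows "c = d"
proof -
  have "w * c < w * (d + 1)" "w * d < w * (c + 1)" using assms by linarith+
  then show ?thesis using assms(1) by simp
qed

text \<open>\<open>c\<close> numbers the output block of width \<open>2 * w\<close> being filled;
  \<open>c = -1\<close> is an empty block ending at 0, so that the first step opens block 0. What
  has been consumed is recorded only as an image: surjectivity of the final permutation
  suffices.\<close>

definition merging :: "(int \<Rightarrow> int) \<Rightarrow> int \<Rightarrow> int \<Rightarrow> (int \<Rightarrow> int) \<Rightarrow> int \<Rightarrow> int \<Rightarrow> int \<Rightarrow> int \<Rightarrow> int \<Rightarrow> (int \<Rightarrow> int) \<Rightarrow> bool" where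
  "merging W w m A q i mid j hi B \<longleftrightarrow> (\<exists>c \<ge> -1. hi = min (2 * w * (c + 1)) m \<and> 2 * w * c \<le> q \<and> q \<le> hi \<and>
     0 \<le> i \<and> i \<le> mid \<and> mid \<le> j \<and> j \<le> hi \<and> q = i + j - mid \<and>
     B ` {0..<q} = A ` ({0..<i} \<union> {mid..<j}) \<and> sorted_blocks W (2 * w) q B \<and>
     (\<forall>a b. i \<le> a \<longrightarrow> a \<le> b \<longrightarrow> b < mid \<longrightarrow> W (A a) \<le> W (A b)) \<and>
     (\<forall>a b. j \<le> a \<longrightarrow> a \<le> b \<longrightarrow> b < hi \<longrightarrow> W (A a) \<le> W (A b)) \<and>
     (\<forall>a b. 2 * w * c \<le> a \<longrightarrow> 0 \<le> a \<longrightarrow> a < q \<longrightarrow> b \<in> {i..<mid} \<union> {j..<hi} \<longrightarrow> W (B a) \<le> W (A b)))"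

lemma merging_init: "0 \<le> m \<Longrightarrow> 0 < w \<Longrightarrow> merging W w m A 0 0 0 0 0 B"
  unfolding merging_def by (intro exI[of _ "-1"]) (auto simp: sorted_blocks_def)

lemma merging_new_blocks:
  assumes "merging W w m A q i mid j q B" "q < m" "0 < w" "sorted_blocks W w m A"
  shows "merging W w m A q q (min (q + w) m) (min (q + w) m) (min (min (q + w) m + w) m) B"
proof -
  from assms(1)[unfolded merging_def] obtain c where c: "-1 \<le> c" "q = min (2 * w * (c + 1)) m" "2 * w * c \<le> q"
    "0 \<le> i" "i \<le> mid" "mid \<le> j" "j \<le> q" "q = i + j - mid"
    "B ` {0..<q} = A ` ({0..<i} \<union> {mid..<j})" "sorted_blocks W (2 * w) q B"
    by (elim exE conjE) (rule that; assumption)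
  \<comment> \<open>Because \<open>q < m\<close>, the minimum is not cut off at \<open>m\<close>, so
    the new pair consists of the source blocks \<open>2 * (c + 1)\<close> and
    \<open>2 * (c + 1) + 1\<close>. The old pair is used up, as \<open>q = i + j - mid\<close> with
    \<open>i <= mid\<close> and \<open>j <= q\<close> leaves no slack.\<close>
  have q: "q = w * (2 * (c + 1))" "0 \<le> q" using c(2,4-8) assms(2) by auto
  have "i = mid" "j = q" using c by auto
  moreover have "{0..<mid} \<union> {mid..<q} = {0..<q}" using c by auto
  ultimately have img: "B ` {0..<q} = A ` {0..<q}" using c(9) by simp
  have 1: "W (A a) \<le> W (A b)" if "q \<le> a" "a \<le> b" "b < min (q + w) m" for a b
    using assms(4)[unfolded sorted_blocks_def, rule_format, of "2 * (c + 1)" a b] that q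
    by (simp add: algebra_simps)
  have 2: "W (A a) \<le> W (A b)" if "min (q + w) m \<le> a" "a \<le> b" "b < min (min (q + w) m + w) m" for a b
    using assms(4)[unfolded sorted_blocks_def, rule_format, of "2 * (c + 1) + 1" a b] that q
    by (auto simp: algebra_simps min_def split: if_splits)
  show ?thesis unfolding merging_def
    by (rule exI[of _ "c + 1"]) (use c q assms(2,3) img 1 2 in \<open>auto simp: algebra_simps min_def\<close>)
qed

lemma merging_step:
  assumes "merging W w m A q i mid j hi B" "q < hi" "0 < w"
    and left: "l \<longleftrightarrow> i < mid \<and> (j < hi \<longrightarrow> W (A i) \<le> W (A j))"
  shows "merging W w m A (q + 1) (if l then i + 1 else i) mid (if l then j else j + 1) hi
    (B(q := A (if l then i else j)))"
proof -
  from assms(1)[unfolded merging_def] obtain c where c: "-1 \<le> c" "hi = min (2 * w * (c + 1)) m" "2 * w * c \<le> q" "q \<le> hi"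
    "0 \<le> i" "i \<le> mid" "mid \<le> j" "j \<le> hi" "q = i + j - mid"
    and img: "B ` {0..<q} = A ` ({0..<i} \<union> {mid..<j})" and sb: "sorted_blocks W (2 * w) q B"
    and s1': "\<forall>a b. i \<le> a \<longrightarrow> a \<le> b \<longrightarrow> b < mid \<longrightarrow> W (A a) \<le> W (A b)"
    and s2': "\<forall>a b. j \<le> a \<longrightarrow> a \<le> b \<longrightarrow> b < hi \<longrightarrow> W (A a) \<le> W (A b)"
    and le': "\<forall>a b. 2 * w * c \<le> a \<longrightarrow> 0 \<le> a \<longrightarrow> a < q \<longrightarrow> b \<in> {i..<mid} \<union> {j..<hi} \<longrightarrow> W (B a) \<le> W (A b)"
    by (elim exE conjE) (rule that; assumption)
  note s1 = s1'[rule_format] and s2 = s2'[rule_format] and le = le'[rule_format]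
  define z where "z = (if l then i else j)"
  have z: "z \<in> {i..<mid} \<union> {j..<hi}" using left assms(2) c by (auto simp: z_def)
  \<comment> \<open>\<open>z\<close> is the lighter of the two heads; as both remainders are sorted,
    it is minimal among everything left in the pair.\<close>
  have zle: "W (A z) \<le> W (A b)" if "b \<in> {i..<mid} \<union> {j..<hi}" for b
  proof (cases "b < mid \<and> i \<le> b")
    case True
    then show ?thesis using s1[of i b] left s2[of j b] assms(2) c that by (auto simp: z_def)
  next
    case False
    then have "j \<le> b" "b < hi" using that by auto
    then show ?thesis using s2[of j b] left by (auto simp: z_def)
  qed
  let ?B = "B(q := A z)"
  have "?B ` {0..<q + 1} = insert (A z) (B ` {0..<q})"
    using c by (auto simp: image_iff)
  also have "\<dots> = A ` ({0..<if l then i + 1 else i} \<union> {mid..<if l then j else j + 1})"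
  proof -
    have "insert z ({0..<i} \<union> {mid..<j}) = {0..<if l then i + 1 else i} \<union> {mid..<if l then j else j + 1}"
      using c by (auto simp: z_def)
    then show ?thesis unfolding img by (metis image_insert)
  qed
  finally have img': "?B ` {0..<q + 1} = A ` ({0..<if l then i + 1 else i} \<union> {mid..<if l then j else j + 1})" .
  have sb': "sorted_blocks W (2 * w) (q + 1) ?B"
    unfolding sorted_blocks_def
  proof (intro allI impI)
    fix d a b assume h: "2 * w * d \<le> a" "0 \<le> a" "a \<le> b" "b < 2 * w * (d + 1)" "b < q + 1"
    show "W (?B a) \<le> W (?B b)"
    proof (cases "b = q")
      case False
      then show ?thesis using sb[unfolded sorted_blocks_def, rule_format, of d a b] h by simp
    next
      case True
      \<comment> \<open>The only aligned block containing \<open>q\<close> is \<open>c\<close>, and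
        what was already output in that block is no heavier than anything remaining.\<close>
      have "q < 2 * w * (c + 1)" using c assms(2) by auto
      then have "d = c" using block_unique[of "2 * w" d q c] h c True assms(3) by auto
      then show ?thesis using le[of a z] z h True by auto
    qed
  qed
  have le_B: "W (?B a) \<le> W (A b)" if "2 * w * c \<le> a" "0 \<le> a" "a < q + 1"
    "b \<in> {if l then i + 1 else i..<mid} \<union> {if l then j else j + 1..<hi}" for a b
  proof -
    have b: "b \<in> {i..<mid} \<union> {j..<hi}" using that(4) by (auto split: if_splits)
    show ?thesis using le[of a b] zle[of b] b that by (cases "a = q") auto
  qed
  show ?thesis
    unfolding merging_def z_def[symmetric]
  proof (intro exI[of _ c] conjI allI impI img' sb')
    fix a b
    show "W (A a) \<le> W (A b)" if "(if l then i + 1 else i) \<le> a" "a \<le> b" "b < mid"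
      using s1[of a b] that by (auto split: if_splits)
    show "W (A a) \<le> W (A b)" if "(if l then j else j + 1) \<le> a" "a \<le> b" "b < hi"
      using s2[of a b] that by (auto split: if_splits)
  qed (use c left assms(2) le_B in auto)
qed

lemma wp_merge_step:
  assumes inv: "merging W w m A q (s ''i'' 0) (s ''mid'' 0) (s ''j'' 0) (s ''hi'' 0) (s ''buf'')"
    and q: "s ''q'' 0 = q" "q < m" and s: "s ''weight'' = W" "s ''perm'' = A" "s ''m'' 0 = m" "s ''width'' 0 = w"
    and w: "0 < w" "sorted_blocks W w m A"
  shows "wp merge_step (\<lambda>s' t'. t' \<le> t + 150 \<and>
    merging W w m A (q + 1) (s' ''i'' 0) (s' ''mid'' 0) (s' ''j'' 0) (s' ''hi'' 0) (s' ''buf'')) s t"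
proof -
  have qhi: "q \<le> s ''hi'' 0" using inv by (auto simp: merging_def)
  have 1: "wp (IfPos (Sub (Add (Var ''q'') One) (Var ''hi'')) new_blocks Skip) (\<lambda>s' t'. t' \<le> t + 80 \<and>
    merging W w m A q (s' ''i'' 0) (s' ''mid'' 0) (s' ''j'' 0) (s' ''hi'' 0) (s' ''buf'') \<and> q < s' ''hi'' 0) s t"
  proof (cases "s ''hi'' 0 = q")
    case True
    then show ?thesis
      using merging_new_blocks[OF _ q(2) w] inv q s w
      by (auto simp: new_blocks_def min_def split: if_splits)
  next
    case False
    with qhi inv q show ?thesis by simp
  qed
  show ?thesis
    unfolding merge_step_def wp_Seq
  proof (rule wp_mono[OF 1])
    fix s1 t1
    assume h: "t1 \<le> t + 80 \<and>
      merging W w m A q (s1 ''i'' 0) (s1 ''mid'' 0) (s1 ''j'' 0) (s1 ''hi'' 0) (s1 ''buf'') \<and> q < s1 ''hi'' 0"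
      and "agree (writes (IfPos (Sub (Add (Var ''q'') One) (Var ''hi'')) new_blocks Skip)) s1 s"
    then have f: "s1 ''weight'' = W" "s1 ''perm'' = A" "s1 ''q'' 0 = q"
      using s q by (auto simp: agree_def new_blocks_def)
    define l where "l \<longleftrightarrow> s1 ''i'' 0 < s1 ''mid'' 0 \<and> (s1 ''j'' 0 < s1 ''hi'' 0 \<longrightarrow> W (A (s1 ''i'' 0)) \<le> W (A (s1 ''j'' 0)))"
    have ms: "merging W w m A (q + 1) (if l then s1 ''i'' 0 + 1 else s1 ''i'' 0) (s1 ''mid'' 0)
        (if l then s1 ''j'' 0 else s1 ''j'' 0 + 1) (s1 ''hi'' 0)
        ((s1 ''buf'')(q := A (if l then s1 ''i'' 0 else s1 ''j'' 0)))"
      by (rule merging_step) (use h w(1) l_def in auto)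
    have 2: "wp compare_heads (\<lambda>s' t'. t' \<le> t1 + 45 \<and> s' = s1(''left'' := (s1 ''left'')(0 := of_bool l))) s1 t1"
      by (auto simp: compare_heads_def l_def f)
    show "wp compare_heads (wp (IfPos (Var ''left'')
        (Store ''buf'' (Var ''q'') (Cell ''perm'' (Var ''i'')) ;; ''i'' ::= Add (Var ''i'') One)
        (Store ''buf'' (Var ''q'') (Cell ''perm'' (Var ''j'')) ;; ''j'' ::= Add (Var ''j'') One))
        (\<lambda>s' t'. t' \<le> t + 150 \<and>
          merging W w m A (q + 1) (s' ''i'' 0) (s' ''mid'' 0) (s' ''j'' 0) (s' ''hi'' 0) (s' ''buf''))) s1 t1"
    proof (rule wp_mono[OF 2])
      fix s2 t2
      assume "t2 \<le> t1 + 45 \<and> s2 = s1(''left'' := (s1 ''left'')(0 := of_bool l))"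
      then show "wp (IfPos (Var ''left'')
        (Store ''buf'' (Var ''q'') (Cell ''perm'' (Var ''i'')) ;; ''i'' ::= Add (Var ''i'') One)
        (Store ''buf'' (Var ''q'') (Cell ''perm'' (Var ''j'')) ;; ''j'' ::= Add (Var ''j'') One))
        (\<lambda>s' t'. t' \<le> t + 150 \<and>
          merging W w m A (q + 1) (s' ''i'' 0) (s' ''mid'' 0) (s' ''j'' 0) (s' ''hi'' 0) (s' ''buf'')) s2 t2"
        using ms h f by (cases l) auto
    qed
  qed
qed

lemma merging_final:
  assumes "merging W w m A m i mid j hi B" "0 \<le> m"
  shows "B ` {0..<m} = A ` {0..<m}" "sorted_blocks W (2 * w) m B"
proof -
  from assms(1)[unfolded merging_def] obtain c where c: "hi = min (2 * w * (c + 1)) m" "m \<le> hi"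
    "i \<le> mid" "j \<le> hi" "m = i + j - mid" "0 \<le> i" "mid \<le> j"
    and img: "B ` {0..<m} = A ` ({0..<i} \<union> {mid..<j})"
    by (elim exE conjE) (rule that; assumption)
  then have "{0..<i} \<union> {mid..<j} = {0..<m}" by auto
  with img show "B ` {0..<m} = A ` {0..<m}" by simp
  show "sorted_blocks W (2 * w) m B" using assms by (auto simp: merging_def)
qed

lemma wp_merge_pass:
  assumes s: "s ''weight'' = W" "s ''perm'' = A" "s ''m'' 0 = m" "s ''width'' 0 = w"
    and m: "0 \<le> m" "A ` {0..<m} = {0..<m}" and w: "0 < w" "sorted_blocks W w m A"
  shows "wp merge_pass (\<lambda>s' t'. t' \<le> t + 200 * (m + 1) \<and>
    s' ''perm'' ` {0..<m} = {0..<m} \<and> sorted_blocks W (2 * w) m (s' ''perm'')) s t"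
proof -
  let ?s = "s(''i'' := (s ''i'')(0 := 0), ''mid'' := (s ''mid'')(0 := 0), ''j'' := (s ''j'')(0 := 0), ''hi'' := (s ''hi'')(0 := 0))"
  have 1: "wp (For ''q'' ''m'' merge_step) (\<lambda>s' t'. t' \<le> t + 21 + 162 * m \<and>
      s' ''buf'' ` {0..<m} = {0..<m} \<and> sorted_blocks W (2 * w) m (s' ''buf'')) ?s (12 + t)"
  proof (rule wp_For[where h = m and k = 150 and I = "\<lambda>q s'.
      merging W w m A q (s' ''i'' 0) (s' ''mid'' 0) (s' ''j'' 0) (s' ''hi'' 0) (s' ''buf'')"])
    fix q s1 t1
    assume "0 \<le> q" "q < m" "merging W w m A q (s1 ''i'' 0) (s1 ''mid'' 0) (s1 ''j'' 0) (s1 ''hi'' 0) (s1 ''buf'')"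
      "s1 ''q'' 0 = q" "agree (insert ''q'' (writes merge_step)) s1 ?s"
    then show "wp merge_step (\<lambda>s' t'. t' \<le> t1 + 150 \<and>
         merging W w m A (q + 1) ((s'(''q'' := (s' ''q'')(0 := q + 1))) ''i'' 0) ((s'(''q'' := (s' ''q'')(0 := q + 1))) ''mid'' 0)
           ((s'(''q'' := (s' ''q'')(0 := q + 1))) ''j'' 0) ((s'(''q'' := (s' ''q'')(0 := q + 1))) ''hi'' 0)
           ((s'(''q'' := (s' ''q'')(0 := q + 1))) ''buf'')) s1 t1"
      using wp_merge_step[of W w m A q s1 t1] s w by (auto simp: writes_merge_step agree_def)
  qed (use s m w merging_init merging_final in \<open>auto simp: writes_merge_step\<close>)
  have "wp (For ''q'' ''m'' merge_step) (wp (For ''q'' ''m'' (Store ''perm'' (Var ''q'') (Cell ''buf'' (Var ''q''))))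
      (\<lambda>s' t'. t' \<le> t + 200 * (m + 1) \<and>
        s' ''perm'' ` {0..<m} = {0..<m} \<and> sorted_blocks W (2 * w) m (s' ''perm''))) ?s (12 + t)"
  proof (rule wp_mono[OF 1])
    fix s1 t1
    assume h: "t1 \<le> t + 21 + 162 * m \<and>
      s1 ''buf'' ` {0..<m} = {0..<m} \<and> sorted_blocks W (2 * w) m (s1 ''buf'')"
      and "agree (writes (For ''q'' ''m'' merge_step)) s1 ?s"
    then have s1: "s1 ''m'' 0 = m" using s by (simp add: agree_def writes_merge_step)
    show "wp (For ''q'' ''m'' (Store ''perm'' (Var ''q'') (Cell ''buf'' (Var ''q''))))
      (\<lambda>s' t'. t' \<le> t + 200 * (m + 1) \<and>
        s' ''perm'' ` {0..<m} = {0..<m} \<and> sorted_blocks W (2 * w) m (s' ''perm'')) s1 t1"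
    proof (rule wp_For[where h = m and k = 6 and I = "\<lambda>q s'. \<forall>a\<in>{0..<q}. s' ''perm'' a = s1 ''buf'' a"])
      fix s2 t2
      assume eq: "\<forall>a\<in>{0..<m}. s2 ''perm'' a = s1 ''buf'' a" and "t2 \<le> t1 + (6 + 12) * m + 9"
      then have "t2 \<le> t + 200 * (m + 1)" using h m by simp
      moreover have "s2 ''perm'' ` {0..<m} = s1 ''buf'' ` {0..<m}"
        by (rule image_cong) (use eq in auto)
      moreover have "sorted_blocks W (2 * w) m (s2 ''perm'')"
        using h eq by (simp add: sorted_blocks_def)
      ultimately show "t2 \<le> t + 200 * (m + 1) \<and>
        s2 ''perm'' ` {0..<m} = {0..<m} \<and> sorted_blocks W (2 * w) m (s2 ''perm'')"
        using h by simp
    next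
      fix i s2 t2
      assume "0 \<le> i" "i < m" and eq: "\<forall>a\<in>{0..<i}. s2 ''perm'' a = s1 ''buf'' a" and i: "s2 ''q'' 0 = i"
        and "agree (insert ''q'' (writes (Store ''perm'' (Var ''q'') (Cell ''buf'' (Var ''q''))))) s2 s1"
      then have "s2 ''buf'' = s1 ''buf''" by (simp add: agree_def)
      then show "wp (Store ''perm'' (Var ''q'') (Cell ''buf'' (Var ''q'')))
          (\<lambda>s' t'. t' \<le> t2 + 6 \<and> (\<forall>a\<in>{0..<i + 1}. (s'(''q'' := (s' ''q'')(0 := i + 1))) ''perm'' a = s1 ''buf'' a)) s2 t2"
        using eq i by simp
    qed (use m s1 in simp_all)
  qed
  then show ?thesis by (simp add: merge_pass_def)
qed

lemma wp_merge_sort: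
  assumes s: "s ''m'' 0 = m" "s ''L'' 0 = L" "s ''weight'' = W" and m: "0 \<le> m" "1 \<le> L"
    and pow: "\<And>i. i \<in> {0..<L} \<Longrightarrow> s ''pow'' i = 2 ^ nat i" "m < 2 ^ nat (L - 1)"
  shows "wp merge_sort (\<lambda>s' t'. t' \<le> t + 300 * (m + 1) * L \<and> s' ''perm'' ` {0..<m} = {0..<m} \<and>
    (\<forall>a b. 0 \<le> a \<longrightarrow> a \<le> b \<longrightarrow> b < m \<longrightarrow> W (s' ''perm'' a) \<le> W (s' ''perm'' b))) s t"
proof -
  let ?Q = "\<lambda>s' t'. t' \<le> t + 300 * (m + 1) * L \<and> s' ''perm'' ` {0..<m} = {0..<m} \<and>
    (\<forall>a b. 0 \<le> a \<longrightarrow> a \<le> b \<longrightarrow> b < m \<longrightarrow> W (s' ''perm'' a) \<le> W (s' ''perm'' b))"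
  have 1: "wp (For ''q'' ''m'' (Store ''perm'' (Var ''q'') (Var ''q'')))
    (\<lambda>s' t'. t' \<le> t + 17 * m + 9 \<and> (\<forall>a\<in>{0..<m}. s' ''perm'' a = a)) s t"
    by (rule wp_For[where h = m and k = 5 and I = "\<lambda>q s'. \<forall>a\<in>{0..<q}. s' ''perm'' a = a"])
      (use s m in auto)
  show ?thesis
    unfolding merge_sort_def wp_Seq
  proof (rule wp_mono[OF 1])
    fix s1 t1
    assume h: "t1 \<le> t + 17 * m + 9 \<and> (\<forall>a\<in>{0..<m}. s1 ''perm'' a = a)"
      and "agree (writes (For ''q'' ''m'' (Store ''perm'' (Var ''q'') (Var ''q'')))) s1 s"
    then have f: "s1 ''m'' 0 = m" "s1 ''L'' 0 = L" "s1 ''weight'' = W" "s1 ''pow'' = s ''pow''"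
      using s by (auto simp: agree_def)
    show "wp (For ''p'' ''L'' (''width'' ::= Cell ''pow'' (Var ''p'') ;; merge_pass)) ?Q s1 t1"
    proof (rule wp_For[where h = L and k = "10 + 200 * (m + 1)" and I = "\<lambda>p s'.
        s' ''perm'' ` {0..<m} = {0..<m} \<and> sorted_blocks W (2 ^ nat p) m (s' ''perm'')"])
      show "(s1(''p'' := (s1 ''p'')(0 := 0))) ''perm'' ` {0..<m} = {0..<m} \<and>
        sorted_blocks W (2 ^ nat 0) m ((s1(''p'' := (s1 ''p'')(0 := 0))) ''perm'')"
        using h sorted_blocks_1 by simp
    next
      fix p s2 t2
      assume p: "0 \<le> p" "p < L"
        and h2: "s2 ''perm'' ` {0..<m} = {0..<m} \<and> sorted_blocks W (2 ^ nat p) m (s2 ''perm'')"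
        and sp: "s2 ''p'' 0 = p" and "agree (insert ''p'' (writes (''width'' ::= Cell ''pow'' (Var ''p'') ;; merge_pass))) s2 s1"
      then have f2: "s2 ''m'' 0 = m" "s2 ''weight'' = W" "s2 ''pow'' p = 2 ^ nat p"
        using f pow(1)[of p] by (simp_all add: agree_def writes_merge_pass)
      let ?s2 = "s2(''width'' := (s2 ''width'')(0 := 2 ^ nat p))"
      have "wp merge_pass (\<lambda>s' t'. t' \<le> 5 + t2 + 200 * (m + 1) \<and>
        s' ''perm'' ` {0..<m} = {0..<m} \<and> sorted_blocks W (2 * 2 ^ nat p) m (s' ''perm'')) ?s2 (5 + t2)"
        by (rule wp_merge_pass) (use f2 h2 m in auto)
      then have "wp merge_pass (\<lambda>s' t'. t' \<le> t2 + (10 + 200 * (m + 1)) \<and>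
            (s'(''p'' := (s' ''p'')(0 := p + 1))) ''perm'' ` {0..<m} = {0..<m} \<and>
            sorted_blocks W (2 ^ nat (p + 1)) m ((s'(''p'' := (s' ''p'')(0 := p + 1))) ''perm'')) ?s2 (5 + t2)"
        by (rule wp_mono) (use p in \<open>simp add: nat_add_distrib\<close>)
      then show "wp (''width'' ::= Cell ''pow'' (Var ''p'') ;; merge_pass)
          (\<lambda>s' t'. t' \<le> t2 + (10 + 200 * (m + 1)) \<and>
            (s'(''p'' := (s' ''p'')(0 := p + 1))) ''perm'' ` {0..<m} = {0..<m} \<and>
            sorted_blocks W (2 ^ nat (p + 1)) m ((s'(''p'' := (s' ''p'')(0 := p + 1))) ''perm'')) s2 t2"
        unfolding wp_Seq wp_Store by (simp add: sp f2 add.commute)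
    next
      fix s2 t2
      assume h2: "s2 ''perm'' ` {0..<m} = {0..<m} \<and> sorted_blocks W (2 ^ nat L) m (s2 ''perm'')"
        "t2 \<le> t1 + (10 + 200 * (m + 1) + 12) * L + 9"
      \<comment> \<open>After \<open>L\<close> doublings block 0 is longer than the whole
        array.\<close>
      have "(2::int) ^ nat (L - 1) \<le> 2 ^ nat L" by (intro power_increasing) auto
      then have "m < 2 ^ nat L" using pow(2) by linarith
      then have "W (s2 ''perm'' a) \<le> W (s2 ''perm'' b)" if "0 \<le> a" "a \<le> b" "b < m" for a b
        using conjunct2[OF h2(1), unfolded sorted_blocks_def, rule_format, of 0 a b] that by simp
      moreover have "t2 \<le> t + 300 * (m + 1) * L"
      proof -
        define X where "X = (m + 1) * L"
        have "m + 1 \<le> X" "1 * L \<le> X" unfolding X_def using m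
          by (simp, intro mult_right_mono) auto
        moreover have "t2 \<le> t1 + 200 * X + 22 * L + 9" using h2(2) by (simp add: X_def algebra_simps)
        ultimately have "t2 \<le> t + 300 * X" using h m by linarith
        then show ?thesis by (simp add: X_def algebra_simps)
      qed
      ultimately show "?Q s2 t2" using h2 by blast
    qed (use f m in \<open>simp_all add: writes_merge_pass\<close>)
  qed
qed

section \<open>Adjacency lists\<close>

definition build_half_edges :: com where
  "build_half_edges = For ''j'' ''m''
     (Store ''hv'' (Var ''j'') (Cell ''tail'' (Cell ''perm'' (Var ''j''))) ;;
      Store ''hw'' (Var ''j'') (Cell ''head'' (Cell ''perm'' (Var ''j''))) ;;
      Store ''arc'' (Var ''j'') (Var ''j'') ;;
      Store ''dir'' (Var ''j'') (Const 0) ;;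
      Store ''hv'' (Add (Var ''m'') (Var ''j'')) (Cell ''head'' (Cell ''perm'' (Var ''j''))) ;;
      Store ''hw'' (Add (Var ''m'') (Var ''j'')) (Cell ''tail'' (Cell ''perm'' (Var ''j''))) ;;
      Store ''arc'' (Add (Var ''m'') (Var ''j'')) (Var ''j'') ;;
      Store ''dir'' (Add (Var ''m'') (Var ''j'')) One)"

text \<open>Half-edges are inserted at the front in increasing order, so lists run through
  decreasing indices and the unscanned rest of a list is given by a single upper bound.\<close>

definition build_lists :: com where
  "build_lists =
    (For ''v'' ''n'' (Store ''first'' (Var ''v'') (Const (-1))) ;;
     ''m2'' ::= Add (Var ''m'') (Var ''m'') ;;
     For ''g'' ''m2''
      (Store ''link'' (Var ''g'') (Cell ''first'' (Cell ''hv'' (Var ''g''))) ;;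
       Store ''first'' (Cell ''hv'' (Var ''g'')) (Var ''g'')))"

definition build_graph :: com where
  "build_graph = (build_half_edges ;; build_lists)"

lemma writes_build_graph:
  "writes build_graph = {''j'', ''hv'', ''hw'', ''arc'', ''dir'', ''v'', ''first'', ''m2'', ''g'', ''link''}"
  by (auto simp: build_graph_def build_half_edges_def build_lists_def)

context flow_network
begin

text \<open>A link of an adjacency list: the next smaller half-edge at \<open>v\<close>, with -1 as
  end marker. For \<open>u = 2 * M\<close> it is the head of the list.\<close>

definition is_prev :: "int \<Rightarrow> int \<Rightarrow> int \<Rightarrow> bool" where
  "is_prev p v u \<longleftrightarrow> -1 \<le> p \<and> p < u \<and> (0 \<le> p \<longrightarrow> hv p = v) \<and> (\<forall>g. p < g \<longrightarrow> g < u \<longrightarrow> hv g \<noteq> v)"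

definition half_edges_ok :: "state \<Rightarrow> bool" where
  "half_edges_ok s \<longleftrightarrow> (\<forall>g\<in>{0..<2*M}. s ''hv'' g = hv g \<and> s ''hw'' g = hw g \<and> s ''arc'' g = arc g \<and> s ''dir'' g = dir g)"

definition graph_ok :: "state \<Rightarrow> bool" where
  "graph_ok s \<longleftrightarrow> s ''n'' 0 = N \<and> s ''m'' 0 = M \<and> (\<forall>v\<in>{0..<N}. s ''supply'' v = b v) \<and>
     half_edges_ok s \<and> (\<forall>v\<in>{0..<N}. is_prev (s ''first'' v) v (2*M)) \<and>
     (\<forall>g\<in>{0..<2*M}. is_prev (s ''link'' g) (hv g) g)"

lemma graph_ok_agree:
  assumes "graph_ok s" "agree W s' s"
    and "W \<inter> {''n'', ''m'', ''supply'', ''hv'', ''hw'', ''arc'', ''dir'', ''first'', ''link''} = {}"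
  shows "graph_ok s'"
proof -
  have "s' a = s a" if "a \<in> {''n'', ''m'', ''supply'', ''hv'', ''hw'', ''arc'', ''dir'', ''first'', ''link''}" for a
    using assms(2,3) that unfolding agree_def by blast
  then show ?thesis using assms(1) by (simp add: graph_ok_def half_edges_ok_def)
qed

lemma wp_build_half_edges:
  assumes m: "s ''m'' 0 = M"
    and arcs: "\<And>j. j \<in> {0..<M} \<Longrightarrow> s ''tail'' (s ''perm'' j) = src j \<and> s ''head'' (s ''perm'' j) = dst j"
  shows "wp build_half_edges (\<lambda>s' t'. t' \<le> t + 100 * (M + 1) \<and> half_edges_ok s') s t"
  unfolding build_half_edges_def
proof (rule wp_For[where h = M and k = 80 and I = "\<lambda>j s'. \<forall>g\<in>{0..<j} \<union> {M..<M+j}.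
      s' ''hv'' g = hv g \<and> s' ''hw'' g = hw g \<and> s' ''arc'' g = arc g \<and> s' ''dir'' g = dir g"], goal_cases)
  case (8 j s1 t1)
  then have f: "s1 ''m'' 0 = M" "s1 ''tail'' (s1 ''perm'' j) = src j" "s1 ''head'' (s1 ''perm'' j) = dst j"
    using m arcs by (auto simp: agree_def)
  have sets: "{0..<j+1} \<union> {M..<M+(j+1)} = insert j (insert (M + j) ({0..<j} \<union> {M..<M+j}))"
    using 8(1,2) by auto
  have ne: "g \<noteq> j \<and> g \<noteq> M + j" if "g \<in> {0..<j} \<union> {M..<M+j}" for g
    using that 8(1,2) by auto
  have new: "hv j = src j" "hw j = dst j" "arc j = j" "dir j = 0"
    "hv (M + j) = dst j" "hw (M + j) = src j" "arc (M + j) = j" "dir (M + j) = 1" "M + j \<noteq> j"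
    using 8(1,2) by (auto simp: hv_def hw_def arc_def dir_def)
  show ?case unfolding sets using 8(3,4) f new ne by simp
next
  case (9 s1 t1)
  then show ?case using M_nonneg by (auto simp: half_edges_ok_def)
qed (use m M_nonneg in auto)

lemma wp_build_lists:
  assumes m: "s ''m'' 0 = M" "s ''n'' 0 = N" and he: "half_edges_ok s"
  shows "wp build_lists (\<lambda>s' t'. t' \<le> t + 100 * (N + M + 1) \<and>
    (\<forall>v\<in>{0..<N}. is_prev (s' ''first'' v) v (2*M)) \<and> (\<forall>g\<in>{0..<2*M}. is_prev (s' ''link'' g) (hv g) g)) s t"
proof -
  have 1: "wp (For ''v'' ''n'' (Store ''first'' (Var ''v'') (Const (-1))))
    (\<lambda>s' t'. t' \<le> t + 17 * N + 9 \<and> (\<forall>v\<in>{0..<N}. s' ''first'' v = -1)) s t"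
    by (rule wp_For[where h = N and k = 5 and I = "\<lambda>i s'. \<forall>v\<in>{0..<i}. s' ''first'' v = -1"])
      (use m N_nonneg in auto)
  show ?thesis
    unfolding build_lists_def wp_Seq
  proof (rule wp_mono[OF 1])
    fix s1 t1
    assume h: "t1 \<le> t + 17 * N + 9 \<and> (\<forall>v\<in>{0..<N}. s1 ''first'' v = -1)"
      and "agree (writes (For ''v'' ''n'' (Store ''first'' (Var ''v'') (Const (-1))))) s1 s"
    then have f: "s1 ''m'' 0 = M" "s1 ''hv'' = s ''hv''" using m by (auto simp: agree_def)
    let ?s = "s1(''m2'' := (s1 ''m2'')(0 := M + M))"
    have "wp (For ''g'' ''m2''
      (Store ''link'' (Var ''g'') (Cell ''first'' (Cell ''hv'' (Var ''g''))) ;;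
       Store ''first'' (Cell ''hv'' (Var ''g'')) (Var ''g'')))
       (\<lambda>s' t'. t' \<le> t + 100 * (N + M + 1) \<and>
    (\<forall>v\<in>{0..<N}. is_prev (s' ''first'' v) v (2*M)) \<and> (\<forall>g\<in>{0..<2*M}. is_prev (s' ''link'' g) (hv g) g)) ?s (t1 + 7)"
    proof (rule wp_For[where h = "2*M" and k = 20 and I = "\<lambda>g s'. (\<forall>v\<in>{0..<N}. is_prev (s' ''first'' v) v g) \<and>
         (\<forall>h\<in>{0..<g}. is_prev (s' ''link'' h) (hv h) h)"], goal_cases)
      case 7
      show ?case using h by (auto simp: is_prev_def)
    next
      case (8 g s2 t2)
      then have hvg: "s2 ''hv'' g = hv g" "hv g \<in> {0..<N}"
        using he f hv_range by (auto simp: agree_def half_edges_ok_def)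
      have "is_prev (if v = hv g then g else p) v (g + 1)" if "is_prev p v g" for p v
        using that 8(1) by (auto simp: is_prev_def zless_add1_eq)
      moreover have "h < g + 1 \<longleftrightarrow> h < g \<or> h = g" for h by auto
      ultimately show ?case using 8(3,4) hvg by auto
    next
      case (9 s2 t2)
      then show ?case using h M_nonneg N_nonneg by auto
    qed (use M_nonneg in auto)
    then show "wp (''m2'' ::= Add (Var ''m'') (Var ''m'')) (wp (For ''g'' ''m2''
      (Store ''link'' (Var ''g'') (Cell ''first'' (Cell ''hv'' (Var ''g''))) ;;
       Store ''first'' (Cell ''hv'' (Var ''g'')) (Var ''g'')))
       (\<lambda>s' t'. t' \<le> t + 100 * (N + M + 1) \<and>
    (\<forall>v\<in>{0..<N}. is_prev (s' ''first'' v) v (2*M)) \<and> (\<forall>g\<in>{0..<2*M}. is_prev (s' ''link'' g) (hv g) g))) s1 t1"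
      using f by simp
  qed
qed

lemma wp_build_graph:
  assumes m: "s ''m'' 0 = M" "s ''n'' 0 = N" and b: "\<And>v. v \<in> {0..<N} \<Longrightarrow> s ''supply'' v = b v"
    and arcs: "\<And>j. j \<in> {0..<M} \<Longrightarrow> s ''tail'' (s ''perm'' j) = src j \<and> s ''head'' (s ''perm'' j) = dst j"
  shows "wp build_graph (\<lambda>s' t'. t' \<le> t + 200 * (N + M + 1) \<and> graph_ok s') s t"
  unfolding build_graph_def wp_Seq
proof (rule wp_mono[OF wp_build_half_edges[where s = s and t = t, OF m(1) arcs]], assumption)
  fix s1 t1
  assume h: "t1 \<le> t + 100 * (M + 1) \<and> half_edges_ok s1" and ag: "agree (writes build_half_edges) s1 s"
  then have f: "s1 ''m'' 0 = M" "s1 ''n'' 0 = N" "s1 ''supply'' = s ''supply''"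
    using m by (auto simp: agree_def build_half_edges_def)
  show "wp build_lists (\<lambda>s' t'. t' \<le> t + 200 * (N + M + 1) \<and> graph_ok s') s1 t1"
  proof (rule wp_mono[OF wp_build_lists[where s = s1 and t = t1, OF f(1,2)]])
    show "half_edges_ok s1" using h by simp
    fix s2 t2
    assume "t2 \<le> t1 + 100 * (N + M + 1) \<and> (\<forall>v\<in>{0..<N}. is_prev (s2 ''first'' v) v (2*M)) \<and>
      (\<forall>g\<in>{0..<2*M}. is_prev (s2 ''link'' g) (hv g) g)" and "agree (writes build_lists) s2 s1"
    then show "t2 \<le> t + 200 * (N + M + 1) \<and> graph_ok s2"
      using h f b N_nonneg by (auto simp: graph_ok_def agree_def build_lists_def half_edges_ok_def)
  qed
qed

end

section \<open>Push-relabel with bounded labels\<close>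

context flow_network
begin

definition active :: "int \<Rightarrow> (int \<Rightarrow> int) \<Rightarrow> (int \<Rightarrow> int) \<Rightarrow> int \<Rightarrow> bool" where
  "active k e d v \<longleftrightarrow> 0 < e v \<and> d v < k"

definition discharging ::
  "int \<Rightarrow> int \<Rightarrow> (int \<Rightarrow> int) \<Rightarrow> (int \<Rightarrow> int) \<Rightarrow> (int \<Rightarrow> int) \<Rightarrow> (int \<Rightarrow> int) \<Rightarrow> int \<Rightarrow> int \<Rightarrow> bool" where
  "discharging r k x e d p i cur \<longleftrightarrow> unit_flow r x \<and> (\<forall>v\<in>{0..<N}. e v = excess x v) \<and> labelling r x d \<and>
     (\<forall>v\<in>{0..<N}. d v \<le> k \<and> p v < 2 * M \<and> (0 \<le> p v \<longrightarrow> hv (p v) = v) \<and> -1 \<le> p v) \<and>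
     (\<forall>g. residual r x g \<longrightarrow> p (hv g) < g \<longrightarrow> d (hv g) \<le> d (hw g)) \<and>
     0 \<le> i \<and> i \<le> N \<and> (i < N \<longrightarrow> cur \<in> {0..<N}) \<and>
     (\<forall>v\<in>{0..<N}. v < i \<longrightarrow> v \<noteq> cur \<longrightarrow> \<not> active k e d v) \<and> (cur < i \<longrightarrow> e cur \<le> 1 \<or> k \<le> d cur)"

section \<open>A potential for scans and relabels\<close>

text \<open>
  While a unit of excess is carried from vertex to vertex, the vertices below \<open>i\<close> other than the
  current one \<open>cur\<close> stay inactive. Half-edges above the pointer \<open>p v\<close> are known to be inadmissible.
\<close>

definition count_upto :: "int \<Rightarrow> int \<Rightarrow> int" where
  "count_upto v q = int (card {g \<in> {0..q}. hv g = v})"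

text \<open>A vertex with label \<open>d v\<close> can be relabelled \<open>k - d v\<close> more
  times, each time at the price of one relabel and one scan of its full list; the last summand is
  the rest of the current scan.\<close>

definition scan_potential :: "int \<Rightarrow> (int \<Rightarrow> int) \<Rightarrow> (int \<Rightarrow> int) \<Rightarrow> int" where
  "scan_potential k d p = (\<Sum>v\<in>{0..<N}. (k - d v) * (count_upto v (2 * M - 1) + 1) + count_upto v (p v))"

lemma count_upto_nonneg: "0 \<le> count_upto v q"
  by (simp add: count_upto_def)

lemma count_upto_prev:
  assumes "is_prev q v u" "hv u = v" "0 \<le> u"
  shows "count_upto v u = count_upto v q + 1"
proof -
  have "{g \<in> {0..u}. hv g = v} = insert u {g \<in> {0..q}. hv g = v}"
    using assms unfolding is_prev_def by (auto simp: set_eq_iff) (metis linorder_not_less order_less_le)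
  moreover have "u \<notin> {g \<in> {0..q}. hv g = v}" using assms by (auto simp: is_prev_def)
  moreover have "finite {g \<in> {0..q}. hv g = v}" by (rule finite_subset[of _ "{0..q}"]) auto
  ultimately show ?thesis by (simp add: count_upto_def)
qed

lemma count_upto_first:
  assumes "is_prev q v (2 * M)"
  shows "count_upto v q = count_upto v (2 * M - 1)"
proof -
  have "g \<le> q" if "g < 2 * M" "hv g = v" for g
  proof (rule ccontr)
    assume "\<not> g \<le> q"
    then show False using assms that by (simp add: is_prev_def)
  qed
  moreover have "q < 2 * M" using assms by (simp add: is_prev_def)
  ultimately have "{g \<in> {0..q}. hv g = v} = {g \<in> {0..2 * M - 1}. hv g = v}" by auto
  then show ?thesis by (simp add: count_upto_def)
qed

lemma count_upto_empty: "count_upto v (-1) = 0"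
  by (simp add: count_upto_def)

lemma scan_potential_nonneg:
  assumes "\<forall>v\<in>{0..<N}. d v \<le> k"
  shows "0 \<le> scan_potential k d p"
  unfolding scan_potential_def using assms count_upto_nonneg
  by (intro sum_nonneg add_nonneg_nonneg mult_nonneg_nonneg) auto

lemma scan_potential_change:
  assumes "c \<in> {0..<N}" "\<And>v. v \<in> {0..<N} \<Longrightarrow> v \<noteq> c \<Longrightarrow> d' v = d v \<and> p' v = p v"
  shows "scan_potential k d' p' - scan_potential k d p =
    ((k - d' c) * (count_upto c (2 * M - 1) + 1) + count_upto c (p' c)) -
    ((k - d c) * (count_upto c (2 * M - 1) + 1) + count_upto c (p c))"
  unfolding scan_potential_def using assms
  by (simp add: sum.remove[of "{0..<N}" c])

lemma scan_potential_scan: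
  assumes "c \<in> {0..<N}" "0 \<le> p c" "hv (p c) = c" "is_prev q c (p c)"
  shows "scan_potential k d (p(c := q)) = scan_potential k d p - 1"
  using scan_potential_change[of c d d "p(c := q)" p k] count_upto_prev[of q c "p c"] assms by simp

text \<open>Raising the label releases the degree plus 1, and refilling the list takes the degree
  back.\<close>

lemma scan_potential_relabel:
  assumes "c \<in> {0..<N}" "p c = -1" "is_prev q c (2 * M)"
  shows "scan_potential k (d(c := d c + 1)) (p(c := q)) = scan_potential k d p - 1"
  using scan_potential_change[of c "d(c := d c + 1)" d "p(c := q)" p k] count_upto_first[of q c] count_upto_empty assms
  by (simp add: algebra_simps)

lemma sum_degrees: "(\<Sum>v\<in>{0..<N}. count_upto v (2 * M - 1)) = 2 * M"
proof -
  have "(\<Sum>v\<in>{0..<N}. card {g \<in> {0..2 * M - 1}. hv g = v}) = card (\<Union>v\<in>{0..<N}. {g \<in> {0..2 * M - 1}. hv g = v})"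
    by (rule card_UN_disjoint[symmetric]) (auto intro: finite_subset[of _ "{0..2 * M - 1}"])
  also have "(\<Union>v\<in>{0..<N}. {g \<in> {0..2 * M - 1}. hv g = v}) = {0..2 * M - 1}"
    using hv_range by auto
  finally show ?thesis using M_nonneg by (simp add: count_upto_def flip: of_nat_sum)
qed

lemma scan_potential_init:
  assumes "1 \<le> k" "\<forall>v\<in>{0..<N}. d v = 0 \<and> is_prev (p v) v (2 * M)"
  shows "scan_potential k d p \<le> 4 * k * M + k * N"
proof -
  have "scan_potential k d p = (\<Sum>v\<in>{0..<N}. k * (count_upto v (2 * M - 1) + 1) + count_upto v (2 * M - 1))"
    unfolding scan_potential_def using assms(2) count_upto_first by (intro sum.cong) auto
  also have "\<dots> = k * (2 * M + N) + 2 * M"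
    using N_nonneg by (simp add: sum.distrib sum_degrees flip: sum_distrib_left)
  also have "\<dots> \<le> 4 * k * M + k * N"
    using mult_right_mono[OF assms(1) M_nonneg] by (simp add: algebra_simps)
  finally show ?thesis .
qed

section \<open>Each kind of step preserves the discharging invariant\<close>

lemma pointer_update:
  assumes "\<forall>v\<in>{0..<N}. d v \<le> k \<and> p v < 2 * M \<and> (0 \<le> p v \<longrightarrow> hv (p v) = v) \<and> -1 \<le> p v"
    and "d' c \<le> k" "q < 2 * M" "0 \<le> q \<longrightarrow> hv q = c" "-1 \<le> q" "\<And>v. v \<noteq> c \<Longrightarrow> d' v = d v"
  shows "\<forall>v\<in>{0..<N}. d' v \<le> k \<and> (p(c := q)) v < 2 * M \<and>
    (0 \<le> (p(c := q)) v \<longrightarrow> hv ((p(c := q)) v) = v) \<and> -1 \<le> (p(c := q)) v"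
proof
  fix v assume "v \<in> {0..<N}"
  with assms show "d' v \<le> k \<and> (p(c := q)) v < 2 * M \<and>
      (0 \<le> (p(c := q)) v \<longrightarrow> hv ((p(c := q)) v) = v) \<and> -1 \<le> (p(c := q)) v"
    by (cases "v = c") simp_all
qed

lemma discharging_skip:
  assumes D: "discharging r k x e d p i cur" and i: "i < N" and p: "0 \<le> p cur" "is_prev q cur (p cur)"
    and no: "\<not> (residual r x (p cur) \<and> d (hw (p cur)) < d cur)"
  shows "discharging r k x e d (p(cur := q)) i cur"
proof -
  have cur: "cur \<in> {0..<N}" "hv (p cur) = cur" "p cur < 2 * M" using D i p by (auto simp: discharging_def)
  then have q2: "q < 2 * M" using p by (simp add: is_prev_def)
  have adm: "d (hv g) \<le> d (hw g)" if g: "residual r x g" "(p(cur := q)) (hv g) < g" for g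
  proof (cases "hv g = cur \<and> g \<le> p cur")
    case True
    \<comment> \<open>As \<open>q\<close> is the next entry of the list, the half-edge just
      inspected is the only one that newly lies above the pointer.\<close>
    then have "g = p cur" using p g(2) by (auto simp: is_prev_def)
    then show ?thesis using no g cur by simp
  next
    case False
    then have "p (hv g) < g" using g(2) by (auto split: if_splits)
    then show ?thesis using D g(1) unfolding discharging_def by blast
  qed
  show ?thesis
    unfolding discharging_def
  proof (intro conjI)
    show "\<forall>g. residual r x g \<longrightarrow> (p(cur := q)) (hv g) < g \<longrightarrow> d (hv g) \<le> d (hw g)" using adm by blast
    show "\<forall>v\<in>{0..<N}. d v \<le> k \<and> (p(cur := q)) v < 2 * M \<and>
        (0 \<le> (p(cur := q)) v \<longrightarrow> hv ((p(cur := q)) v) = v) \<and> -1 \<le> (p(cur := q)) v"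
      by (rule pointer_update) (use D p cur q2 in \<open>simp_all add: discharging_def is_prev_def\<close>)
  qed (use D in \<open>simp_all add: discharging_def\<close>)
qed

text \<open>\<open>h\<close> stops being residual, so the pointer may pass it although it was
  admissible; its reverse leads uphill and is therefore valid and inadmissible.\<close>

lemma discharging_push:
  fixes cur h d e i k p q r x
  defines "h \<equiv> p cur"
  assumes D: "discharging r k x e d p i cur" and i: "i < N" and p: "0 \<le> h" "is_prev q cur h"
    and res: "residual r x h" "d (hw h) < d cur" and act: "active k e d cur"
  shows "discharging r k (x(arc h := 1 - dir h)) (e(cur := e cur - 1, hw h := e (hw h) + 1)) d (p(cur := q)) i (hw h)"
proof -
  have cur: "cur \<in> {0..<N}" "hv h = cur" "h < 2 * M" using D i p by (auto simp: discharging_def h_def)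
  have w: "hw h \<in> {0..<N}" using res hw_range by (auto simp: residual_def)
  have ne: "hw h \<noteq> cur" using res by auto
  let ?x = "x(arc h := 1 - dir h)" and ?e = "e(cur := e cur - 1, hw h := e (hw h) + 1)"
  have uf: "unit_flow r ?x" using D res by (auto simp: discharging_def unit_flow_push)
  have ex: "\<forall>v\<in>{0..<N}. ?e v = excess ?x v"
    using D cur ne by (auto simp: discharging_def excess_push[OF res(1)])
  have dnn: "0 \<le> d v" if "v \<in> {0..<N}" for v using D that by (auto simp: discharging_def labelling_def)
  have valid: "d (hv g) \<le> d (hw g) + 1" if "residual r ?x g" for g
    using residual_push[OF res(1) that]
  proof
    assume "residual r x g \<and> g \<noteq> h"
    then show ?thesis using D by (auto simp: discharging_def labelling_def)
  next
    assume "hv g = hw h \<and> hw g = hv h"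
    then show ?thesis using res cur by simp
  qed
  have lab: "labelling r ?x d"
    unfolding labelling_def
  proof (intro conjI ballI allI impI valid)
    fix v assume v: "v \<in> {0..<N}"
    then show "0 \<le> d v" by (rule dnn)
    assume "excess ?x v < 0"
    then have "?e v < 0" using ex v by simp
    \<comment> \<open>Only \<open>cur\<close> loses excess, and being active it keeps a nonnegative
      amount: a push creates no deficit.\<close>
    then have "e v < 0" using act by (auto simp: active_def split: if_splits)
    then show "d v = 0" using D v by (auto simp: discharging_def labelling_def)
  qed
  have adm: "d (hv g) \<le> d (hw g)" if g: "residual r ?x g" "(p(cur := q)) (hv g) < g" for g
    using residual_push[OF res(1) g(1)]
  proof
    assume g': "residual r x g \<and> g \<noteq> h"
    have "p (hv g) < g"
    proof (cases "hv g = cur")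
      case True
      then have "q < g" using g(2) by simp
      then have "\<not> g < h" using p(2) True by (auto simp: is_prev_def)
      then show ?thesis using g' True by (simp add: h_def)
    qed (use g(2) in simp)
    then show ?thesis using D g' unfolding discharging_def by blast
  next
    assume "hv g = hw h \<and> hw g = hv h"
    then show ?thesis using res cur by simp
  qed
  \<comment> \<open>If \<open>cur\<close> is below \<open>i\<close>, it held at most one unit and is
    now empty.\<close>
  have inact: "\<not> active k ?e d v" if "v \<in> {0..<N}" "v < i" "v \<noteq> hw h" for v
    using D that unfolding discharging_def active_def by (cases "v = cur") auto
  \<comment> \<open>A vertex below \<open>i\<close> that receives the unit was inactive: either it
    had no positive excess and now has at most 1, or its label has reached \<open>k\<close>.\<close>
  have carried: "?e (hw h) \<le> 1 \<or> k \<le> d (hw h)" if "hw h < i"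
  proof -
    have "\<not> active k e d (hw h)" using D that w ne unfolding discharging_def by blast
    then show ?thesis by (auto simp: active_def)
  qed
  have ptr: "\<forall>v\<in>{0..<N}. d v \<le> k \<and> (p(cur := q)) v < 2 * M \<and>
      (0 \<le> (p(cur := q)) v \<longrightarrow> hv ((p(cur := q)) v) = v) \<and> -1 \<le> (p(cur := q)) v"
    by (rule pointer_update) (use D p cur in \<open>simp_all add: discharging_def is_prev_def\<close>)
  have "0 \<le> i" "i \<le> N" using D by (auto simp: discharging_def)
  then show ?thesis
    unfolding discharging_def
    by (intro conjI uf ex lab ptr impI allI ballI adm inact carried w) assumption+
qed

text \<open>With the list exhausted, no residual half-edge at \<open>cur\<close> leads downhill, so
  one more level keeps the labels valid. Positive excess exempts \<open>cur\<close> from the rule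
  that deficits have label 0.\<close>

lemma discharging_relabel:
  assumes D: "discharging r k x e d p i cur" and i: "i < N" and p: "p cur = -1" "is_prev q cur (2 * M)"
    and act: "active k e d cur"
  shows "discharging r k x e (d(cur := d cur + 1)) (p(cur := q)) i cur"
proof -
  let ?d = "d(cur := d cur + 1)"
  have cur: "cur \<in> {0..<N}" using D i by (auto simp: discharging_def)
  have ge: "0 \<le> g" if "residual r x g" for g using that by (auto simp: residual_def)
  have valid: "?d (hv g) \<le> ?d (hw g) + 1" if g: "residual r x g" for g
  proof (cases "hv g = cur")
    case True
    then have "p (hv g) < g" using p ge[OF g] by simp
    then have "d (hv g) \<le> d (hw g)" using D g unfolding discharging_def by blast
    then show ?thesis using True by simp
  next
    case False
    have "d (hv g) \<le> d (hw g) + 1" using D g by (auto simp: discharging_def labelling_def)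
    then show ?thesis using False by (cases "hw g = cur") simp_all
  qed
  have "excess x cur = e cur" using D cur by (auto simp: discharging_def)
  then have "labelling r x d" "0 < excess x cur" using D act by (auto simp: discharging_def active_def)
  then have lab: "labelling r x ?d"
    unfolding labelling_def using valid by (auto simp: less_le_not_le)
  have adm: "?d (hv g) \<le> ?d (hw g)" if g: "residual r x g" "(p(cur := q)) (hv g) < g" for g
  proof (cases "hv g = cur")
    case True
    \<comment> \<open>The pointer is back at the head of the list, so no half-edge of
      \<open>cur\<close> lies above it and the case is contradictory.\<close>
    have "g < 2 * M" using g(1) by (auto simp: residual_def)
    then show ?thesis using True g(2) p(2) by (auto simp: is_prev_def)
  next
    case False
    then have "d (hv g) \<le> d (hw g)" using D g unfolding discharging_def by simp
    then show ?thesis using False by (cases "hw g = cur") simp_all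
  qed
  have "\<forall>v\<in>{0..<N}. ?d v \<le> k \<and> (p(cur := q)) v < 2 * M \<and>
      (0 \<le> (p(cur := q)) v \<longrightarrow> hv ((p(cur := q)) v) = v) \<and> -1 \<le> (p(cur := q)) v"
    by (rule pointer_update[where d = d])
      (use D p act in \<open>simp_all add: discharging_def is_prev_def active_def\<close>)
  moreover have "\<forall>v\<in>{0..<N}. v < i \<longrightarrow> v \<noteq> cur \<longrightarrow> \<not> active k e ?d v"
    using D by (simp add: discharging_def active_def)
  moreover have "cur < i \<longrightarrow> e cur \<le> 1 \<or> k \<le> ?d cur"
    using D by (auto simp: discharging_def)
  ultimately show ?thesis
    unfolding discharging_def using lab adm D by (simp add: discharging_def)
qed

text \<open>A carried unit ends in a deficit or at label \<open>k\<close>. Either way all vertices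
  below \<open>i\<close> are inactive again, and work resumes at \<open>i\<close>.\<close>

lemma discharging_return:
  assumes D: "discharging r k x e d p i cur" and i: "i < N" and act: "\<not> active k e d cur"
  shows "discharging r k x e d p i i"
  unfolding discharging_def using D i act by (auto simp: discharging_def)

lemma discharging_next:
  assumes D: "discharging r k x e d p i i" and i: "i < N" and act: "\<not> active k e d i"
  shows "discharging r k x e d p (i + 1) (i + 1)"
  unfolding discharging_def using D i act by (auto simp: discharging_def zless_add1_eq)

lemma discharging_final:
  assumes D: "discharging r k x e d p i cur" and i: "N \<le> i" and cur: "cur = i" and "feas r" "1 \<le> k"
  shows "total_excess (excess x) * k \<le> M" "total_excess (excess x) * k\<^sup>2 \<le> 2 * N\<^sup>2"
proof -
  have "k \<le> d v" if "v \<in> {0..<N}" "0 < excess x v" for v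
    using D i cur that by (force simp: discharging_def active_def)
  moreover have "unit_flow r x" "labelling r x d" using D by (auto simp: discharging_def)
  ultimately show "total_excess (excess x) * k \<le> M" "total_excess (excess x) * k\<^sup>2 \<le> 2 * N\<^sup>2"
    using level_bounds assms(4,5) by blast+
qed

end

section \<open>The push-relabel program\<close>

definition init_vertex :: com where
  "init_vertex =
    (Store ''e'' (Var ''v'') (Cell ''supply'' (Var ''v'')) ;;
       Store ''d'' (Var ''v'') (Const 0) ;;
       Store ''ptr'' (Var ''v'') (Cell ''first'' (Var ''v'')))"

definition init_flow :: com where
  "init_flow =
    (For ''v'' ''n'' init_vertex ;;
     For ''j'' ''m'' (Store ''x'' (Var ''j'') (Const 0)))"

definition push_along :: com where
  "push_along =
    (Store ''x'' (Cell ''arc'' (Var ''h'')) (Sub One (Cell ''dir'' (Var ''h''))) ;;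
     Store ''e'' (Var ''cur'') (Sub (Cell ''e'' (Var ''cur'')) One) ;;
     ''cur'' ::= Cell ''hw'' (Var ''h'') ;;
     Store ''e'' (Var ''cur'') (Add (Cell ''e'' (Var ''cur'')) One))"

text \<open>The machine tests only for positivity, so equality of flow value and direction takes two
  strict tests, with \<open>c\<close> in the branch where both fail.\<close>

definition if_residual :: "string \<Rightarrow> com \<Rightarrow> com" where
  "if_residual x c =
    (IfPos (Sub (Var ''r'') (Cell ''arc'' (Var ''h'')))
      (IfPos (Sub (Cell x (Cell ''arc'' (Var ''h''))) (Cell ''dir'' (Var ''h''))) Skip
        (IfPos (Sub (Cell ''dir'' (Var ''h'')) (Cell x (Cell ''arc'' (Var ''h'')))) Skip c))
      Skip)"

definition scan_half_edge :: com where
  "scan_half_edge =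
    (Store ''ptr'' (Var ''cur'') (Cell ''link'' (Var ''h'')) ;;
     if_residual ''x''
       (IfPos (Sub (Cell ''d'' (Var ''cur'')) (Cell ''d'' (Cell ''hw'' (Var ''h'')))) push_along Skip))"

definition relabel :: com where
  "relabel =
    (Store ''d'' (Var ''cur'') (Add (Cell ''d'' (Var ''cur'')) One) ;;
     Store ''ptr'' (Var ''cur'') (Cell ''first'' (Var ''cur'')))"

text \<open>An inactive \<open>cur\<close> different from \<open>i\<close> ends the journey of a
  carried unit; an inactive \<open>i\<close> itself lets the sweep advance. The two sign tests
  distinguish these cases.\<close>

definition retire :: com where
  "retire =
    (IfPos (Sub (Var ''i'') (Var ''cur'')) (''cur'' ::= Var ''i'')
      (IfPos (Sub (Var ''cur'') (Var ''i'')) (''cur'' ::= Var ''i'')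
        (''i'' ::= Add (Var ''i'') One ;; ''cur'' ::= Var ''i'')))"

definition discharge_step :: com where
  "discharge_step =
    (IfPos (Cell ''e'' (Var ''cur''))
      (IfPos (Sub (Var ''k'') (Cell ''d'' (Var ''cur'')))
        (''h'' ::= Cell ''ptr'' (Var ''cur'') ;;
         IfPos (Add (Var ''h'') One) scan_half_edge relabel)
        retire)
      retire)"

definition push_relabel :: com where
  "push_relabel = (init_flow ;; ''i'' ::= Const 0 ;; ''cur'' ::= Const 0 ;;
     WhilePos (Sub (Var ''n'') (Var ''i'')) discharge_step)"

definition sum_excesses :: com where
  "sum_excesses = (''F'' ::= Const 0 ;;
     For ''v'' ''n'' (IfPos (Cell ''e'' (Var ''v'')) (''F'' ::= Add (Var ''F'') (Cell ''e'' (Var ''v''))) Skip))"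

definition test_threshold :: com where
  "test_threshold = (push_relabel ;; sum_excesses)"

lemma writes_discharge_step: "writes discharge_step = {''x'', ''e'', ''d'', ''ptr'', ''h'', ''cur'', ''i''}"
  by (auto simp: discharge_step_def scan_half_edge_def relabel_def retire_def if_residual_def push_along_def)

lemma writes_test_threshold:
  "writes test_threshold = {''x'', ''e'', ''d'', ''ptr'', ''h'', ''cur'', ''i'', ''v'', ''j'', ''F''}"
  by (auto simp: test_threshold_def push_relabel_def init_flow_def init_vertex_def sum_excesses_def writes_discharge_step)

context flow_network
begin

lemma wp_init_flow:
  assumes g: "graph_ok s"
  shows "wp init_flow (\<lambda>s' t'. t' \<le> t + 50 * (N + M + 1) \<and> (\<forall>j\<in>{0..<M}. s' ''x'' j = 0) \<and>
    (\<forall>v\<in>{0..<N}. s' ''e'' v = b v \<and> s' ''d'' v = 0 \<and> s' ''ptr'' v = s ''first'' v)) s t"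
proof -
  have s: "s ''n'' 0 = N" "s ''m'' 0 = M" and b: "\<And>v. v \<in> {0..<N} \<Longrightarrow> s ''supply'' v = b v"
    using g by (auto simp: graph_ok_def)
  let ?I = "\<lambda>i s'. \<forall>v\<in>{0..<i}. s' ''e'' v = b v \<and> s' ''d'' v = 0 \<and> s' ''ptr'' v = s ''first'' v"
  have 1: "wp (For ''v'' ''n'' init_vertex)
    (\<lambda>s' t'. t' \<le> t + 35 * N + 9 \<and> ?I N s') s t"
  proof (rule wp_For[where h = N and k = 23 and I = ?I], goal_cases)
    case (8 i s1 t1)
    then have "s1 ''supply'' i = b i" "s1 ''first'' i = s ''first'' i"
      using b by (auto simp: agree_def init_vertex_def)
    moreover have "v < i + 1 \<longleftrightarrow> v < i \<or> v = i" for v by auto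
    ultimately show ?case using 8(3,4) by (auto simp: init_vertex_def)
  qed (use s N_nonneg in \<open>auto simp: init_vertex_def\<close>)
  show ?thesis
    unfolding init_flow_def wp_Seq
  proof (rule wp_mono[OF 1])
    fix s1 t1
    assume h: "t1 \<le> t + 35 * N + 9 \<and> ?I N s1"
      and "agree (writes (For ''v'' ''n'' init_vertex)) s1 s"
    then have f: "s1 ''m'' 0 = M" using s by (auto simp: agree_def init_vertex_def)
    show "wp (For ''j'' ''m'' (Store ''x'' (Var ''j'') (Const 0)))
      (\<lambda>s' t'. t' \<le> t + 50 * (N + M + 1) \<and> (\<forall>j\<in>{0..<M}. s' ''x'' j = 0) \<and> ?I N s') s1 t1"
    proof (rule wp_For[where h = M and k = 5 and I = "\<lambda>i s'. \<forall>j\<in>{0..<i}. s' ''x'' j = 0"], goal_cases)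
      case (9 s2 t2)
      then show ?case using h N_nonneg M_nonneg by (auto simp: agree_def)
    qed (use f M_nonneg in auto)
  qed
qed

definition discharging_state :: "int \<Rightarrow> int \<Rightarrow> state \<Rightarrow> bool" where
  "discharging_state r k s \<longleftrightarrow> graph_ok s \<and> s ''r'' 0 = r \<and> s ''k'' 0 = k \<and>
    discharging r k (s ''x'') (s ''e'') (s ''d'') (s ''ptr'') (s ''i'' 0) (s ''cur'' 0) \<and>
    (N \<le> s ''i'' 0 \<longrightarrow> s ''cur'' 0 = s ''i'' 0)"

text \<open>Each step lowers this by at least 1, and 200 clock units per unit of potential cover a
  step. The weight 2 on scans absorbs the indicator, which a push may switch on by moving
  \<open>cur\<close> away from \<open>i\<close>; the step returning to \<open>i\<close> is then paid
  by the indicator.\<close>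

definition discharging_potential :: "int \<Rightarrow> state \<Rightarrow> int" where
  "discharging_potential k s = 2 * scan_potential k (s ''d'') (s ''ptr'') + 2 * (N - s ''i'' 0) +
    of_bool (s ''cur'' 0 \<noteq> s ''i'' 0)"

lemma discharging_potential_nonneg: "discharging_state r k s \<Longrightarrow> 0 \<le> discharging_potential k s"
  using scan_potential_nonneg[of "s ''d''" k "s ''ptr''"]
  by (auto simp: discharging_state_def discharging_potential_def discharging_def)

lemma wp_retire:
  assumes st: "discharging_state r k s" "s ''i'' 0 < N" and inact: "\<not> active k (s ''e'') (s ''d'') (s ''cur'' 0)"
  shows "wp retire (\<lambda>s' t'. discharging_state r k s' \<and>
    t' + 200 * discharging_potential k s' \<le> t + 40 + 200 * (discharging_potential k s - 1)) s t"
proof -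
  have D: "discharging r k (s ''x'') (s ''e'') (s ''d'') (s ''ptr'') (s ''i'' 0) (s ''cur'' 0)"
    and g: "graph_ok s" "s ''r'' 0 = r" "s ''k'' 0 = k"
    using st by (auto simp: discharging_state_def)
  have g': "graph_ok s'" if "agree {''i'', ''cur''} s' s" for s'
    by (rule graph_ok_agree[OF g(1) that]) simp
  show ?thesis
  proof (cases "s ''cur'' 0 = s ''i'' 0")
    case True
    have "discharging r k (s ''x'') (s ''e'') (s ''d'') (s ''ptr'') (s ''i'' 0 + 1) (s ''i'' 0 + 1)"
      using D st inact True by (intro discharging_next) auto
    then show ?thesis using True g g'
      by (simp add: retire_def discharging_state_def discharging_potential_def agree_def)
  next
    case False
    have "discharging r k (s ''x'') (s ''e'') (s ''d'') (s ''ptr'') (s ''i'' 0) (s ''i'' 0)"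
      using D st inact by (rule_tac discharging_return)
    then show ?thesis using False g g' st
      by (simp add: retire_def discharging_state_def discharging_potential_def agree_def)
  qed
qed

lemma wp_relabel:
  assumes st: "discharging_state r k s" "s ''i'' 0 < N" and act: "active k (s ''e'') (s ''d'') (s ''cur'' 0)"
    and p: "s ''ptr'' (s ''cur'' 0) = -1"
  shows "wp relabel (\<lambda>s' t'. discharging_state r k s' \<and>
    t' + 200 * discharging_potential k s' \<le> t + 40 + 200 * (discharging_potential k s - 1)) s t"
proof -
  let ?c = "s ''cur'' 0" let ?q = "s ''first'' ?c"
  have D: "discharging r k (s ''x'') (s ''e'') (s ''d'') (s ''ptr'') (s ''i'' 0) ?c"
    and g: "graph_ok s" "s ''r'' 0 = r" "s ''k'' 0 = k"
    using st by (auto simp: discharging_state_def)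
  have g': "graph_ok s'" if "agree {''d'', ''ptr''} s' s" for s'
    by (rule graph_ok_agree[OF g(1) that]) simp
  have c: "?c \<in> {0..<N}" using D st(2) by (auto simp: discharging_def)
  then have q: "is_prev ?q ?c (2 * M)" using g by (auto simp: graph_ok_def)
  have "discharging r k (s ''x'') (s ''e'') ((s ''d'')(?c := s ''d'' ?c + 1)) ((s ''ptr'')(?c := ?q)) (s ''i'' 0) ?c"
    by (rule discharging_relabel[OF D st(2) p q act])
  moreover have "scan_potential k ((s ''d'')(?c := s ''d'' ?c + 1)) ((s ''ptr'')(?c := ?q)) =
      scan_potential k (s ''d'') (s ''ptr'') - 1"
    by (rule scan_potential_relabel) (use c p q in auto)
  ultimately show ?thesis using g g' st
    by (simp add: relabel_def discharging_state_def discharging_potential_def agree_def)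
qed

lemma wp_if_residual:
  assumes "half_edges_ok s" "s ''r'' 0 = r" "s ''h'' 0 = h" "h \<in> {0..<2*M}"
    and "\<And>u. residual r (s x) h \<Longrightarrow> u \<le> t + 26 \<Longrightarrow> wp c Q s u"
    and "\<And>u. \<not> residual r (s x) h \<Longrightarrow> u \<le> t + 26 \<Longrightarrow> Q s u"
  shows "wp (if_residual x c) Q s t"
  using assms(5,6) assms(1-4)
  by (cases "residual r (s x) h") (auto simp: if_residual_def residual_def half_edges_ok_def)

lemma wp_scan_half_edge:
  assumes st: "discharging_state r k s" "s ''i'' 0 < N" and act: "active k (s ''e'') (s ''d'') (s ''cur'' 0)"
    and h: "s ''h'' 0 = s ''ptr'' (s ''cur'' 0)" "0 \<le> s ''h'' 0"
  shows "wp scan_half_edge (\<lambda>s' t'. discharging_state r k s' \<and>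
    t' + 200 * discharging_potential k s' \<le> t + 80 + 200 * (discharging_potential k s - 1)) s t"
proof -
  let ?c = "s ''cur'' 0" let ?h = "s ''h'' 0" let ?q = "s ''link'' ?h"
  have D: "discharging r k (s ''x'') (s ''e'') (s ''d'') (s ''ptr'') (s ''i'' 0) ?c"
    and g: "graph_ok s" "s ''r'' 0 = r" "s ''k'' 0 = k"
    using st by (auto simp: discharging_state_def)
  have g': "graph_ok s'" if "agree {''x'', ''e'', ''cur'', ''ptr''} s' s" for s'
    by (rule graph_ok_agree[OF g(1) that]) simp
  have c: "?c \<in> {0..<N}" "hv ?h = ?c" "?h \<in> {0..<2*M}" using D st(2) h by (auto simp: discharging_def)
  have "is_prev ?q (hv ?h) ?h" and he: "half_edges_ok s" using g c(3) by (simp_all add: graph_ok_def)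
  then have q: "is_prev ?q ?c ?h" using c(2) by simp
  have he': "s ''hw'' ?h = hw ?h" "s ''arc'' ?h = arc ?h" "s ''dir'' ?h = dir ?h"
    using he c(3) by (auto simp: half_edges_ok_def)
  have pot: "scan_potential k (s ''d'') ((s ''ptr'')(?c := ?q)) = scan_potential k (s ''d'') (s ''ptr'') - 1"
    using scan_potential_scan[of ?c "s ''ptr''" ?q] c q h by simp
  let ?s = "s(''ptr'' := (s ''ptr'')(?c := ?q))"
  let ?Q = "\<lambda>s' t'. discharging_state r k s' \<and>
    t' + 200 * discharging_potential k s' \<le> t + 80 + 200 * (discharging_potential k s - 1)"
  have skip: "?Q ?s u" if "\<not> (residual r (s ''x'') ?h \<and> s ''d'' (hw ?h) < s ''d'' ?c)" "u \<le> t + 80" for u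
  proof -
    have "discharging r k (s ''x'') (s ''e'') (s ''d'') ((s ''ptr'')(?c := ?q)) (s ''i'' 0) ?c"
      by (rule discharging_skip[OF D st(2)]) (use that h q in auto)
    then show ?thesis using that g g' st pot
      by (simp add: discharging_state_def discharging_potential_def agree_def)
  qed
  have "wp (if_residual ''x''
       (IfPos (Sub (Cell ''d'' (Var ''cur'')) (Cell ''d'' (Cell ''hw'' (Var ''h'')))) push_along Skip)) ?Q ?s u"
    if u: "u \<le> t + 7" for u
  proof (rule wp_if_residual[where h = ?h and r = r])
    show "half_edges_ok ?s" using he by (simp add: half_edges_ok_def)
    show "?Q ?s u'" if "\<not> residual r (?s ''x'') ?h" "u' \<le> u + 26" for u'
      by (rule skip) (use that u in auto)
    fix u' assume res: "residual r (?s ''x'') ?h" and u': "u' \<le> u + 26"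
    show "wp (IfPos (Sub (Cell ''d'' (Var ''cur'')) (Cell ''d'' (Cell ''hw'' (Var ''h'')))) push_along Skip) ?Q ?s u'"
    proof (cases "s ''d'' (hw ?h) < s ''d'' ?c")
      case False
      then show ?thesis using skip[of "u' + 10"] he' u u' by simp
    next
      case True
      have ne: "hw ?h \<noteq> ?c" using True by auto
      have "discharging r k ((s ''x'')(arc ?h := 1 - dir ?h)) ((s ''e'')(?c := s ''e'' ?c - 1, hw ?h := s ''e'' (hw ?h) + 1))
         (s ''d'') ((s ''ptr'')(?c := ?q)) (s ''i'' 0) (hw ?h)"
        using discharging_push[OF D st(2), of ?q] h q res True act by simp
      then show ?thesis using True he' g g' st pot ne u u'
        by (simp add: push_along_def discharging_state_def discharging_potential_def agree_def)
    qed
  qed (use g c in auto)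
  then show ?thesis by (simp add: scan_half_edge_def)
qed

lemma wp_discharge_step:
  assumes st: "discharging_state r k s" "s ''i'' 0 < N"
  shows "wp discharge_step (\<lambda>s' t'. discharging_state r k s' \<and>
    t' + 200 * discharging_potential k s' \<le> t + 110 + 200 * (discharging_potential k s - 1)) s t"
    (is "wp _ ?Q s t")
proof -
  let ?c = "s ''cur'' 0"
  have k: "s ''k'' 0 = k" using st by (simp add: discharging_state_def)
  show ?thesis
  proof (cases "active k (s ''e'') (s ''d'') ?c")
    case False
    have "wp retire ?Q s u" if "u \<le> t + 20" for u
      by (rule wp_mono[OF wp_retire[OF st False]]) (use that in auto)
    then show ?thesis using False k by (auto simp: discharge_step_def active_def)
  next
    case True
    let ?s = "s(''h'' := (s ''h'')(0 := s ''ptr'' ?c))"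
    have st': "discharging_state r k ?s"
      using st(1) graph_ok_agree[of s "{''h''}" ?s] by (simp add: discharging_state_def agree_def)
    moreover have pot: "discharging_potential k ?s = discharging_potential k s"
      by (simp add: discharging_potential_def)
    moreover have p: "-1 \<le> s ''ptr'' ?c" using st by (simp add: discharging_state_def discharging_def)
    ultimately have "wp scan_half_edge ?Q ?s u" if "0 \<le> s ''ptr'' ?c" "u \<le> t + 30" for u
      using wp_mono[OF wp_scan_half_edge[of r k ?s u], of ?Q] st(2) True that by (simp add: active_def)
    moreover have "wp relabel ?Q ?s u" if "\<not> 0 \<le> s ''ptr'' ?c" "u \<le> t + 30" for u
      using wp_mono[OF wp_relabel[of r k ?s u], of ?Q] st(2) True that st' pot p by (simp add: active_def)
    ultimately show ?thesis using True k by (simp add: discharge_step_def active_def)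
  qed
qed

lemma wp_push_relabel:
  assumes g: "graph_ok s" and r: "s ''r'' 0 = r" and k: "s ''k'' 0 = k" "1 \<le> k"
  shows "wp push_relabel (\<lambda>s' t'. t' \<le> t + 3000 * k * (N + M + 1) \<and> unit_flow r (s' ''x'') \<and>
    (\<forall>v\<in>{0..<N}. s' ''e'' v = excess (s' ''x'') v) \<and>
    (feas r \<longrightarrow> total_excess (excess (s' ''x'')) * k \<le> M \<and> total_excess (excess (s' ''x'')) * k\<^sup>2 \<le> 2 * N\<^sup>2)) s t"
    (is "wp _ ?Q s t")
  unfolding push_relabel_def wp_Seq
proof (rule wp_mono[OF wp_init_flow[OF g]])
  fix s1 t1
  assume h: "t1 \<le> t + 50 * (N + M + 1) \<and> (\<forall>j\<in>{0..<M}. s1 ''x'' j = 0) \<and>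
    (\<forall>v\<in>{0..<N}. s1 ''e'' v = b v \<and> s1 ''d'' v = 0 \<and> s1 ''ptr'' v = s ''first'' v)"
    and ag: "agree (writes init_flow) s1 s"
  let ?s = "s1(''i'' := (s1 ''i'')(0 := 0), ''cur'' := (s1 ''cur'')(0 := 0))"
  have "agree ({''i'', ''cur''} \<union> writes init_flow) ?s s" using ag by (simp add: agree_def)
  then have g': "graph_ok ?s" by (rule graph_ok_agree[OF g]) (simp add: init_flow_def init_vertex_def)
  have first: "is_prev (s1 ''ptr'' v) v (2 * M)" if "v \<in> {0..<N}" for v
    using h g that by (simp add: graph_ok_def)
  have ex: "excess (s1 ''x'') v = b v" for v
    using h by (simp add: excess_def)
  have noprev: "\<not> s1 ''ptr'' (hv g) < g" if "g \<in> {0..<2*M}" for g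
    using first[OF hv_range[OF that]] that by (auto simp: is_prev_def)
  have "discharging r k (s1 ''x'') (s1 ''e'') (s1 ''d'') (s1 ''ptr'') 0 0"
    unfolding discharging_def labelling_def
  proof (intro conjI ballI allI impI)
    show "unit_flow r (s1 ''x'')" using h by (simp add: unit_flow_def)
    \<comment> \<open>All labels are 0 at the start, which settles validity and the clause on passed
      half-edges alike.\<close>
    show "s1 ''d'' (hv g) \<le> s1 ''d'' (hw g) + 1" "s1 ''d'' (hv g) \<le> s1 ''d'' (hw g)" if "residual r (s1 ''x'') g" for g
      using h hv_range[of g] hw_range[of g] that by (simp_all add: residual_def)
  qed (use h ex first N_nonneg k in \<open>auto simp: is_prev_def\<close>)
  then have D: "discharging_state r k ?s"
    using g' k(1) r ag N_nonneg by (simp add: discharging_state_def agree_def init_flow_def init_vertex_def)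
  have pot: "discharging_potential k ?s \<le> 10 * k * (N + M)"
  proof -
    have "scan_potential k (s1 ''d'') (s1 ''ptr'') \<le> 4 * k * M + k * N"
      using h first by (intro scan_potential_init k) auto
    moreover have "N \<le> k * N" "0 \<le> k * M" using k N_nonneg M_nonneg by (simp_all add: mult_le_cancel_right1)
    ultimately show ?thesis using N_nonneg by (simp add: discharging_potential_def algebra_simps)
  qed
  have "N + M + 1 \<le> k * (N + M + 1)" "0 \<le> k * (N + M)" using k N_nonneg M_nonneg by (simp_all add: mult_le_cancel_right1)
  then have bound: "t1 + 300 + 200 * discharging_potential k ?s \<le> t + 3000 * k * (N + M + 1)"
    using pot h k(2) by (simp add: algebra_simps)
  have "wp (WhilePos (Sub (Var ''n'') (Var ''i'')) discharge_step) ?Q ?s t2" if t2: "t2 \<le> t1 + 50" for t2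
  proof (rule wp_While[where I = "\<lambda>s' t'. discharging_state r k s' \<and>
        t' + 200 * discharging_potential k s' \<le> t2 + 200 * discharging_potential k ?s"
        and B = "t2 + 200 * discharging_potential k ?s"])
    show "discharging_state r k ?s \<and> t2 + 200 * discharging_potential k ?s \<le> t2 + 200 * discharging_potential k ?s"
      using D by simp
  next
    fix s' t'
    assume "discharging_state r k s' \<and> t' + 200 * discharging_potential k s' \<le> t2 + 200 * discharging_potential k ?s"
    then show "t' \<le> t2 + 200 * discharging_potential k ?s"
      using discharging_potential_nonneg[of r k s'] by auto
  next
    fix s' t'
    assume I: "discharging_state r k s' \<and> t' + 200 * discharging_potential k s' \<le> t2 + 200 * discharging_potential k ?s"
      and "0 < eval (Sub (Var ''n'') (Var ''i'')) s'"
    then have "s' ''i'' 0 < N" by (simp add: discharging_state_def graph_ok_def)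
    then show "wp discharge_step (\<lambda>s' t'. discharging_state r k s' \<and>
        t' + 200 * discharging_potential k s' \<le> t2 + 200 * discharging_potential k ?s) s'
        (t' + (1 + cost (Sub (Var ''n'') (Var ''i''))))"
      using I by (intro wp_mono[OF wp_discharge_step]) auto
  next
    fix s' t'
    assume I: "discharging_state r k s' \<and> t' + 200 * discharging_potential k s' \<le> t2 + 200 * discharging_potential k ?s"
      and "eval (Sub (Var ''n'') (Var ''i'')) s' \<le> 0"
    then have D': "discharging r k (s' ''x'') (s' ''e'') (s' ''d'') (s' ''ptr'') (s' ''i'' 0) (s' ''cur'' 0)"
      and i: "N \<le> s' ''i'' 0" "s' ''cur'' 0 = s' ''i'' 0" by (auto simp: discharging_state_def graph_ok_def)
    have "t' + (1 + cost (Sub (Var ''n'') (Var ''i''))) \<le> t + 3000 * k * (N + M + 1)"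
      using I t2 bound discharging_potential_nonneg[of r k s'] by auto
    then show "?Q s' (t' + (1 + cost (Sub (Var ''n'') (Var ''i''))))"
      using D' discharging_final[OF D' i _ k(2)] by (auto simp: discharging_def)
  qed
  then show "wp (''i'' ::= Const 0) (wp (''cur'' ::= Const 0)
      (wp (WhilePos (Sub (Var ''n'') (Var ''i'')) discharge_step) ?Q)) s1 t1"
    by simp
qed

definition pseudoflow :: "int \<Rightarrow> (int \<Rightarrow> int) \<Rightarrow> (int \<Rightarrow> int) \<Rightarrow> int \<Rightarrow> bool" where
  "pseudoflow r x e F \<longleftrightarrow> unit_flow r x \<and> (\<forall>v\<in>{0..<N}. e v = excess x v) \<and> F = total_excess (excess x)"

lemma wp_test_threshold:
  assumes g: "graph_ok s" and r: "s ''r'' 0 = r" and k: "s ''k'' 0 = k" "1 \<le> k"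
  shows "wp test_threshold (\<lambda>s' t'. t' \<le> t + 3100 * k * (N + M + 1) \<and>
    pseudoflow r (s' ''x'') (s' ''e'') (s' ''F'' 0) \<and>
    (feas r \<longrightarrow> s' ''F'' 0 * k \<le> M \<and> s' ''F'' 0 * k\<^sup>2 \<le> 2 * N\<^sup>2)) s t"
    (is "wp _ ?Q s t")
  unfolding test_threshold_def wp_Seq
proof (rule wp_mono[OF wp_push_relabel[OF assms]])
  fix s1 t1
  assume h: "t1 \<le> t + 3000 * k * (N + M + 1) \<and> unit_flow r (s1 ''x'') \<and>
    (\<forall>v\<in>{0..<N}. s1 ''e'' v = excess (s1 ''x'') v) \<and>
    (feas r \<longrightarrow> total_excess (excess (s1 ''x'')) * k \<le> M \<and> total_excess (excess (s1 ''x'')) * k\<^sup>2 \<le> 2 * N\<^sup>2)"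
    and ag: "agree (writes push_relabel) s1 s"
  have n: "s1 ''n'' 0 = N" using g ag by (simp add: graph_ok_def agree_def push_relabel_def init_flow_def init_vertex_def writes_discharge_step)
  have "N + M + 1 \<le> k * (N + M + 1)" using k N_nonneg M_nonneg by (simp add: mult_le_cancel_right1)
  then have kN: "17 + 40 * N \<le> 100 * k * (N + M + 1)" using N_nonneg M_nonneg by (simp add: algebra_simps)
  have "wp (For ''v'' ''n'' (IfPos (Cell ''e'' (Var ''v'')) (''F'' ::= Add (Var ''F'') (Cell ''e'' (Var ''v''))) Skip))
    ?Q (s1(''F'' := (s1 ''F'')(0 := 0))) t2" if t2: "t2 \<le> t1 + 5" for t2
  proof (rule wp_For[where h = N and k = 28 and
      I = "\<lambda>i s'. s' ''F'' 0 = (\<Sum>v\<in>{0..<i}. max 0 (s1 ''e'' v))"], goal_cases)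
    case (8 i s2 t2)
    then have e: "s2 ''e'' i = s1 ''e'' i" by (simp add: agree_def)
    have "{0..<i + 1} = insert i {0..<i}" using 8(1) by auto
    then have "(\<Sum>v\<in>{0..<i + 1}. max 0 (s1 ''e'' v)) = (\<Sum>v\<in>{0..<i}. max 0 (s1 ''e'' v)) + max 0 (s1 ''e'' i)" by simp
    then show ?case using 8(3,4) e by simp
  next
    case (9 s2 t3)
    have "(\<Sum>v\<in>{0..<N}. max 0 (s1 ''e'' v)) = total_excess (excess (s1 ''x''))"
      unfolding total_excess_def using h by (intro sum.cong) auto
    then have F: "s2 ''F'' 0 = total_excess (excess (s1 ''x''))" using 9(1) by simp
    moreover have "t3 \<le> t + 3100 * k * (N + M + 1)" using 9(4) t2 h kN by (simp add: algebra_simps)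
    moreover have "s2 ''x'' = s1 ''x''" "s2 ''e'' = s1 ''e''" using 9(3) by (auto simp: agree_def)
    ultimately show ?case using h by (simp add: pseudoflow_def)
  qed (use n N_nonneg in auto)
  then show "wp sum_excesses ?Q s1 t1"
    by (simp add: sum_excesses_def)
qed

end

section \<open>Augmentation with rising thresholds\<close>

definition init_search :: com where
  "init_search = (''qt'' ::= Const 0 ;;
     For ''v'' ''n''
       (IfPos (Cell ''f'' (Var ''v''))
         (Store ''mark'' (Var ''v'') One ;; Store ''queue'' (Var ''qt'') (Var ''v'') ;; ''qt'' ::= Add (Var ''qt'') One)
         (Store ''mark'' (Var ''v'') (Const 0))) ;;
     ''qh'' ::= Const 0 ;; ''p'' ::= Const (-1) ;; ''goal'' ::= Const (-1) ;; ''go'' ::= One)"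

text \<open>The tail is tested as well, because a half-edge made available by raising the threshold
  may start outside the marked set.\<close>

definition reach :: com where
  "reach =
     (IfPos (Cell ''mark'' (Cell ''hv'' (Var ''h'')))
       (''w'' ::= Cell ''hw'' (Var ''h'') ;;
        IfPos (Cell ''mark'' (Var ''w'')) Skip
         (Store ''mark'' (Var ''w'') One ;; Store ''par'' (Var ''w'') (Var ''h'') ;;
          Store ''queue'' (Var ''qt'') (Var ''w'') ;; ''qt'' ::= Add (Var ''qt'') One ;;
          IfPos (Sub (Const 0) (Cell ''f'' (Var ''w''))) (''goal'' ::= Var ''w'' ;; ''go'' ::= Const 0) Skip))
       Skip)"

definition visit :: com where
  "visit = if_residual ''y'' reach"

definition search_step :: com where
  "search_step = IfPos (Add (Var ''p'') One)
     (''h'' ::= Var ''p'' ;; ''p'' ::= Cell ''link'' (Var ''p'') ;; visit)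
     (IfPos (Sub (Var ''qt'') (Var ''qh''))
       (''p'' ::= Cell ''first'' (Cell ''queue'' (Var ''qh'')) ;; ''qh'' ::= Add (Var ''qh'') One)
       (IfPos (Sub (Var ''m'') (Var ''r''))
         (''h'' ::= Var ''r'' ;; ''r'' ::= Add (Var ''r'') One ;; visit)
         (''go'' ::= Const 0)))"

definition search :: com where
  "search = (init_search ;; WhilePos (Var ''go'') search_step)"

definition augment_step :: com where
  "augment_step = (''h'' ::= Cell ''par'' (Var ''cur'') ;;
     Store ''y'' (Cell ''arc'' (Var ''h'')) (Sub One (Cell ''dir'' (Var ''h''))) ;;
     Store ''f'' (Var ''cur'') (Add (Cell ''f'' (Var ''cur'')) One) ;;
     ''cur'' ::= Cell ''hv'' (Var ''h'') ;;
     Store ''f'' (Var ''cur'') (Sub (Cell ''f'' (Var ''cur'')) One))"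

text \<open>The walk along the parents needs no explicit root test: taking a unit from a vertex
  without excess makes it negative and continues the loop, taking it from positive excess stops
  it.\<close>

definition augment :: com where
  "augment = (''cur'' ::= Var ''goal'' ;; WhilePos (Sub (Const 0) (Cell ''f'' (Var ''cur''))) augment_step)"

text \<open>The value -1 of \<open>R\<close> reports infeasibility and at the same time terminates
  the loop.\<close>

definition finish :: com where
  "finish = WhilePos (Var ''R'')
     (search ;; IfPos (Add (Var ''goal'') One) (augment ;; ''R'' ::= Sub (Var ''R'') One) (''R'' ::= Const (-1)))"

lemma writes_visit: "writes visit = {''w'', ''mark'', ''par'', ''queue'', ''qt'', ''goal'', ''go''}"
  by (auto simp: visit_def if_residual_def reach_def)

lemma writes_search_step:
  "writes search_step = {''h'', ''p'', ''qh'', ''r'', ''w'', ''mark'', ''par'', ''queue'', ''qt'', ''goal'', ''go''}"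
  by (auto simp: search_step_def writes_visit)

lemma writes_search:
  "writes search = {''v'', ''h'', ''p'', ''qh'', ''r'', ''w'', ''mark'', ''par'', ''queue'', ''qt'', ''goal'', ''go''}"
  by (auto simp: search_def init_search_def writes_search_step)

lemma writes_augment: "writes augment = {''h'', ''y'', ''f'', ''cur''}"
  by (auto simp: augment_def augment_step_def)

lemma writes_finish: "writes finish =
    {''v'', ''h'', ''p'', ''qh'', ''r'', ''w'', ''mark'', ''par'', ''queue'', ''qt'', ''goal'', ''go'', ''y'', ''f'', ''cur'', ''R''}"
  by (auto simp: finish_def writes_search writes_augment)

context flow_network
begin

section \<open>Invariants of the search and of the augmenting walk\<close>

lemma is_prev_le: "is_prev p v u \<Longrightarrow> hv g = v \<Longrightarrow> g < u \<Longrightarrow> g \<le> p"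
  by (meson is_prev_def linorder_not_less)

lemma is_prev_hv: "is_prev p v u \<Longrightarrow> 0 \<le> g \<Longrightarrow> g \<le> p \<Longrightarrow> hv p = v"
  by (simp add: is_prev_def)

lemma feas_mono: "feas r \<Longrightarrow> r \<le> r' \<Longrightarrow> feas r'"
  unfolding feas_def real_flow_def by (meson atLeastLessThan_iff order_trans)

text \<open>Queue positions serve as ranks: a parent stands strictly earlier, so following parents
  cannot cycle and takes fewer than \<open>N\<close> steps.\<close>

definition tree_edge :: "int \<Rightarrow> (int \<Rightarrow> int) \<Rightarrow> (int \<Rightarrow> int) \<Rightarrow> (int \<Rightarrow> int) \<Rightarrow> int \<Rightarrow> bool" where
  "tree_edge r y par Q i \<longleftrightarrow>
     residual r y (par (Q i)) \<and> hw (par (Q i)) = Q i \<and> (\<exists>j. 0 \<le> j \<and> j < i \<and> hv (par (Q i)) = Q j)"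

definition queue_ok :: "(int \<Rightarrow> int) \<Rightarrow> (int \<Rightarrow> int) \<Rightarrow> int \<Rightarrow> bool" where
  "queue_ok mark Q qt \<longleftrightarrow> 0 \<le> qt \<and> inj_on Q {0..<qt} \<and> Q ` {0..<qt} = {v \<in> {0..<N}. 0 < mark v}"

definition search_tree ::
  "int \<Rightarrow> (int \<Rightarrow> int) \<Rightarrow> (int \<Rightarrow> int) \<Rightarrow> (int \<Rightarrow> int) \<Rightarrow> (int \<Rightarrow> int) \<Rightarrow> (int \<Rightarrow> int) \<Rightarrow> int \<Rightarrow> bool" where
  "search_tree r y f mark par Q qt \<longleftrightarrow> queue_ok mark Q qt \<and>
     (\<forall>v\<in>{0..<N}. 0 < f v \<longrightarrow> 0 < mark v) \<and>
     (\<forall>i\<in>{0..<qt}. 0 < f (Q i) \<or> tree_edge r y par Q i)"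

text \<open>
  \<open>closed_except\<close> says that the marked vertices are closed under residual half-edges, apart from those
  still to be scanned and apart from \<open>z\<close>, which has just been taken from its list.
\<close>

definition closed_except ::
  "int \<Rightarrow> (int \<Rightarrow> int) \<Rightarrow> (int \<Rightarrow> int) \<Rightarrow> (int \<Rightarrow> int) \<Rightarrow> int \<Rightarrow> int \<Rightarrow> int \<Rightarrow> int \<Rightarrow> bool" where
  "closed_except r y mark Q qh qt p z \<longleftrightarrow>
     (\<forall>g. residual r y g \<longrightarrow> g \<noteq> z \<longrightarrow> 0 < mark (hv g) \<longrightarrow>
        0 < mark (hw g) \<or> hv g \<in> Q ` {qh..<qt} \<or> hv g = hv p \<and> g \<le> p)"

text \<open>Full lists of vertices not yet dequeued, plus the rest of the current list. For
  \<open>p = -1\<close> the second set is empty, whatever the value of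
  \<open>hv (-1)\<close>.\<close>

definition unscanned :: "(int \<Rightarrow> int) \<Rightarrow> int \<Rightarrow> int \<Rightarrow> int set" where
  "unscanned Q qh p = {g \<in> {0..<2*M}. hv g \<notin> Q ` {0..<qh}} \<union> {g \<in> {0..p}. hv g = hv p}"

definition search_potential :: "(int \<Rightarrow> int) \<Rightarrow> int \<Rightarrow> int \<Rightarrow> int \<Rightarrow> int" where
  "search_potential Q qh p r = int (card (unscanned Q qh p)) + (N - qh) + (M - r)"

lemma queue_length: "queue_ok mark Q qt \<Longrightarrow> qt \<le> N"
proof -
  assume q: "queue_ok mark Q qt"
  then have "card (Q ` {0..<qt}) = card {0..<qt}" by (intro card_image) (simp add: queue_ok_def)
  moreover have "card (Q ` {0..<qt}) \<le> card {0..<N}"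
    using q by (intro card_mono) (auto simp: queue_ok_def)
  ultimately show "qt \<le> N" using N_nonneg by simp
qed

lemma queue_ok_insert:
  assumes "queue_ok mark Q qt" "w \<in> {0..<N}" "\<not> 0 < mark w"
  shows "queue_ok (mark(w := 1)) (Q(qt := w)) (qt + 1)"
proof -
  have qt: "0 \<le> qt" and img: "Q ` {0..<qt} = {v \<in> {0..<N}. 0 < mark v}" and inj: "inj_on Q {0..<qt}"
    using assms(1) by (auto simp: queue_ok_def)
  have set: "{0..<qt + 1} = insert qt {0..<qt}" using qt by auto
  have img': "(Q(qt := w)) ` {0..<qt} = Q ` {0..<qt}" by (intro image_cong) auto
  have "w \<notin> Q ` {0..<qt}" unfolding img using assms(3) by simp
  moreover have "inj_on (Q(qt := w)) {0..<qt}" using inj by (simp add: inj_on_def)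
  ultimately have "inj_on (Q(qt := w)) (insert qt {0..<qt})"
    unfolding inj_on_insert by (simp add: image_iff)
  moreover have "(Q(qt := w)) ` (insert qt {0..<qt}) = insert w {v \<in> {0..<N}. 0 < mark v}"
    unfolding image_insert img' img by simp
  moreover have "insert w {v \<in> {0..<N}. 0 < mark v} = {v \<in> {0..<N}. 0 < (mark(w := 1)) v}"
    using assms(2) by auto
  ultimately show ?thesis unfolding queue_ok_def set using qt by simp
qed

lemma tree_edge_update: "tree_edge r y par Q i \<Longrightarrow> i < qt \<Longrightarrow> Q i \<noteq> w \<Longrightarrow> tree_edge r y (par(w := h)) (Q(qt := w)) i"
proof -
  assume e: "tree_edge r y par Q i" and i: "i < qt" "Q i \<noteq> w"
  then obtain j where "0 \<le> j" "j < i" "hv (par (Q i)) = Q j" by (auto simp: tree_edge_def)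
  with e i show ?thesis by (auto simp: tree_edge_def intro!: exI[of _ j])
qed

lemma search_tree_insert:
  assumes T: "search_tree r y f mark par Q qt" and h: "residual r y h" "0 < mark (hv h)" "\<not> 0 < mark (hw h)"
  shows "search_tree r y f (mark(hw h := 1)) (par(hw h := h)) (Q(qt := hw h)) (qt + 1)"
proof -
  let ?w = "hw h"
  have w: "?w \<in> {0..<N}" "hv h \<in> {0..<N}" using h hw_range hv_range by (auto simp: residual_def)
  have q: "queue_ok mark Q qt" using T by (simp add: search_tree_def)
  then have img: "Q ` {0..<qt} = {v \<in> {0..<N}. 0 < mark v}" by (simp add: queue_ok_def)
  have "0 < f ((Q(qt := ?w)) i) \<or> tree_edge r y (par(?w := h)) (Q(qt := ?w)) i" if i: "i \<in> {0..<qt + 1}" for i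
  proof (cases "i = qt")
    case True
    have "hv h \<in> Q ` {0..<qt}" using img h w by simp
    then obtain j where "j \<in> {0..<qt}" "hv h = Q j" by auto
    then show ?thesis using True h by (auto simp: tree_edge_def)
  next
    case False
    then have i': "i \<in> {0..<qt}" using i by auto
    then have "Q i \<in> Q ` {0..<qt}" by blast
    then have "Q i \<noteq> ?w" using img h(3) by auto
    moreover have "0 < f (Q i) \<or> tree_edge r y par Q i" using T i' unfolding search_tree_def by blast
    ultimately show ?thesis using i' False tree_edge_update[of r y par Q i qt ?w h] by auto
  qed
  moreover have "\<forall>v\<in>{0..<N}. 0 < f v \<longrightarrow> 0 < (mark(?w := 1)) v"
    using T by (simp add: search_tree_def)
  ultimately show ?thesis
    unfolding search_tree_def using queue_ok_insert[OF q w(1) h(3)] by blast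
qed

text \<open>Marking its head settles the exception \<open>h\<close>, and the half-edges of the new
  vertex are excused by its place in the queue. The value -1 for \<open>z\<close> means no
  exception, since residual half-edges are nonnegative.\<close>

lemma closed_except_insert:
  assumes C: "closed_except r y mark Q qh qt p h" and "qh \<le> qt"
  shows "closed_except r y (mark(hw h := 1)) (Q(qt := hw h)) qh (qt + 1) p (-1)"
  unfolding closed_except_def
proof (intro allI impI)
  fix g assume g: "residual r y g" "0 < (mark(hw h := 1)) (hv g)"
  have set: "(Q(qt := hw h)) ` {qh..<qt + 1} = insert (hw h) (Q ` {qh..<qt})"
  proof -
    have "{qh..<qt + 1} = insert qt {qh..<qt}" using assms(2) by auto
    moreover have "(Q(qt := hw h)) ` {qh..<qt} = Q ` {qh..<qt}" by (intro image_cong) auto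
    ultimately show ?thesis by (simp only: image_insert fun_upd_same)
  qed
  show "0 < (mark(hw h := 1)) (hw g) \<or> hv g \<in> (Q(qt := hw h)) ` {qh..<qt + 1} \<or> hv g = hv p \<and> g \<le> p"
    unfolding set
  proof (cases "hv g = hw h \<or> g = h")
    case False
    then have "0 < mark (hw g) \<or> hv g \<in> Q ` {qh..<qt} \<or> hv g = hv p \<and> g \<le> p"
      using C g unfolding closed_except_def by simp
    then show "0 < (mark(hw h := 1)) (hw g) \<or> hv g \<in> insert (hw h) (Q ` {qh..<qt}) \<or> hv g = hv p \<and> g \<le> p"
      by auto
  qed auto
qed

lemma closed_except_skip:
  assumes "closed_except r y mark Q qh qt p h" "\<not> (residual r y h \<and> 0 < mark (hv h) \<and> \<not> 0 < mark (hw h))"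
  shows "closed_except r y mark Q qh qt p (-1)"
  using assms unfolding closed_except_def by blast

lemma closed_except_advance:
  assumes C: "closed_except r y mark Q qh qt p (-1)" and p: "0 \<le> p" "is_prev p' (hv p) p"
  shows "closed_except r y mark Q qh qt p' p"
  unfolding closed_except_def
proof (intro allI impI)
  fix g assume g: "residual r y g" "g \<noteq> p" "0 < mark (hv g)"
  then have "g \<noteq> -1" by (auto simp: residual_def)
  then have "0 < mark (hw g) \<or> hv g \<in> Q ` {qh..<qt} \<or> hv g = hv p \<and> g \<le> p"
    using C g unfolding closed_except_def by blast
  moreover have "hv g = hv p' \<and> g \<le> p'" if "hv g = hv p" "g \<le> p"
  proof -
    have "g < p" using that g(2) by simp
    then have "g \<le> p'" using is_prev_le[OF p(2) that(1)] by simp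
    moreover have "0 \<le> g" using g(1) by (simp add: residual_def)
    ultimately show ?thesis using is_prev_hv[OF p(2)] that(1) by simp
  qed
  ultimately show "0 < mark (hw g) \<or> hv g \<in> Q ` {qh..<qt} \<or> hv g = hv p' \<and> g \<le> p'" by blast
qed

text \<open>The half-edges of the dequeued vertex change their excuse, from its place in the queue
  to the list pointer.\<close>

lemma closed_except_dequeue:
  assumes C: "closed_except r y mark Q qh qt (-1) (-1)" and q: "0 \<le> qh" "qh < qt" "is_prev p (Q qh) (2 * M)"
  shows "closed_except r y mark Q (qh + 1) qt p (-1)"
  unfolding closed_except_def
proof (intro allI impI)
  fix g assume g: "residual r y g" "g \<noteq> -1" "0 < mark (hv g)"
  have g0: "0 \<le> g" "g < 2 * M" using g(1) by (auto simp: residual_def)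
  have "0 < mark (hw g) \<or> hv g \<in> Q ` {qh..<qt}"
    using C g g0 unfolding closed_except_def by fastforce
  moreover have "{qh..<qt} = insert qh {qh + 1..<qt}" using q by auto
  moreover have "hv g = hv p \<and> g \<le> p" if "hv g = Q qh"
  proof -
    have "g \<le> p" using is_prev_le[OF q(3) that g0(2)] .
    then show ?thesis using is_prev_hv[OF q(3) g0(1)] that by simp
  qed
  ultimately show "0 < mark (hw g) \<or> hv g \<in> Q ` {qh + 1..<qt} \<or> hv g = hv p \<and> g \<le> p" by auto
qed

text \<open>The arc \<open>r\<close> carries no flow yet, so only its forward half-edge, numbered
  \<open>r\<close> too, can become residual.\<close>

lemma residual_raise:
  assumes "unit_flow r y" "residual (r + 1) y g"
  shows "residual r y g \<or> g = r"
proof (cases "arc g = r")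
  case True
  have "r \<in> {0..<M}" using arc_range[of g] assms(2) True by (simp add: residual_def)
  then have "y r = 0" using assms(1) by (auto simp: unit_flow_def)
  then show ?thesis using assms(2) True by (auto simp: residual_def arc_def dir_def split: if_splits)
next
  case False
  then show ?thesis using assms(2) by (auto simp: residual_def)
qed

lemma residual_mono: "residual r y g \<Longrightarrow> r \<le> r' \<Longrightarrow> residual r' y g"
  by (auto simp: residual_def)

text \<open>The new half-edge is the exception, to be tried at once. If its tail is unmarked nothing
  is lost, as it is met again in the list of that vertex should the tail be marked later.\<close>

lemma closed_except_raise:
  assumes "closed_except r y mark Q qh qt p (-1)" "unit_flow r y"
  shows "closed_except (r + 1) y mark Q qh qt p r"
  unfolding closed_except_def
proof (intro allI impI)
  fix g assume g: "residual (r + 1) y g" "g \<noteq> r" "0 < mark (hv g)"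
  have "residual r y g" using residual_raise[OF assms(2) g(1)] g(2) by simp
  moreover have "g \<noteq> -1" using g(1) by (auto simp: residual_def)
  ultimately show "0 < mark (hw g) \<or> hv g \<in> Q ` {qh..<qt} \<or> hv g = hv p \<and> g \<le> p"
    using assms(1) g(3) unfolding closed_except_def by blast
qed

lemma search_tree_raise: "search_tree r y f mark par Q qt \<Longrightarrow> search_tree (r + 1) y f mark par Q qt"
  unfolding search_tree_def tree_edge_def using residual_mono[of r y _ "r + 1"] by fastforce

lemma unit_flow_mono: "unit_flow r y \<Longrightarrow> r \<le> r' \<Longrightarrow> unit_flow r' y"
  by (auto simp: unit_flow_def)

lemma closed_infeasible:
  assumes "search_tree r y f mark par Q qt" "closed_except r y mark Q qt qt (-1) (-1)"
    and "pseudoflow r y f F" "0 < F" "\<And>v. v \<in> {0..<N} \<Longrightarrow> 0 < mark v \<Longrightarrow> 0 \<le> f v"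
  shows "\<not> feas r"
proof (rule closed_set_infeasible[where S = "{v \<in> {0..<N}. 0 < mark v}" and x = y])
  show "hw g \<in> {v \<in> {0..<N}. 0 < mark v}" if g: "residual r y g" "hv g \<in> {v \<in> {0..<N}. 0 < mark v}" for g
  proof -
    have g0: "g \<in> {0..<2*M}" using g(1) by (simp add: residual_def)
    then have "0 < mark (hw g)" using assms(2) g unfolding closed_except_def by fastforce
    then show ?thesis using hw_range[OF g0] by simp
  qed
qed (use assms in \<open>auto simp: pseudoflow_def search_tree_def\<close>)

lemma finite_unscanned: "finite (unscanned Q qh p)"
  by (rule finite_subset[of _ "{0..<2*M} \<union> {0..p}"]) (auto simp: unscanned_def)

lemma unscanned_advance:
  assumes "0 \<le> p" "is_prev p' (hv p) p" "hv p \<in> Q ` {0..<qh}"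
  shows "int (card (unscanned Q qh p)) = int (card (unscanned Q qh p')) + 1"
proof -
  have "{g \<in> {0..p}. hv g = hv p} = insert p {g \<in> {0..p'}. hv g = hv p'}"
  proof (rule set_eqI)
    fix g
    show "g \<in> {g \<in> {0..p}. hv g = hv p} \<longleftrightarrow> g \<in> insert p {g \<in> {0..p'}. hv g = hv p'}"
    proof
      assume g: "g \<in> {g \<in> {0..p}. hv g = hv p}"
      show "g \<in> insert p {g \<in> {0..p'}. hv g = hv p'}"
      proof (cases "g = p")
        case False
        then have "g \<le> p'" using g is_prev_le[OF assms(2), of g] by simp
        then show ?thesis using g is_prev_hv[OF assms(2), of g] by simp
      qed simp
    next
      assume "g \<in> insert p {g \<in> {0..p'}. hv g = hv p'}"
      then show "g \<in> {g \<in> {0..p}. hv g = hv p}" using assms by (auto simp: is_prev_def)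
    qed
  qed
  then have "unscanned Q qh p = insert p (unscanned Q qh p')" by (simp add: unscanned_def)
  \<comment> \<open>Its tail has been dequeued and \<open>p\<close> exceeds \<open>p'\<close>, so
    neither part contains it.\<close>
  moreover have "p \<notin> unscanned Q qh p'" using assms by (auto simp: unscanned_def is_prev_def)
  ultimately show ?thesis using finite_unscanned by simp
qed

text \<open>The list of the dequeued vertex only moves from the first part to the second; the
  potential falls through the summand \<open>N - qh\<close>.\<close>

lemma unscanned_dequeue:
  assumes "inj_on Q {0..<qt}" "0 \<le> qh" "qh < qt" "is_prev p (Q qh) (2 * M)"
  shows "unscanned Q (qh + 1) p = unscanned Q qh (-1)"
proof -
  have "{0..<qh + 1} = insert qh {0..<qh}" using assms by auto
  then have img: "Q ` {0..<qh + 1} = insert (Q qh) (Q ` {0..<qh})" by simp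
  have "Q qh \<noteq> Q i" if "i \<in> {0..<qh}" for i
    using inj_onD[OF assms(1), of qh i] that assms(2,3) by auto
  then have new: "Q qh \<notin> Q ` {0..<qh}" by blast
  have list: "{g \<in> {0..p}. hv g = hv p} = {g \<in> {0..<2*M}. hv g = Q qh}"
  proof (rule set_eqI)
    fix g
    show "g \<in> {g \<in> {0..p}. hv g = hv p} \<longleftrightarrow> g \<in> {g \<in> {0..<2*M}. hv g = Q qh}"
    proof
      assume "g \<in> {g \<in> {0..p}. hv g = hv p}"
      then have g: "0 \<le> g" "g \<le> p" "hv g = hv p" by auto
      have "hv p = Q qh" by (rule is_prev_hv[OF assms(4) g(1,2)])
      moreover have "p < 2 * M" using assms(4) by (simp add: is_prev_def)
      ultimately show "g \<in> {g \<in> {0..<2*M}. hv g = Q qh}" using g by simp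
    next
      assume "g \<in> {g \<in> {0..<2*M}. hv g = Q qh}"
      then have g: "0 \<le> g" "g < 2 * M" "hv g = Q qh" by auto
      have "g \<le> p" by (rule is_prev_le[OF assms(4) g(3,2)])
      moreover have "hv p = Q qh" by (rule is_prev_hv[OF assms(4) g(1) \<open>g \<le> p\<close>])
      ultimately show "g \<in> {g \<in> {0..p}. hv g = hv p}" using g by simp
    qed
  qed
  have "unscanned Q (qh + 1) p = {g \<in> {0..<2*M}. hv g \<notin> insert (Q qh) (Q ` {0..<qh})} \<union> {g \<in> {0..<2*M}. hv g = Q qh}"
    unfolding unscanned_def img list ..
  also have "\<dots> = {g \<in> {0..<2*M}. hv g \<notin> Q ` {0..<qh}}"
  proof (rule set_eqI)
    fix g
    show "g \<in> {g \<in> {0..<2*M}. hv g \<notin> insert (Q qh) (Q ` {0..<qh})} \<union> {g \<in> {0..<2*M}. hv g = Q qh} \<longleftrightarrow>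
        g \<in> {g \<in> {0..<2*M}. hv g \<notin> Q ` {0..<qh}}"
      using new by (cases "hv g = Q qh") simp_all
  qed
  finally show ?thesis by (simp add: unscanned_def)
qed

lemma unscanned_insert: "qh \<le> qt \<Longrightarrow> unscanned (Q(qt := w)) qh p = unscanned Q qh p"
proof -
  assume "qh \<le> qt"
  then have "(Q(qt := w)) ` {0..<qh} = Q ` {0..<qh}" by (intro image_cong) auto
  then show ?thesis by (simp add: unscanned_def)
qed

text \<open>A negative value raised by one stays nonpositive, so the positive part can change only
  at \<open>q\<close>.\<close>

lemma total_excess_hole:
  assumes "c \<in> {0..<N}" "q \<in> {0..<N}" "c \<noteq> q" "f c < 0"
  shows "total_excess (f(c := f c + 1, q := f q - 1)) = total_excess f - of_bool (0 < f q)"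
proof -
  let ?f = "f(c := f c + 1, q := f q - 1)"
  have fin: "finite {0..<N}" "c \<in> {0..<N}" "q \<in> {0..<N} - {c}" using assms by auto
  have "total_excess g = max 0 (g c) + (max 0 (g q) + (\<Sum>v\<in>{0..<N} - {c} - {q}. max 0 (g v)))" for g
    unfolding total_excess_def using fin
    by (simp only: sum.remove[OF fin(1,2)] sum.remove[OF finite_Diff[OF fin(1)] fin(3)])
  note split = this
  define rest where "rest = (\<Sum>v\<in>{0..<N} - {c} - {q}. max 0 (f v))"
  have "(\<Sum>v\<in>{0..<N} - {c} - {q}. max 0 (?f v)) = rest"
    unfolding rest_def by (intro sum.cong) auto
  then have "total_excess ?f = max 0 (f c + 1) + (max 0 (f q - 1) + rest)"
    unfolding split[of ?f] using assms(3) by simp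
  moreover have "total_excess f = max 0 (f c) + (max 0 (f q) + rest)"
    by (simp add: split[of f] rest_def)
  ultimately show ?thesis using assms(4) by (simp add: max_def)
qed

text \<open>
  One unit is moved along the path from the queue's roots to the goal, starting from the goal: the
  current vertex is the only one whose excess has become negative.
\<close>

definition augmenting ::
  "int \<Rightarrow> (int \<Rightarrow> int) \<Rightarrow> (int \<Rightarrow> int) \<Rightarrow> (int \<Rightarrow> int) \<Rightarrow> (int \<Rightarrow> int) \<Rightarrow> int \<Rightarrow> int \<Rightarrow> int \<Rightarrow> int \<Rightarrow> bool" where
  "augmenting r y f par Q qt F i cur \<longleftrightarrow> pseudoflow r y f F \<and> inj_on Q {0..<qt} \<and> Q ` {0..<qt} \<subseteq> {0..<N} \<and>
     0 \<le> i \<and> i < qt \<and> cur = Q i \<and> f cur < 0 \<and> (\<forall>j. 0 \<le> j \<longrightarrow> j < i \<longrightarrow> 0 \<le> f (Q j)) \<and>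
     (\<forall>j. 0 \<le> j \<longrightarrow> j \<le> i \<longrightarrow> 0 < f (Q j) \<or> tree_edge r y par Q j)"

text \<open>The push repairs \<open>cur\<close> and passes the missing unit on to its parent.
  Positive excess there absorbs it and the total falls by one; otherwise the parent is the new
  deficit, at a smaller queue position.\<close>

lemma augmenting_step:
  fixes par f y :: "int \<Rightarrow> int" and cur :: int
  defines "h \<equiv> par cur"
  assumes A: "augmenting r y f par Q qt F i cur"
  defines "y' \<equiv> y(arc h := 1 - dir h)" and "f' \<equiv> f(cur := f cur + 1, hv h := f (hv h) - 1)"
  shows "h \<in> {0..<2*M}" "hv h \<noteq> cur"
    and "0 \<le> f' (hv h) \<and> pseudoflow r y' f' (F - 1) \<or>
      f' (hv h) < 0 \<and> (\<exists>j. j < i \<and> augmenting r y' f' par Q qt F j (hv h))"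
proof -
  have A': "pseudoflow r y f F" "inj_on Q {0..<qt}" "Q ` {0..<qt} \<subseteq> {0..<N}" "0 \<le> i" "i < qt" "cur = Q i" "f cur < 0"
    and nn: "\<And>j. 0 \<le> j \<Longrightarrow> j < i \<Longrightarrow> 0 \<le> f (Q j)"
    and edge: "\<And>j. 0 \<le> j \<Longrightarrow> j \<le> i \<Longrightarrow> 0 < f (Q j) \<or> tree_edge r y par Q j"
    using A by (auto simp: augmenting_def)
  have "tree_edge r y par Q i" using edge[of i] A' by auto
  then obtain j where res: "residual r y h" "hw h = cur" and j: "0 \<le> j" "j < i" "hv h = Q j"
    by (auto simp: tree_edge_def h_def A')
  show "h \<in> {0..<2*M}" using res by (simp add: residual_def)
  have injQ: "Q a = Q c \<longleftrightarrow> a = c" if "0 \<le> a" "a < qt" "0 \<le> c" "c < qt" for a c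
    using inj_on_eq_iff[OF A'(2), of a c] that by simp
  show ne: "hv h \<noteq> cur" using j A' injQ[of j i] by simp
  have "Q i \<in> Q ` {0..<qt}" "Q j \<in> Q ` {0..<qt}" using A' j by auto
  then have V: "cur \<in> {0..<N}" "hv h \<in> {0..<N}" using A'(3,6) j(3) by auto
  have ex: "\<forall>v\<in>{0..<N}. f' v = excess y' v"
    using A'(1) V ne res by (auto simp: pseudoflow_def f'_def y'_def excess_push[OF res(1)])
  have uf: "unit_flow r y'" using A'(1) res by (simp add: pseudoflow_def y'_def unit_flow_push)
  have "total_excess (excess y') = total_excess f'"
    unfolding total_excess_def using ex by (intro sum.cong) auto
  also have "\<dots> = total_excess f - of_bool (0 < f (hv h))"
    unfolding f'_def using V ne A' by (intro total_excess_hole) auto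
  also have "total_excess f = F"
    using A'(1) unfolding pseudoflow_def total_excess_def by (auto intro!: sum.cong)
  finally have F: "total_excess (excess y') = F - of_bool (0 < f (hv h))" .
  show "0 \<le> f' (hv h) \<and> pseudoflow r y' f' (F - 1) \<or>
      f' (hv h) < 0 \<and> (\<exists>j. j < i \<and> augmenting r y' f' par Q qt F j (hv h))"
  proof (cases "0 < f (hv h)")
    case True
    then show ?thesis using uf ex F by (simp add: pseudoflow_def f'_def)
  next
    case False
    have same: "f' (Q c) = f (Q c)" if "0 \<le> c" "c < i" "c \<noteq> j" for c
      using that A' j injQ[of c i] injQ[of c j] by (simp add: f'_def)
    \<comment> \<open>The push spoils only the residuality of \<open>h\<close>; parent half-edges of
      other vertices have other heads and thus differ from \<open>h\<close>.\<close>
    have keep: "tree_edge r y' par Q c" if "tree_edge r y par Q c" "0 \<le> c" "c < i" for c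
    proof -
      have "Q c \<noteq> cur" using that A' injQ[of c i] by simp
      then have "par (Q c) \<noteq> h" using that(1) res(2) by (auto simp: tree_edge_def)
      then show ?thesis
        using that(1) residual_push_keep[OF res(1), of "par (Q c)"] by (simp add: tree_edge_def y'_def)
    qed
    have "0 < f' (Q c) \<or> tree_edge r y' par Q c" if c: "0 \<le> c" "c \<le> j" for c
    proof (cases "c = j")
      case True
      then show ?thesis using edge[of j] False j keep[of j] by auto
    next
      case False
      then show ?thesis using edge[of c] keep[of c] same[of c] c j by auto
    qed
    moreover have "0 \<le> f' (Q c)" if "0 \<le> c" "c < j" for c
      using same[of c] nn[of c] that j by auto
    ultimately have "augmenting r y' f' par Q qt F j (hv h)"
      unfolding augmenting_def using A' j uf ex F False by (simp add: pseudoflow_def f'_def)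
    then show ?thesis using j False by (auto simp: f'_def)
  qed
qed


section \<open>Verification of the search, the augmentation and their iteration\<close>

definition search_core :: "(int \<Rightarrow> int) \<Rightarrow> (int \<Rightarrow> int) \<Rightarrow> int \<Rightarrow> state \<Rightarrow> bool" where
  "search_core y f F s \<longleftrightarrow> graph_ok s \<and> s ''y'' = y \<and> s ''f'' = f \<and> pseudoflow (s ''r'' 0) y f F \<and> 0 < F \<and>
     0 \<le> s ''r'' 0 \<and> s ''r'' 0 \<le> M \<and> (\<forall>r'. 0 \<le> r' \<longrightarrow> r' < s ''r'' 0 \<longrightarrow> \<not> feas r') \<and>
     search_tree (s ''r'' 0) y f (s ''mark'') (s ''par'') (s ''queue'') (s ''qt'' 0) \<and>
     0 \<le> s ''qh'' 0 \<and> s ''qh'' 0 \<le> s ''qt'' 0 \<and> -1 \<le> s ''p'' 0 \<and> s ''p'' 0 < 2 * M \<and>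
     (0 \<le> s ''p'' 0 \<longrightarrow> hv (s ''p'' 0) \<in> s ''queue'' ` {0..<s ''qh'' 0})"

definition searching :: "(int \<Rightarrow> int) \<Rightarrow> (int \<Rightarrow> int) \<Rightarrow> int \<Rightarrow> state \<Rightarrow> bool" where
  "searching y f z s \<longleftrightarrow> 0 < s ''go'' 0 \<and> s ''goal'' 0 = -1 \<and>
     (\<forall>v\<in>{0..<N}. 0 < s ''mark'' v \<longrightarrow> 0 \<le> f v) \<and>
     closed_except (s ''r'' 0) y (s ''mark'') (s ''queue'') (s ''qh'' 0) (s ''qt'' 0) (s ''p'' 0) z"

text \<open>The goal is the first deficit in queue order; the walk needs this, since its invariant
  allows only the current vertex to be negative among the queue entries up to it.\<close>

definition search_done :: "(int \<Rightarrow> int) \<Rightarrow> state \<Rightarrow> bool" where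
  "search_done f s \<longleftrightarrow> s ''go'' 0 \<le> 0 \<and>
     (s ''goal'' 0 = -1 \<and> \<not> feas M \<or>
      (\<exists>i. 0 \<le> i \<and> i < s ''qt'' 0 \<and> s ''goal'' 0 = s ''queue'' i \<and> f (s ''goal'' 0) < 0 \<and>
        (\<forall>j. 0 \<le> j \<longrightarrow> j < i \<longrightarrow> 0 \<le> f (s ''queue'' j))))"

definition search_state :: "(int \<Rightarrow> int) \<Rightarrow> (int \<Rightarrow> int) \<Rightarrow> int \<Rightarrow> state \<Rightarrow> bool" where
  "search_state y f F s \<longleftrightarrow> search_core y f F s \<and> (searching y f (-1) s \<or> search_done f s)"

text \<open>One unit for every scan, dequeue and raise still possible, and one for the step that
  merely clears \<open>go\<close>.\<close>

definition state_potential :: "state \<Rightarrow> int" where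
  "state_potential s = search_potential (s ''queue'') (s ''qh'' 0) (s ''p'' 0) (s ''r'' 0) + of_bool (0 < s ''go'' 0)"

lemma state_potential_nonneg:
  assumes "search_core y f F s"
  shows "0 \<le> state_potential s"
proof -
  have "s ''qt'' 0 \<le> N" using assms queue_length by (auto simp: search_core_def search_tree_def)
  then show ?thesis using assms by (auto simp: search_core_def state_potential_def search_potential_def)
qed

text \<open>The potential need not drop here: the caller has already paid by advancing a list
  pointer or the threshold, and a new queue entry leaves the unscanned set as it was.\<close>

lemma wp_visit:
  assumes C: "search_core y f F s" and S: "searching y f h s" and h: "s ''h'' 0 = h" "h \<in> {0..<2*M}"
  shows "wp visit (\<lambda>s' t'. t' \<le> t + 100 \<and> search_state y f F s' \<and> state_potential s' \<le> state_potential s) s t"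
    (is "wp _ ?Q s t")
proof -
  let ?r = "s ''r'' 0" and ?w = "hw h" and ?qt = "s ''qt'' 0"
  have g: "graph_ok s" "s ''y'' = y" "s ''f'' = f" using C by (auto simp: search_core_def)
  then have he: "half_edges_ok s" "s ''hv'' h = hv h" "s ''hw'' h = hw h"
    using h by (auto simp: graph_ok_def half_edges_ok_def)
  have T: "search_tree ?r y f (s ''mark'') (s ''par'') (s ''queue'') ?qt" using C by (simp add: search_core_def)
  have img: "s ''queue'' ` {0..<?qt} = {v \<in> {0..<N}. 0 < s ''mark'' v}"
    using T by (simp add: search_tree_def queue_ok_def)
  have w: "?w \<in> {0..<N}" using h hw_range by simp
  have skip: "?Q (s(''w'' := (s ''w'')(0 := k))) u" "?Q s u"
    if "\<not> (residual ?r y h \<and> 0 < s ''mark'' (hv h) \<and> \<not> 0 < s ''mark'' ?w)" "u \<le> t + 100" for u k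
  proof -
    let ?s = "s(''w'' := (s ''w'')(0 := k))"
    have cl: "closed_except ?r y (s ''mark'') (s ''queue'') (s ''qh'' 0) ?qt (s ''p'' 0) (-1)"
      using S that(1) closed_except_skip unfolding searching_def by blast
    have "graph_ok ?s" by (rule graph_ok_agree[OF g(1), of "{''w''}"]) (simp_all add: agree_def)
    then show "?Q ?s u" "?Q s u"
      using C S that(2) cl by (simp_all add: search_state_def search_core_def searching_def state_potential_def)
  qed
  show ?thesis
    unfolding visit_def
  proof (rule wp_if_residual[where r = ?r and h = h])
    show "?Q s u" if "\<not> residual ?r (s ''y'') h" "u \<le> t + 26" for u
      by (rule skip(2)) (use that g in auto)
    fix u assume res: "residual ?r (s ''y'') h" and u: "u \<le> t + 26"
    show "wp reach ?Q s u"
    proof (cases "0 < s ''mark'' (hv h) \<and> \<not> 0 < s ''mark'' ?w")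
      case False
      then show ?thesis
        using skip(1)[of "u + 20" ?w] skip(2)[of "u + 6"] h he u by (auto simp: reach_def)
    next
      case True
      let ?m = "(s ''mark'')(?w := 1)" and ?p = "(s ''par'')(?w := h)" and ?Qu = "(s ''queue'')(?qt := ?w)"
      have T': "search_tree ?r y f ?m ?p ?Qu (?qt + 1)"
        using search_tree_insert[OF T] res True g by simp
      have cl: "closed_except ?r y ?m ?Qu (s ''qh'' 0) (?qt + 1) (s ''p'' 0) (-1)"
        using C S by (intro closed_except_insert) (auto simp: search_core_def searching_def)
      have qh: "s ''qh'' 0 \<le> ?qt" using C by (simp add: search_core_def)
      then have imgh: "?Qu ` {0..<s ''qh'' 0} = s ''queue'' ` {0..<s ''qh'' 0}" by (intro image_cong) auto
      have pot: "search_potential ?Qu (s ''qh'' 0) (s ''p'' 0) ?r = search_potential (s ''queue'') (s ''qh'' 0) (s ''p'' 0) ?r"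
        using qh by (simp add: search_potential_def unscanned_insert)
      have nn: "0 \<le> f (s ''queue'' j)" if "0 \<le> j" "j < ?qt" for j
      proof -
        have "s ''queue'' j \<in> s ''queue'' ` {0..<?qt}" using that by simp
        then have "s ''queue'' j \<in> {v \<in> {0..<N}. 0 < s ''mark'' v}" unfolding img .
        then show ?thesis using S by (simp add: searching_def)
      qed
      have qt: "0 \<le> ?qt" using T by (simp add: search_tree_def queue_ok_def)
      define s1 where "s1 = s(''w'' := (s ''w'')(0 := ?w), ''mark'' := ?m, ''par'' := ?p, ''queue'' := ?Qu,
        ''qt'' := (s ''qt'')(0 := ?qt + 1))"
      have g1: "graph_ok s1" by (rule graph_ok_agree[OF g(1), of "writes visit"]) (auto simp: agree_def s1_def writes_visit)
      then have core: "search_core y f F s1"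
        using C T' imgh by (simp add: search_core_def s1_def)
      have a: "search_state y f F s1 \<and> state_potential s1 \<le> state_potential s" if "0 \<le> f ?w"
        using core S that cl pot by (simp add: search_state_def searching_def s1_def state_potential_def)
      let ?s2 = "s1(''goal'' := (s1 ''goal'')(0 := ?w), ''go'' := (s1 ''go'')(0 := 0))"
      have b: "search_state y f F ?s2 \<and> state_potential ?s2 \<le> state_potential s" if "f ?w < 0"
      proof -
        let ?s = "s1(''goal'' := (s1 ''goal'')(0 := ?w), ''go'' := (s1 ''go'')(0 := 0))"
        have "graph_ok ?s" by (rule graph_ok_agree[OF g1, of "writes visit"]) (auto simp: agree_def writes_visit)
        then have "search_core y f F ?s" using core by (simp add: search_core_def)
        moreover have "search_done f ?s"
          unfolding search_done_def
          by (intro conjI disjI2 exI[of _ ?qt]) (use that nn qt in \<open>auto simp: s1_def\<close>)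
        ultimately show ?thesis using that pot by (simp add: search_state_def state_potential_def s1_def)
      qed
      show ?thesis
        using True h he g u a b by (simp add: s1_def reach_def)
    qed
  qed (use he h in auto)
qed

lemma wp_search_step:
  assumes st: "search_state y f F s" and go: "0 < s ''go'' 0"
  shows "wp search_step (\<lambda>s' t'. search_state y f F s' \<and>
    t' + 200 * state_potential s' \<le> t + 160 + 200 * (state_potential s - 1)) s t"
    (is "wp _ ?Q s t")
proof -
  let ?r = "s ''r'' 0" and ?p = "s ''p'' 0" and ?qh = "s ''qh'' 0" and ?qt = "s ''qt'' 0"
  have C: "search_core y f F s" and S: "searching y f (-1) s"
    using st go by (auto simp: search_state_def search_done_def)
  have g: "graph_ok s" "s ''y'' = y" "s ''f'' = f" and m: "s ''m'' 0 = M"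
    using C by (auto simp: search_core_def graph_ok_def)
  have T: "search_tree ?r y f (s ''mark'') (s ''par'') (s ''queue'') ?qt" using C by (simp add: search_core_def)
  consider "0 \<le> ?p" | "?p = -1" "?qh < ?qt" | "?p = -1" "?qt \<le> ?qh" "?r < M" | "?p = -1" "?qt \<le> ?qh" "M \<le> ?r"
  proof -
    have "-1 \<le> ?p" using C by (simp add: search_core_def)
    then have "0 \<le> ?p \<or> ?p = -1" by arith
    moreover have "?qh < ?qt \<or> ?qt \<le> ?qh" "?r < M \<or> M \<le> ?r" by arith+
    ultimately show thesis using that by blast
  qed
  then show ?thesis
  proof cases
    case 1
    let ?p' = "s ''link'' ?p"
    have hvp: "?p \<in> {0..<2*M}" "hv ?p \<in> s ''queue'' ` {0..<?qh}" using C 1 by (auto simp: search_core_def)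
    have prev: "is_prev ?p' (hv ?p) ?p" using g(1) hvp by (simp add: graph_ok_def)
    let ?s = "s(''h'' := (s ''h'')(0 := ?p), ''p'' := (s ''p'')(0 := ?p'))"
    have "graph_ok ?s" by (rule graph_ok_agree[OF g(1), of "{''h'', ''p''}"]) (auto simp: agree_def)
    moreover have "0 \<le> ?p' \<longrightarrow> hv ?p' = hv ?p" "-1 \<le> ?p'" "?p' < 2 * M"
      using prev hvp by (auto simp: is_prev_def)
    ultimately have core: "search_core y f F ?s" using C hvp by (simp add: search_core_def)
    have "closed_except ?r y (s ''mark'') (s ''queue'') ?qh ?qt ?p (-1)"
      using S by (simp add: searching_def)
    then have "closed_except ?r y (s ''mark'') (s ''queue'') ?qh ?qt ?p' ?p"
      by (rule closed_except_advance[OF _ 1 prev])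
    then have "searching y f ?p ?s" using S by (simp add: searching_def)
    from wp_visit[OF core this] hvp
    have v: "wp visit (\<lambda>s' t'. t' \<le> u + 100 \<and> search_state y f F s' \<and> state_potential s' \<le> state_potential ?s) ?s u" for u
      by simp
    have pot: "state_potential ?s = state_potential s - 1"
      using unscanned_advance[OF 1 prev hvp(2)] by (simp add: state_potential_def search_potential_def)
    have "wp visit ?Q ?s u" if "u \<le> t + 30" for u
      by (rule wp_mono[OF v]) (use that pot in auto)
    then show ?thesis using 1 by (simp add: search_step_def)
  next
    case 2
    let ?v = "s ''queue'' ?qh" and ?p' = "s ''first'' (s ''queue'' ?qh)"
    have qh: "0 \<le> ?qh" using C by (simp add: search_core_def)
    have inj: "inj_on (s ''queue'') {0..<?qt}" and "s ''queue'' ` {0..<?qt} = {v \<in> {0..<N}. 0 < s ''mark'' v}"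
      using T by (auto simp: search_tree_def queue_ok_def)
    moreover have "?v \<in> s ''queue'' ` {0..<?qt}" using qh 2 by simp
    ultimately have v: "?v \<in> {0..<N}" by auto
    have prev: "is_prev ?p' ?v (2 * M)" using g(1) v by (simp add: graph_ok_def)
    let ?s = "s(''p'' := (s ''p'')(0 := ?p'), ''qh'' := (s ''qh'')(0 := ?qh + 1))"
    have "graph_ok ?s" by (rule graph_ok_agree[OF g(1), of "{''p'', ''qh''}"]) (auto simp: agree_def)
    moreover have "0 \<le> ?p' \<longrightarrow> hv ?p' = ?v" "-1 \<le> ?p'" "?p' < 2 * M"
      using prev by (auto simp: is_prev_def)
    moreover have "?v \<in> s ''queue'' ` {0..<?qh + 1}" using qh by simp
    ultimately have core: "search_core y f F ?s" using C 2 by (simp add: search_core_def)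
    have "closed_except ?r y (s ''mark'') (s ''queue'') (?qh + 1) ?qt ?p' (-1)"
      using S prev 2 qh by (intro closed_except_dequeue) (auto simp: searching_def)
    then have "searching y f (-1) ?s" using S by (simp add: searching_def)
    moreover have "state_potential ?s = state_potential s - 1"
      using unscanned_dequeue[OF inj qh 2(2) prev] 2 by (simp add: state_potential_def search_potential_def)
    ultimately show ?thesis using 2 core by (simp add: search_step_def search_state_def)
  next
    case 3
    have cl: "closed_except ?r y (s ''mark'') (s ''queue'') ?qt ?qt (-1) (-1)"
      using S 3 C by (simp add: searching_def search_core_def)
    have pf: "pseudoflow ?r y f F" "0 < F" using C by (auto simp: search_core_def)
    \<comment> \<open>With list and queue exhausted the marked set is closed and free of deficits:
      the certificate that permits raising \<open>r\<close>.\<close>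
    have inf: "\<not> feas ?r"
      by (rule closed_infeasible[OF T cl pf]) (use S in \<open>auto simp: searching_def\<close>)
    let ?s = "s(''h'' := (s ''h'')(0 := ?r), ''r'' := (s ''r'')(0 := ?r + 1))"
    have "graph_ok ?s" by (rule graph_ok_agree[OF g(1), of "{''h'', ''r''}"]) (auto simp: agree_def)
    moreover have "pseudoflow (?r + 1) y f F"
      using pf unit_flow_mono[of ?r y "?r + 1"] by (auto simp: pseudoflow_def)
    moreover have "\<not> feas r'" if "0 \<le> r'" "r' < ?r + 1" for r'
      using inf that C feas_mono[of r' ?r] by auto
    ultimately have core: "search_core y f F ?s" using C 3 T search_tree_raise[OF T] by (simp add: search_core_def)
    have "closed_except (?r + 1) y (s ''mark'') (s ''queue'') ?qh ?qt ?p ?r"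
      using S pf by (intro closed_except_raise) (auto simp: searching_def pseudoflow_def)
    then have S': "searching y f ?r ?s" using S by (simp add: searching_def)
    have "?r \<in> {0..<2*M}" using C 3 by (simp add: search_core_def)
    with wp_visit[OF core S']
    have v: "wp visit (\<lambda>s' t'. t' \<le> u + 100 \<and> search_state y f F s' \<and> state_potential s' \<le> state_potential ?s) ?s u" for u
      by simp
    have pot: "state_potential ?s = state_potential s - 1"
      by (simp add: state_potential_def search_potential_def)
    have "wp visit ?Q ?s u" if "u \<le> t + 50" for u
      by (rule wp_mono[OF v]) (use that pot in auto)
    then show ?thesis using 3 m by (simp add: search_step_def)
  next
    case 4
    have r: "?r = M" using 4 C by (simp add: search_core_def)
    have cl: "closed_except ?r y (s ''mark'') (s ''queue'') ?qt ?qt (-1) (-1)"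
      using S 4 C by (simp add: searching_def search_core_def)
    have pf: "pseudoflow ?r y f F" "0 < F" using C by (auto simp: search_core_def)
    have inf: "\<not> feas ?r"
      by (rule closed_infeasible[OF T cl pf]) (use S in \<open>auto simp: searching_def\<close>)
    let ?s = "s(''go'' := (s ''go'')(0 := 0))"
    have "graph_ok ?s" by (rule graph_ok_agree[OF g(1), of "{''go''}"]) (auto simp: agree_def)
    then have "search_core y f F ?s" using C by (simp add: search_core_def)
    moreover have "search_done f ?s" using inf r S by (simp add: search_done_def searching_def)
    moreover have "state_potential ?s = state_potential s - 1" using go by (simp add: state_potential_def)
    ultimately show ?thesis using 4 m by (simp add: search_step_def search_state_def)
  qed
qed

lemma wp_init_search:
  assumes g: "graph_ok s" and pf: "pseudoflow (s ''r'' 0) (s ''y'') (s ''f'') F" "0 < F"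
    and r: "0 \<le> s ''r'' 0" "s ''r'' 0 \<le> M" "\<And>r'. 0 \<le> r' \<Longrightarrow> r' < s ''r'' 0 \<Longrightarrow> \<not> feas r'"
  shows "wp init_search (\<lambda>s' t'. t' \<le> t + 100 * (N + 1) \<and> search_state (s ''y'') (s ''f'') F s' \<and>
    state_potential s' \<le> 3 * M + N + 1) s t"
    (is "wp _ ?Q s t")
proof -
  let ?f = "s ''f''"
  have n: "s ''n'' 0 = N" using g by (simp add: graph_ok_def)
  let ?I = "\<lambda>i s'. 0 \<le> s' ''qt'' 0 \<and> inj_on (s' ''queue'') {0..<s' ''qt'' 0} \<and>
      s' ''queue'' ` {0..<s' ''qt'' 0} = {v \<in> {0..<i}. 0 < ?f v} \<and>
      (\<forall>v\<in>{0..<i}. s' ''mark'' v = of_bool (0 < ?f v))"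
  let ?tail = "''qh'' ::= Const 0 ;; ''p'' ::= Const (-1) ;; ''goal'' ::= Const (-1) ;; ''go'' ::= One"
  have "wp (For ''v'' ''n''
       (IfPos (Cell ''f'' (Var ''v''))
         (Store ''mark'' (Var ''v'') One ;; Store ''queue'' (Var ''qt'') (Var ''v'') ;; ''qt'' ::= Add (Var ''qt'') One)
         (Store ''mark'' (Var ''v'') (Const 0)))) (wp ?tail ?Q) (s(''qt'' := (s ''qt'')(0 := 0))) u"
    if u: "u \<le> t + 5" for u
  proof (rule wp_For[where h = N and k = 30 and I = ?I], goal_cases)
    case (8 i s1 t1)
    let ?qt = "s1 ''qt'' 0"
    have f: "s1 ''f'' = ?f" using 8(5) by (simp add: agree_def)
    have I1: "0 \<le> ?qt" "inj_on (s1 ''queue'') {0..<?qt}" "s1 ''queue'' ` {0..<?qt} = {v \<in> {0..<i}. 0 < ?f v}"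
      "\<forall>v\<in>{0..<i}. s1 ''mark'' v = of_bool (0 < ?f v)"
      using 8(3) by auto
    have set: "{0..<i + 1} = insert i {0..<i}" using 8(1) by auto
    have marks: "\<forall>v\<in>{0..<i + 1}. ((s1 ''mark'')(i := of_bool (0 < ?f i))) v = of_bool (0 < ?f v)"
      unfolding set using I1(4) by simp
    show ?case
    proof (cases "0 < ?f i")
      case True
      have qs: "{0..<?qt + 1} = insert ?qt {0..<?qt}" using I1(1) by auto
      let ?Q' = "(s1 ''queue'')(?qt := i)"
      have img0: "?Q' ` {0..<?qt} = s1 ''queue'' ` {0..<?qt}" by (intro image_cong) auto
      have "i \<notin> s1 ''queue'' ` {0..<?qt}" unfolding I1(3) by simp
      moreover have "inj_on ?Q' {0..<?qt}" using I1(2) by (simp add: inj_on_def)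
      ultimately have inj: "inj_on ?Q' (insert ?qt {0..<?qt})"
        unfolding inj_on_insert by (simp add: image_iff)
      have img: "?Q' ` (insert ?qt {0..<?qt}) = {v \<in> {0..<i + 1}. 0 < ?f v}"
        unfolding image_insert img0 I1(3) set using True by auto
      have inj': "inj_on ?Q' {0..<?qt + 1}" and img': "?Q' ` {0..<?qt + 1} = {v \<in> {0..<i + 1}. 0 < ?f v}"
        unfolding qs using inj img by auto
      show ?thesis using True f 8(4) I1(1) marks inj' img' by simp
    next
      case False
      have "{v \<in> {0..<i + 1}. 0 < ?f v} = {v \<in> {0..<i}. 0 < ?f v}" unfolding set using False by auto
      then show ?thesis using False f 8(4) I1 marks by simp
    qed
  next
    case (9 s1 t1)
    let ?s = "s1(''qh'' := (s1 ''qh'')(0 := 0), ''p'' := (s1 ''p'')(0 := -1), ''goal'' := (s1 ''goal'')(0 := -1),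
      ''go'' := (s1 ''go'')(0 := 1))"
    have same: "s1 ''f'' = ?f" "s1 ''y'' = s ''y''" "s1 ''r'' = s ''r''" using 9(3) by (auto simp: agree_def)
    have "agree (writes search) ?s s" using 9(3) by (auto simp: agree_def writes_search)
    then have g': "graph_ok ?s" by (rule graph_ok_agree[OF g]) (simp add: writes_search)
    have I1: "0 \<le> s1 ''qt'' 0" "inj_on (s1 ''queue'') {0..<s1 ''qt'' 0}"
      "s1 ''queue'' ` {0..<s1 ''qt'' 0} = {v \<in> {0..<N}. 0 < ?f v}"
      "\<And>v. 0 \<le> v \<Longrightarrow> v < N \<Longrightarrow> s1 ''mark'' v = of_bool (0 < ?f v)"
      using 9(1) by auto
    have "{v \<in> {0..<N}. 0 < ?f v} = {v \<in> {0..<N}. 0 < s1 ''mark'' v}" using I1(4) by auto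
    then have q: "queue_ok (s1 ''mark'') (s1 ''queue'') (s1 ''qt'' 0)" using I1 by (simp add: queue_ok_def)
    have pos: "0 < ?f (s1 ''queue'' i)" if "i \<in> {0..<s1 ''qt'' 0}" for i
    proof -
      have "s1 ''queue'' i \<in> s1 ''queue'' ` {0..<s1 ''qt'' 0}" using that by blast
      then show ?thesis unfolding I1(3) by simp
    qed
    have T: "search_tree (s ''r'' 0) (s ''y'') ?f (s1 ''mark'') (s1 ''par'') (s1 ''queue'') (s1 ''qt'' 0)"
      unfolding search_tree_def using q pos I1(4) by simp
    then have core: "search_core (s ''y'') ?f F ?s"
      using g' pf r same I1(1) M_nonneg by (simp add: search_core_def)
    have "closed_except (s ''r'' 0) (s ''y'') (s1 ''mark'') (s1 ''queue'') 0 (s1 ''qt'' 0) (-1) (-1)"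
      unfolding closed_except_def
    proof (intro allI impI)
      fix g assume "residual (s ''r'' 0) (s ''y'') g" "0 < s1 ''mark'' (hv g)"
      then have "hv g \<in> s1 ''queue'' ` {0..<s1 ''qt'' 0}"
        using q hv_range[of g] by (simp add: queue_ok_def residual_def)
      then show "0 < s1 ''mark'' (hw g) \<or> hv g \<in> s1 ''queue'' ` {0..<s1 ''qt'' 0} \<or> hv g = hv (-1) \<and> g \<le> -1"
        by blast
    qed
    then have S: "searching (s ''y'') ?f (-1) ?s" using same I1(4) by (simp add: searching_def)
    \<comment> \<open>At most \<open>2 * M\<close> scans, \<open>N\<close> dequeues,
      \<open>M\<close> raises and the final step.\<close>
    have "card (unscanned (s1 ''queue'') 0 (-1)) \<le> card {0..<2*M}"
      by (rule card_mono) (auto simp: unscanned_def)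
    then have "state_potential ?s \<le> 3 * M + N + 1"
      using r(1) same M_nonneg by (simp add: state_potential_def search_potential_def)
    then show ?case using core S 9(4) u N_nonneg by (simp add: search_state_def)
  qed (use n N_nonneg in auto)
  then show ?thesis by (simp add: init_search_def)
qed

lemma wp_search:
  assumes g: "graph_ok s" and pf: "pseudoflow (s ''r'' 0) (s ''y'') (s ''f'') F" "0 < F"
    and r: "0 \<le> s ''r'' 0" "s ''r'' 0 \<le> M" "\<And>r'. 0 \<le> r' \<Longrightarrow> r' < s ''r'' 0 \<Longrightarrow> \<not> feas r'"
  shows "wp search (\<lambda>s' t'. t' \<le> t + 1000 * (N + M + 1) \<and> search_core (s ''y'') (s ''f'') F s' \<and>
    search_done (s ''f'') s') s t"
    (is "wp _ ?Q s t")
  unfolding search_def wp_Seq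
proof (rule wp_mono[OF wp_init_search[OF g pf r]], assumption, assumption)
  let ?y = "s ''y''" and ?f = "s ''f''"
  fix s1 t1
  assume h: "t1 \<le> t + 100 * (N + 1) \<and> search_state ?y ?f F s1 \<and> state_potential s1 \<le> 3 * M + N + 1"
  let ?B = "t1 + 200 * state_potential s1"
  show "wp (WhilePos (Var ''go'') search_step) ?Q s1 t1"
  proof (rule wp_While[where B = ?B and I = "\<lambda>s' t'. search_state ?y ?f F s' \<and> t' + 200 * state_potential s' \<le> ?B"])
    fix s2 t2 assume I: "search_state ?y ?f F s2 \<and> t2 + 200 * state_potential s2 \<le> ?B"
    then have nn: "0 \<le> state_potential s2" using state_potential_nonneg by (auto simp: search_state_def)
    then show "t2 \<le> ?B" using I by linarith
    show "wp search_step (\<lambda>s' t'. search_state ?y ?f F s' \<and> t' + 200 * state_potential s' \<le> ?B) s2 (t2 + (1 + cost (Var ''go'')))"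
      if "0 < eval (Var ''go'') s2"
      by (rule wp_mono[OF wp_search_step]) (use that I in auto)
    show "?Q s2 (t2 + (1 + cost (Var ''go'')))" if "eval (Var ''go'') s2 \<le> 0"
    proof -
      have "search_core ?y ?f F s2" "search_done ?f s2"
        using I that by (auto simp: search_state_def searching_def)
      moreover have "t2 + 3 \<le> t + 1000 * (N + M + 1)" using I h nn N_nonneg M_nonneg by auto
      ultimately show ?thesis by simp
    qed
  qed (use h in auto)
qed


lemma wp_augment:
  assumes C: "search_core y f F s" and goal: "0 \<le> i" "i < s ''qt'' 0" "s ''goal'' 0 = s ''queue'' i"
    "f (s ''goal'' 0) < 0" "\<forall>j. 0 \<le> j \<longrightarrow> j < i \<longrightarrow> 0 \<le> f (s ''queue'' j)"
  shows "wp augment (\<lambda>s' t'. t' \<le> t + 100 * (N + 1) \<and>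
    pseudoflow (s ''r'' 0) (s' ''y'') (s' ''f'') (F - 1)) s t"
    (is "wp _ ?P s t")
proof -
  let ?r = "s ''r'' 0" and ?par = "s ''par''" and ?Q = "s ''queue''" and ?qt = "s ''qt'' 0"
  have g: "graph_ok s" "s ''y'' = y" "s ''f'' = f" and pf: "pseudoflow ?r y f F"
    and T: "search_tree ?r y f (s ''mark'') ?par ?Q ?qt"
    using C by (auto simp: search_core_def)
  have he: "half_edges_ok s" using g(1) by (simp add: graph_ok_def)
  have q: "queue_ok (s ''mark'') ?Q ?qt" using T by (simp add: search_tree_def)
  then have "inj_on ?Q {0..<?qt}" "?Q ` {0..<?qt} \<subseteq> {0..<N}" by (auto simp: queue_ok_def)
  moreover have "0 < f (?Q j) \<or> tree_edge ?r y ?par ?Q j" if "0 \<le> j" "j \<le> i" for j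
    using T that goal(2) by (simp add: search_tree_def)
  ultimately have A: "augmenting ?r y f ?par ?Q ?qt F i (s ''goal'' 0)"
    unfolding augmenting_def using pf goal by simp
  have iN: "i < N" using queue_length[OF q] goal(2) by simp
  \<comment> \<open>The queue position \<open>i\<close> of the current vertex falls with each step,
    so a budget of 60 per remaining position suffices.\<close>
  let ?I = "\<lambda>s' t'. (\<exists>i. augmenting ?r (s' ''y'') (s' ''f'') ?par ?Q ?qt F i (s' ''cur'' 0) \<and> t' + 60 * (i + 1) \<le> t + 60 * N + 10) \<or>
    0 \<le> s' ''f'' (s' ''cur'' 0) \<and> pseudoflow ?r (s' ''y'') (s' ''f'') (F - 1) \<and> t' \<le> t + 60 * N + 10"
  let ?s = "s(''cur'' := (s ''cur'')(0 := s ''goal'' 0))"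
  have "wp (WhilePos (Sub (Const 0) (Cell ''f'' (Var ''cur''))) augment_step) ?P ?s u" if u: "u \<le> t + 8" for u
  proof (rule wp_While[where I = ?I and B = "t + 60 * N + 10"])
    show "?I ?s u" by (intro disjI1 exI[of _ i]) (use A g u iN in simp)
  next
    fix s1 t1 assume "?I s1 t1"
    then show "t1 \<le> t + 60 * N + 10" by (auto simp: augmenting_def)
  next
    fix s1 t1 assume I: "?I s1 t1" and ag: "agree (writes augment_step) s1 ?s"
      and neg: "0 < eval (Sub (Const 0) (Cell ''f'' (Var ''cur''))) s1"
    then obtain k where A1: "augmenting ?r (s1 ''y'') (s1 ''f'') ?par ?Q ?qt F k (s1 ''cur'' 0)"
      and t1: "t1 + 60 * (k + 1) \<le> t + 60 * N + 10" by auto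
    let ?c = "s1 ''cur'' 0" let ?h = "?par ?c"
    have k: "0 \<le> k" using A1 by (simp add: augmenting_def)
    have f1: "s1 ''par'' = ?par" "s1 ''hv'' = s ''hv''" "s1 ''arc'' = s ''arc''" "s1 ''dir'' = s ''dir''"
      using ag by (auto simp: agree_def augment_step_def)
    note step = augmenting_step[OF A1]
    have h: "s ''hv'' ?h = hv ?h" "s ''arc'' ?h = arc ?h" "s ''dir'' ?h = dir ?h"
      using he step(1) by (auto simp: half_edges_ok_def)
    let ?y' = "(s1 ''y'')(arc ?h := 1 - dir ?h)"
      and ?f' = "(s1 ''f'')(?c := s1 ''f'' ?c + 1, hv ?h := s1 ''f'' (hv ?h) - 1)"
    have next_I: "(\<exists>i. augmenting ?r ?y' ?f' ?par ?Q ?qt F i (hv ?h) \<and> v + 60 * (i + 1) \<le> t + 60 * N + 10) \<or>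
      0 \<le> ?f' (hv ?h) \<and> pseudoflow ?r ?y' ?f' (F - 1) \<and> v \<le> t + 60 * N + 10" if v: "v \<le> t1 + 50" for v
      using step(3)
    proof
      assume "0 \<le> ?f' (hv ?h) \<and> pseudoflow ?r ?y' ?f' (F - 1)"
      then show ?thesis using v t1 k by simp
    next
      assume "?f' (hv ?h) < 0 \<and> (\<exists>j. j < k \<and> augmenting ?r ?y' ?f' ?par ?Q ?qt F j (hv ?h))"
      then obtain j where j: "j < k" "augmenting ?r ?y' ?f' ?par ?Q ?qt F j (hv ?h)" by blast
      then have "v + 60 * (j + 1) \<le> t + 60 * N + 10" using v t1 by simp
      with j(2) show ?thesis by blast
    qed
    show "wp augment_step ?I s1 (t1 + (1 + cost (Sub (Const 0) (Cell ''f'' (Var ''cur'')))))"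
      using next_I[of "t1 + 41"] f1 h step(2) by (simp add: augment_step_def)
  next
    fix s1 t1 assume "?I s1 t1" and "eval (Sub (Const 0) (Cell ''f'' (Var ''cur''))) s1 \<le> 0"
    then show "?P s1 (t1 + (1 + cost (Sub (Const 0) (Cell ''f'' (Var ''cur'')))))"
      using N_nonneg by (auto simp: augmenting_def)
  qed
  then show ?thesis by (simp add: augment_def)
qed

lemma wp_finish:
  assumes g: "graph_ok s" and pf: "pseudoflow (s ''r'' 0) (s ''y'') (s ''f'') (s ''R'' 0)"
    and r: "0 \<le> s ''r'' 0" "s ''r'' 0 \<le> M" "\<And>r'. 0 \<le> r' \<Longrightarrow> r' < s ''r'' 0 \<Longrightarrow> \<not> feas r'"
  shows "wp finish (\<lambda>s' t'. t' \<le> t + 2000 * (N + M + 1) * (s ''R'' 0 + 1) \<and>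
    (s' ''R'' 0 = -1 \<and> \<not> feas M \<or>
     s' ''R'' 0 = 0 \<and> pseudoflow (s' ''r'' 0) (s' ''y'') (s' ''f'') 0 \<and>
       0 \<le> s' ''r'' 0 \<and> s' ''r'' 0 \<le> M \<and> (\<forall>r'. 0 \<le> r' \<longrightarrow> r' < s' ''r'' 0 \<longrightarrow> \<not> feas r'))) s t"
proof -
  \<comment> \<open>\<open>W\<close> pays for one search and its augmentation. Budgeting
    \<open>W * (R + 1)\<close> lets the outcome \<open>R = -1\<close> fit the same
    invariant.\<close>
  define W where "W = 2000 * (N + M + 1)"
  have W: "2000 \<le> W" "2 * (1000 * (N + M + 1)) = W" "2000 * (N + 1) \<le> W" using N_nonneg M_nonneg by (simp_all add: W_def)
  let ?J = "\<lambda>s'. pseudoflow (s' ''r'' 0) (s' ''y'') (s' ''f'') (s' ''R'' 0) \<and>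
       0 \<le> s' ''r'' 0 \<and> s' ''r'' 0 \<le> M \<and> (\<forall>r'. 0 \<le> r' \<longrightarrow> r' < s' ''r'' 0 \<longrightarrow> \<not> feas r')"
  \<comment> \<open>The reserve of 10 covers the last loop test after \<open>R = -1\<close>, where
    the budget term is 0.\<close>
  let ?I = "\<lambda>s' t'. (s' ''R'' 0 = -1 \<and> \<not> feas M \<or> ?J s') \<and>
     t' + W * (s' ''R'' 0 + 1) \<le> t + W * (s ''R'' 0 + 1) - of_bool (s' ''R'' 0 = -1) * 10"
  have R: "0 \<le> s' ''R'' 0" if "?J s'" for s' using that total_excess_nonneg by (simp add: pseudoflow_def)
  let ?P = "\<lambda>s' t'. t' \<le> t + W * (s ''R'' 0 + 1) \<and>
    (s' ''R'' 0 = -1 \<and> \<not> feas M \<or>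
     s' ''R'' 0 = 0 \<and> pseudoflow (s' ''r'' 0) (s' ''y'') (s' ''f'') 0 \<and>
       0 \<le> s' ''r'' 0 \<and> s' ''r'' 0 \<le> M \<and> (\<forall>r'. 0 \<le> r' \<longrightarrow> r' < s' ''r'' 0 \<longrightarrow> \<not> feas r'))"
  have "wp finish ?P s t"
    unfolding finish_def
  proof (rule wp_While[where I = ?I and B = "t + W * (s ''R'' 0 + 1)"])
    show "?I s t" using pf r R[of s] by simp
  next
    fix s1 t1 assume I: "?I s1 t1"
    then have "0 \<le> s1 ''R'' 0 + 1" using R[of s1] by auto
    then have "0 \<le> W * (s1 ''R'' 0 + 1)" using W by simp
    moreover have "(0::int) \<le> of_bool (s1 ''R'' 0 = -1) * 10" by simp
    ultimately show "t1 \<le> t + W * (s ''R'' 0 + 1)" using conjunct2[OF I] by linarith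
  next
    fix s1 t1 assume I: "?I s1 t1" and ag: "agree (writes (search ;;
      IfPos (Add (Var ''goal'') One) (augment ;; ''R'' ::= Sub (Var ''R'') One) (''R'' ::= Const (-1)))) s1 s"
      and pos: "0 < eval (Var ''R'') s1"
    have g1: "graph_ok s1" by (rule graph_ok_agree[OF g ag]) (simp add: writes_search writes_augment)
    define F where "F = s1 ''R'' 0"
    have F: "0 < F" using pos by (simp add: F_def)
    have J: "pseudoflow (s1 ''r'' 0) (s1 ''y'') (s1 ''f'') F" "0 \<le> s1 ''r'' 0" "s1 ''r'' 0 \<le> M"
      "\<And>r'. 0 \<le> r' \<Longrightarrow> r' < s1 ''r'' 0 \<Longrightarrow> \<not> feas r'"
      using I pos by (auto simp: F_def)
    have t1: "t1 + W * (F + 1) \<le> t + W * (s ''R'' 0 + 1)"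
      using I F by (simp add: F_def)
    have "wp search (wp (IfPos (Add (Var ''goal'') One) (augment ;; ''R'' ::= Sub (Var ''R'') One) (''R'' ::= Const (-1))) ?I) s1
      (t1 + (1 + cost (Var ''R'')))"
    proof (rule wp_mono[OF wp_search[OF g1 J(1) F J(2,3,4)]], assumption, assumption)
      fix s2 t2
      assume h: "t2 \<le> t1 + (1 + cost (Var ''R'')) + 1000 * (N + M + 1) \<and> search_core (s1 ''y'') (s1 ''f'') F s2 \<and> search_done (s1 ''f'') s2"
        and ag2: "agree (writes search) s2 s1"
      then have t2: "t2 \<le> t1 + 3 + 1000 * (N + M + 1)" and core: "search_core (s1 ''y'') (s1 ''f'') F s2" by auto
      have R2: "s2 ''R'' 0 = F" using ag2 by (simp add: agree_def writes_search F_def)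
      have dec: "W * (F + 1) = W * F + W" "0 \<le> W * F" using W F by (simp_all add: algebra_simps)
      from h have "search_done (s1 ''f'') s2" by simp
      then consider "s2 ''goal'' 0 = -1" "\<not> feas M" | i where "0 \<le> i" "i < s2 ''qt'' 0" "s2 ''goal'' 0 = s2 ''queue'' i"
        "s1 ''f'' (s2 ''goal'' 0) < 0" "\<forall>j. 0 \<le> j \<longrightarrow> j < i \<longrightarrow> 0 \<le> s1 ''f'' (s2 ''queue'' j)"
        by (auto simp: search_done_def)
      then show "wp (IfPos (Add (Var ''goal'') One) (augment ;; ''R'' ::= Sub (Var ''R'') One) (''R'' ::= Const (-1))) ?I s2 t2"
      proof cases
        case 1
        have "u \<le> t + W * (s ''R'' 0 + 1) - 10" if "u \<le> t2 + 20" for u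
          using t1 t2 dec W that by linarith
        then show ?thesis using 1 by simp
      next
        case 2
        have "s2 ''queue'' i \<in> s2 ''queue'' ` {0..<s2 ''qt'' 0}" using 2 by simp
        then have goal: "0 \<le> s2 ''goal'' 0"
          using core 2(3) by (auto simp: search_core_def search_tree_def queue_ok_def)
        have "wp augment (wp (''R'' ::= Sub (Var ''R'') One) ?I) s2 u" if u: "u \<le> t2 + 10" for u
        proof (rule wp_mono[OF wp_augment[OF core 2]])
          fix s3 t3
          assume h3: "t3 \<le> u + 100 * (N + 1) \<and> pseudoflow (s2 ''r'' 0) (s3 ''y'') (s3 ''f'') (F - 1)"
            and ag3: "agree (writes augment) s3 s2"
          have R3: "s3 ''R'' 0 = F" "s3 ''r'' = s2 ''r''" using ag3 R2 by (auto simp: agree_def writes_augment)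
          have time: "v + W * F \<le> t + W * (s ''R'' 0 + 1)" if "v \<le> t3 + 20" for v
            using t1 t2 dec W that u conjunct1[OF h3] M_nonneg by linarith
          show "wp (''R'' ::= Sub (Var ''R'') One) ?I s3 t3"
            using h3 R3 core F time by (simp add: search_core_def)
        qed
        then show ?thesis using goal by simp
      qed
    qed
    then show "wp (search ;; IfPos (Add (Var ''goal'') One) (augment ;; ''R'' ::= Sub (Var ''R'') One) (''R'' ::= Const (-1))) ?I s1
      (t1 + (1 + cost (Var ''R'')))" by simp
  next
    fix s1 t1 assume I: "?I s1 t1" and le: "eval (Var ''R'') s1 \<le> 0"
    show "?P s1 (t1 + (1 + cost (Var ''R'')))"
    proof (cases "s1 ''R'' 0 = -1")
      case True
      then have "\<not> feas M" using I R[of s1] by auto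
      then show ?thesis using True I by simp
    next
      case False
      then have J: "?J s1" using I by simp
      then have "s1 ''R'' 0 = 0" using R[OF J] le by simp
      then show ?thesis using I J W by simp
    qed
  qed
  then show ?thesis by (simp only: W_def)
qed

end

section \<open>Binary search for the threshold\<close>

definition save :: com where
  "save = (For ''j'' ''m'' (Store ''y'' (Var ''j'') (Cell ''x'' (Var ''j''))) ;;
     For ''v'' ''n'' (Store ''f'' (Var ''v'') (Cell ''e'' (Var ''v''))) ;;
     ''R'' ::= Var ''F'' ;; ''hi'' ::= Var ''r'')"

text \<open>Halving without division: \<open>hi <= lo + 2^b - 1\<close> holds throughout, the probe
  lies \<open>2^(b-1) - 1\<close> above \<open>lo\<close>, and either outcome restores the
  inequality with \<open>b - 1\<close>. A probe at or above \<open>hi\<close> needs no test.\<close>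

definition bisect_step :: com where
  "bisect_step =
     (''b'' ::= Sub (Var ''b'') One ;;
      ''r'' ::= Sub (Add (Var ''lo'') (Cell ''pow'' (Var ''b''))) One ;;
      IfPos (Sub (Var ''hi'') (Var ''r''))
        (test_threshold ;;
         IfPos (Sub (Var ''F'') (Var ''D'')) (''lo'' ::= Add (Var ''r'') One) save)
        Skip)"

definition bisect :: com where
  "bisect = (''lo'' ::= Const 0 ;; ''b'' ::= Sub (Var ''L'') One ;; WhilePos (Var ''b'') bisect_step)"

definition report :: com where
  "report = IfPos (Add (Var ''R'') One)
     (For ''j'' ''m'' (Store ''flow'' (Cell ''perm'' (Var ''j'')) (Cell ''y'' (Var ''j''))) ;; ''feasible'' ::= One)
     (''feasible'' ::= Const 0)"

text \<open>The test on the full arc set supplies the pseudoflow of small excess from which the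
  bisection starts; if it fails, the instance is infeasible.\<close>

definition solve :: com where
  "solve =
     (''D'' ::= Add (Var ''k1'') (Var ''k1'') ;; ''r'' ::= Var ''m'' ;; test_threshold ;;
      IfPos (Sub (Var ''F'') (Var ''D'')) (''feasible'' ::= Const 0)
        (save ;; bisect ;; ''r'' ::= Var ''hi'' ;; finish ;; report))"

lemma writes_save: "writes save = {''j'', ''y'', ''v'', ''f'', ''R'', ''hi''}"
  by (auto simp: save_def)

lemma writes_bisect_step: "writes bisect_step =
    {''b'', ''r'', ''lo'', ''x'', ''e'', ''d'', ''ptr'', ''h'', ''cur'', ''i'', ''v'', ''j'', ''F'', ''y'', ''f'', ''R'', ''hi''}"
  by (auto simp: bisect_step_def writes_test_threshold writes_save)

lemma writes_bisect: "writes bisect =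
    {''b'', ''r'', ''lo'', ''x'', ''e'', ''d'', ''ptr'', ''h'', ''cur'', ''i'', ''v'', ''j'', ''F'', ''y'', ''f'', ''R'', ''hi''}"
  by (auto simp: bisect_def writes_bisect_step)

lemma wp_Seq_fun: "wp (Seq c d) Q = wp c (wp d Q)"
  by (simp add: fun_eq_iff)

context flow_network
begin

lemma pseudoflow_cong:
  assumes "pseudoflow r x e F" "\<And>j. j \<in> {0..<M} \<Longrightarrow> y j = x j" "\<And>v. v \<in> {0..<N} \<Longrightarrow> f v = e v"
  shows "pseudoflow r y f F"
proof -
  have ex: "excess y = excess x" using assms(2) by (simp add: excess_def fun_eq_iff)
  then show ?thesis using assms by (simp add: pseudoflow_def unit_flow_def)
qed

lemma wp_save:
  assumes g: "graph_ok s" and pf: "pseudoflow (s ''r'' 0) (s ''x'') (s ''e'') (s ''F'' 0)"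
  shows "wp save (\<lambda>s' t'. t' \<le> t + 50 * (N + M + 1) \<and> s' ''hi'' 0 = s ''r'' 0 \<and> s' ''R'' 0 = s ''F'' 0 \<and>
    pseudoflow (s ''r'' 0) (s' ''y'') (s' ''f'') (s ''F'' 0)) s t"
    (is "wp _ ?P s t")
proof -
  have s: "s ''n'' 0 = N" "s ''m'' 0 = M" using g by (auto simp: graph_ok_def)
  have 1: "wp (For ''j'' ''m'' (Store ''y'' (Var ''j'') (Cell ''x'' (Var ''j''))))
    (\<lambda>s' t'. t' \<le> t + 18 * M + 9 \<and> (\<forall>j\<in>{0..<M}. s' ''y'' j = s ''x'' j)) s t"
  proof (rule wp_For[where h = M and k = 6 and I = "\<lambda>i s'. \<forall>j\<in>{0..<i}. s' ''y'' j = s ''x'' j"], goal_cases)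
    case (8 i s1 t1)
    then have "s1 ''x'' = s ''x''" by (simp add: agree_def)
    moreover have "{0..<i + 1} = insert i {0..<i}" using 8(1) by auto
    ultimately show ?case using 8(3,4) by simp
  qed (use s M_nonneg in auto)
  show ?thesis
    unfolding save_def wp_Seq
  proof (rule wp_mono[OF 1])
    fix s1 t1
    assume h: "t1 \<le> t + 18 * M + 9 \<and> (\<forall>j\<in>{0..<M}. s1 ''y'' j = s ''x'' j)"
      and "agree (writes (For ''j'' ''m'' (Store ''y'' (Var ''j'') (Cell ''x'' (Var ''j''))))) s1 s"
    then have f1: "s1 ''n'' = s ''n''" "s1 ''e'' = s ''e''" "s1 ''F'' = s ''F''" "s1 ''r'' = s ''r''"
      by (auto simp: agree_def)
    show "wp (For ''v'' ''n'' (Store ''f'' (Var ''v'') (Cell ''e'' (Var ''v''))))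
      (wp (''R'' ::= Var ''F'') (wp (''hi'' ::= Var ''r'') ?P)) s1 t1"
    proof (rule wp_For[where h = N and k = 6 and I = "\<lambda>i s'. \<forall>v\<in>{0..<i}. s' ''f'' v = s ''e'' v"], goal_cases)
      case (8 i s2 t2)
      then have "s2 ''e'' = s ''e''" using f1 by (simp add: agree_def)
      moreover have "{0..<i + 1} = insert i {0..<i}" using 8(1) by auto
      ultimately show ?case using 8(3,4) by simp
    next
      case (9 s2 t2)
      have "s2 ''y'' = s1 ''y''" "s2 ''F'' = s ''F''" "s2 ''r'' = s ''r''" using 9(3) f1 by (auto simp: agree_def)
      moreover have "pseudoflow (s ''r'' 0) (s1 ''y'') (s2 ''f'') (s ''F'' 0)"
        by (rule pseudoflow_cong[OF pf]) (use h 9(1) in auto)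
      ultimately show ?case using 9(4) h N_nonneg M_nonneg by simp
    qed (use f1 s N_nonneg in auto)
  qed
qed

text \<open>Each alternative in the choice of \<open>k\<close> is matched with one bound: divide
  \<open>F k <= M <= k^2 L\<close> by \<open>k\<close>, or \<open>F k^2 <= 2 N^2 <= 2 k^3 L\<close>
  by \<open>k^2\<close>.\<close>

lemma test_failure:
  assumes bk: "balanced_k N M L k" and F: "feas r \<longrightarrow> F * k \<le> M \<and> F * k\<^sup>2 \<le> 2 * N\<^sup>2" and D: "2 * (k * L) < F"
    and L: "1 \<le> L"
  shows "\<not> feas r"
proof
  assume "feas r"
  then have F: "F * k \<le> M" "F * k\<^sup>2 \<le> 2 * N\<^sup>2" using F by auto
  have k: "1 \<le> k" using bk by (simp add: balanced_k_def)
  have kL: "0 \<le> k * L" using k L by simp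
  from bk have "M \<le> k\<^sup>2 * L \<or> N\<^sup>2 \<le> k ^ 3 * L" by (simp add: balanced_k_def)
  then have "F \<le> 2 * (k * L)"
  proof
    assume "M \<le> k\<^sup>2 * L"
    then have "F * k \<le> k * L * k" using F(1) by (simp add: power2_eq_square algebra_simps)
    then have "F \<le> k * L" using k mult_right_le_imp_le[of F k "k * L"] by simp
    then show ?thesis using kL by simp
  next
    assume "N\<^sup>2 \<le> k ^ 3 * L"
    then have "F * k\<^sup>2 \<le> 2 * (k * L) * k\<^sup>2" using F(2) by (simp add: power2_eq_square power3_eq_cube algebra_simps)
    then show ?thesis using k by simp
  qed
  then show False using D by simp
qed

definition solver_env :: "int \<Rightarrow> int \<Rightarrow> state \<Rightarrow> bool" where
  "solver_env L k s \<longleftrightarrow> graph_ok s \<and> s ''k'' 0 = k \<and> s ''L'' 0 = L \<and> s ''D'' 0 = 2 * (k * L) \<and>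
     balanced_k N M L k \<and> 1 \<le> L \<and> (\<forall>i\<in>{0..<L}. s ''pow'' i = 2 ^ nat i) \<and> M < 2 ^ nat (L - 1)"

lemma solver_env_agree:
  assumes "solver_env L k s" "agree W s' s"
    and "W \<inter> {''n'', ''m'', ''supply'', ''hv'', ''hw'', ''arc'', ''dir'', ''first'', ''link'', ''k'', ''L'', ''D'', ''pow''} = {}"
  shows "solver_env L k s'"
proof -
  have "s' a = s a" if "a \<in> {''k'', ''L'', ''D'', ''pow''}" for a
    using assms(2,3) that unfolding agree_def by blast
  moreover have "graph_ok s'"
    by (rule graph_ok_agree[OF _ assms(2)]) (use assms(1,3) in \<open>auto simp: solver_env_def\<close>)
  ultimately show ?thesis using assms(1) by (simp add: solver_env_def)
qed

text \<open>Not a bracket in the usual sense: \<open>hi\<close> need not be feasible. It only comes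
  with a pseudoflow whose excess is small enough for the final phase.\<close>

definition bracket :: "int \<Rightarrow> int \<Rightarrow> state \<Rightarrow> bool" where
  "bracket lo hi s \<longleftrightarrow> s ''hi'' 0 = hi \<and> 0 \<le> lo \<and> 0 \<le> hi \<and> hi \<le> M \<and>
     pseudoflow hi (s ''y'') (s ''f'') (s ''R'' 0) \<and> s ''R'' 0 \<le> s ''D'' 0 \<and>
     (\<forall>r. 0 \<le> r \<longrightarrow> r < lo \<longrightarrow> \<not> feas r)"

lemma wp_bisect_step:
  assumes env: "solver_env L k s" and br: "bracket (s ''lo'' 0) (s ''hi'' 0) s"
    and b: "0 < s ''b'' 0" "s ''b'' 0 < L" "s ''hi'' 0 \<le> s ''lo'' 0 + 2 ^ nat (s ''b'' 0) - 1"
  shows "wp bisect_step (\<lambda>s' t'. t' \<le> t + 3300 * (k * (N + M + 1)) \<and> bracket (s' ''lo'' 0) (s' ''hi'' 0) s' \<and>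
    s' ''b'' 0 = s ''b'' 0 - 1 \<and> s' ''hi'' 0 \<le> s' ''lo'' 0 + 2 ^ nat (s' ''b'' 0) - 1) s t"
    (is "wp _ ?P s t")
proof -
  let ?b = "s ''b'' 0 - 1" and ?lo = "s ''lo'' 0" and ?hi = "s ''hi'' 0"
  let ?r = "?lo + 2 ^ nat ?b - 1"
  have k: "1 \<le> k" and L: "1 \<le> L" and bk: "balanced_k N M L k"
    using env by (auto simp: solver_env_def balanced_k_def)
  have kZ: "N + M + 1 \<le> k * (N + M + 1)"
    using N_nonneg M_nonneg mult_right_mono[OF k, of "N + M + 1"] by simp
  then have kZ1: "1 \<le> k * (N + M + 1)" using N_nonneg M_nonneg by linarith
  have pow: "s ''pow'' ?b = 2 ^ nat ?b" using env b by (simp add: solver_env_def)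
  have "nat (s ''b'' 0) = Suc (nat ?b)" using b by simp
  then have dbl: "(2::int) ^ nat (s ''b'' 0) = 2 ^ nat ?b + 2 ^ nat ?b" by simp
  have lo: "0 \<le> ?lo" using br by (simp add: bracket_def)
  have r0: "0 \<le> ?r"
  proof -
    have "(0::int) < 2 ^ nat ?b" by simp
    then show ?thesis using lo by linarith
  qed
  let ?s = "s(''b'' := (s ''b'')(0 := ?b), ''r'' := (s ''r'')(0 := ?r))"
  have env1: "solver_env L k ?s" by (rule solver_env_agree[OF env, of "writes bisect_step"]) (auto simp: agree_def writes_bisect_step)
  then have g1: "graph_ok ?s" "?s ''k'' 0 = k" by (auto simp: solver_env_def)
  show ?thesis
  proof (cases "?hi - ?r > 0")
    case False
    then show ?thesis using br pow kZ1 by (simp add: bisect_step_def bracket_def)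
  next
    case True
    have "wp test_threshold (wp (IfPos (Sub (Var ''F'') (Var ''D'')) (''lo'' ::= Add (Var ''r'') One) save) ?P) ?s u"
      if u: "u \<le> t + 50" for u
    proof (rule wp_mono[OF wp_test_threshold[OF g1(1) _ g1(2) k, of ?r]])
      fix s2 t2
      assume h: "t2 \<le> u + 3100 * k * (N + M + 1) \<and> pseudoflow ?r (s2 ''x'') (s2 ''e'') (s2 ''F'' 0) \<and>
        (feas ?r \<longrightarrow> s2 ''F'' 0 * k \<le> M \<and> s2 ''F'' 0 * k\<^sup>2 \<le> 2 * N\<^sup>2)"
        and ag: "agree (writes test_threshold) s2 ?s"
      have env2: "solver_env L k s2" by (rule solver_env_agree[OF env1 ag]) (simp add: writes_test_threshold)
      have f2: "s2 ''r'' 0 = ?r" "s2 ''b'' 0 = ?b" "s2 ''lo'' 0 = ?lo" "s2 ''hi'' = s ''hi''" "s2 ''y'' = s ''y''"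
        "s2 ''f'' = s ''f''" "s2 ''R'' = s ''R''" "s2 ''D'' = s ''D''"
        using ag by (auto simp: agree_def writes_test_threshold)
      have D2: "s2 ''D'' 0 = 2 * (k * L)" using env2 by (simp add: solver_env_def)
      have time: "t2 \<le> t + 50 + 3100 * (k * (N + M + 1))" using h u by (simp add: mult.assoc)
      show "wp (IfPos (Sub (Var ''F'') (Var ''D'')) (''lo'' ::= Add (Var ''r'') One) save) ?P s2 t2"
      proof (cases "s2 ''D'' 0 < s2 ''F'' 0")
        case fail: True
        have inf: "\<not> feas ?r"
          by (rule test_failure[OF bk _ _ L, of ?r "s2 ''F'' 0"]) (use h fail D2 in auto)
        have "\<not> feas r'" if "0 \<le> r'" "r' < ?r + 1" for r'
          using feas_mono[of r' ?r] inf that by auto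
        then have "bracket (?r + 1) ?hi (s2(''lo'' := (s2 ''lo'')(0 := ?r + 1)))"
          using br f2 r0 by (simp add: bracket_def)
        moreover have "?hi \<le> ?r + 1 + 2 ^ nat ?b - 1" using b(3) dbl by simp
        moreover have "t2 + 20 \<le> t + 3300 * (k * (N + M + 1))" using time kZ1 by simp
        ultimately show ?thesis using fail f2 by simp
      next
        case False
        have g2: "graph_ok s2" using env2 by (simp add: solver_env_def)
        have "pseudoflow (s2 ''r'' 0) (s2 ''x'') (s2 ''e'') (s2 ''F'' 0)" using h f2 by simp
        note sv = wp_save[OF g2 this]
        have "wp save ?P s2 w" if w: "w \<le> t2 + 10" for w
        proof (rule wp_mono[OF sv])
          fix s3 t3
          assume h3: "t3 \<le> w + 50 * (N + M + 1) \<and> s3 ''hi'' 0 = s2 ''r'' 0 \<and> s3 ''R'' 0 = s2 ''F'' 0 \<and>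
              pseudoflow (s2 ''r'' 0) (s3 ''y'') (s3 ''f'') (s2 ''F'' 0)"
            and ag3: "agree (writes save) s3 s2"
          have f3: "s3 ''b'' 0 = ?b" "s3 ''lo'' 0 = ?lo" "s3 ''D'' 0 = s2 ''D'' 0"
            using ag3 f2 by (auto simp: agree_def writes_save)
          have "bracket ?lo ?r s3"
            unfolding bracket_def using h3 f2 f3 br True False r0 by (simp add: bracket_def)
          moreover have "t3 \<le> t + 3300 * (k * (N + M + 1))" using h3 w time kZ kZ1 by simp
          ultimately show "?P s3 t3" using h3 f2 f3 by simp
        qed
        then show ?thesis using False by simp
      qed
    qed simp
    then show ?thesis using True pow by (simp add: bisect_step_def)
  qed
qed

lemma wp_bisect:
  assumes env: "solver_env L k s" and br: "bracket 0 M s"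
  shows "wp bisect (\<lambda>s' t'. t' \<le> t + 3400 * (k * (N + M + 1)) * L \<and>
    (\<exists>lo hi. bracket lo hi s' \<and> hi \<le> lo)) s t"
    (is "wp _ ?P s t")
proof -
  define W where "W = k * (N + M + 1)"
  have k: "1 \<le> k" and L: "1 \<le> L" "M < 2 ^ nat (L - 1)" "s ''L'' 0 = L"
    using env by (auto simp: solver_env_def balanced_k_def)
  have "N + M + 1 \<le> W"
    using N_nonneg M_nonneg mult_right_mono[OF k, of "N + M + 1"] by (simp add: W_def)
  then have W: "1 \<le> W" using N_nonneg M_nonneg by linarith
  let ?I = "\<lambda>s' t'. bracket (s' ''lo'' 0) (s' ''hi'' 0) s' \<and> 0 \<le> s' ''b'' 0 \<and> s' ''b'' 0 < L \<and>
    s' ''hi'' 0 \<le> s' ''lo'' 0 + 2 ^ nat (s' ''b'' 0) - 1 \<and> t' + 3310 * W * (s' ''b'' 0 + 1) \<le> t + 20 + 3310 * W * L"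
  let ?s = "s(''lo'' := (s ''lo'')(0 := 0), ''b'' := (s ''b'')(0 := L - 1))"
  have "wp (WhilePos (Var ''b'') bisect_step) ?P ?s u" if u: "u \<le> t + 20" for u
  proof (rule wp_While[where I = ?I and B = "t + 20 + 3310 * W * L"])
    show "?I ?s u" using br L u by (simp add: bracket_def)
  next
    fix s1 t1 assume "?I s1 t1"
    moreover from this have "0 \<le> 3310 * W * (s1 ''b'' 0 + 1)" using W by simp
    ultimately show "t1 \<le> t + 20 + 3310 * W * L" by linarith
  next
    fix s1 t1 assume I: "?I s1 t1" and ag: "agree (writes bisect_step) s1 ?s" and pos: "0 < eval (Var ''b'') s1"
    have "solver_env L k ?s" by (rule solver_env_agree[OF env, of "writes bisect"]) (auto simp: agree_def writes_bisect)
    then have env1: "solver_env L k s1" by (rule solver_env_agree[OF _ ag]) (simp add: writes_bisect_step)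
    have mul: "3310 * W * (s1 ''b'' 0 + 1) = 3310 * W * s1 ''b'' 0 + 3310 * W" by (simp add: algebra_simps)
    show "wp bisect_step ?I s1 (t1 + (1 + cost (Var ''b'')))"
      by (rule wp_mono[OF wp_bisect_step[OF env1]])
        (use I pos mul W in \<open>auto simp flip: W_def\<close>)
  next
    fix s1 t1 assume I: "?I s1 t1" and "eval (Var ''b'') s1 \<le> 0"
    then have b0: "s1 ''b'' 0 = 0" by simp
    have "W * 1 \<le> W * L" using W L by (intro mult_left_mono) auto
    moreover have "t1 + 3310 * W \<le> t + 20 + 3310 * (W * L)" using I b0 by (simp add: mult.assoc)
    ultimately have "t1 + 3 \<le> t + 3400 * (W * L)" using W by linarith
    then have "t1 + 3 \<le> t + 3400 * (k * (N + M + 1)) * L" by (simp add: W_def mult.assoc)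
    then show "?P s1 (t1 + (1 + cost (Var ''b'')))"
      using I b0 by auto
  qed
  then show ?thesis using L by (simp add: bisect_def)
qed

definition optimal_threshold :: "int \<Rightarrow> (int \<Rightarrow> int) \<Rightarrow> bool" where
  "optimal_threshold r y \<longleftrightarrow> 0 \<le> r \<and> r \<le> M \<and> unit_flow r y \<and> (\<forall>v\<in>{0..<N}. excess y v = 0) \<and>
     (\<forall>r'. 0 \<le> r' \<longrightarrow> r' < r \<longrightarrow> \<not> feas r')"

text \<open>\<open>y\<close> is indexed by weight rank, the output by input position;
  \<open>perm\<close> translates.\<close>

definition solved :: "state \<Rightarrow> bool" where
  "solved s \<longleftrightarrow> s ''feasible'' 0 = 0 \<and> \<not> feas M \<or>
     s ''feasible'' 0 = 1 \<and> (\<exists>r y. optimal_threshold r y \<and> (\<forall>j\<in>{0..<M}. s ''flow'' (s ''perm'' j) = y j))"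

lemma wp_report:
  assumes m: "s ''m'' 0 = M" and perm: "inj_on (s ''perm'') {0..<M}"
    and R: "s ''R'' 0 = -1 \<and> \<not> feas M \<or> s ''R'' 0 = 0 \<and> optimal_threshold r (s ''y'')"
  shows "wp report (\<lambda>s' t'. t' \<le> t + 50 * (N + M + 1) \<and> solved s') s t"
    (is "wp _ ?P s t")
proof (cases "s ''R'' 0 = -1")
  case True
  then show ?thesis using R N_nonneg M_nonneg by (simp add: report_def solved_def)
next
  case False
  then have R: "s ''R'' 0 = 0" "optimal_threshold r (s ''y'')" using R by auto
  have "wp (For ''j'' ''m'' (Store ''flow'' (Cell ''perm'' (Var ''j'')) (Cell ''y'' (Var ''j'')))) (wp (''feasible'' ::= One) ?P) s u"
    if u: "u \<le> t + 10" for u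
  proof (rule wp_For[where h = M and k = 7 and
      I = "\<lambda>i s'. \<forall>j\<in>{0..<i}. s' ''flow'' (s ''perm'' j) = s ''y'' j"], goal_cases)
    case (8 i s1 t1)
    then have f: "s1 ''perm'' = s ''perm''" "s1 ''y'' = s ''y''" by (auto simp: agree_def)
    have set: "{0..<i + 1} = insert i {0..<i}" using 8(1) by auto
    \<comment> \<open>Injectivity of \<open>perm\<close> keeps later stores from overwriting earlier
      results.\<close>
    have "s ''perm'' j \<noteq> s ''perm'' i" if "j \<in> {0..<i}" for j
      using inj_onD[OF perm, of j i] that 8(1,2) by auto
    then show ?case unfolding set using 8(3,4) f by simp
  next
    case (9 s1 t1)
    have "s1 ''perm'' = s ''perm''" using 9(3) by (simp add: agree_def)
    then have "solved (s1(''feasible'' := (s1 ''feasible'')(0 := 1)))"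
      unfolding solved_def using 9(1) R(2) by auto
    then show ?case using 9(4) u N_nonneg M_nonneg by simp
  qed (use m M_nonneg in auto)
  then show ?thesis using R by (simp add: report_def)
qed

lemma wp_solve:
  assumes g: "graph_ok s" and k: "s ''k'' 0 = k" "s ''k1'' 0 = k * L" "balanced_k N M L k"
    and L: "s ''L'' 0 = L" "1 \<le> L" "\<And>i. i \<in> {0..<L} \<Longrightarrow> s ''pow'' i = 2 ^ nat i" "M < 2 ^ nat (L - 1)"
    and perm: "inj_on (s ''perm'') {0..<M}"
  shows "wp solve (\<lambda>s' t'. t' \<le> t + 20000 * (k * (N + M + 1)) * L \<and> solved s' \<and> s' ''perm'' = s ''perm'') s t"
    (is "wp _ ?P s t")
proof -
  define W where "W = k * (N + M + 1)"
  have k1: "1 \<le> k" using k by (simp add: balanced_k_def)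
  have WZ: "N + M + 1 \<le> W"
    using N_nonneg M_nonneg mult_right_mono[OF k1, of "N + M + 1"] by (simp add: W_def)
  then have W: "1 \<le> W" using N_nonneg M_nonneg by linarith
  define V where "V = W * L"
  have WL: "W \<le> V" using W mult_left_mono[OF L(2), of W] by (simp add: V_def)
  have V: "20000 * (k * (N + M + 1)) * L = 20000 * V" by (simp add: V_def W_def mult.assoc)
  let ?s = "s(''D'' := (s ''D'')(0 := k * L + k * L), ''r'' := (s ''r'')(0 := M))"
  have "graph_ok ?s" by (rule graph_ok_agree[OF g, of "{''D'', ''r''}"]) (auto simp: agree_def)
  then have env: "solver_env L k ?s" using k L by (simp add: solver_env_def)
  then have g1: "graph_ok ?s" "?s ''k'' 0 = k" by (auto simp: solver_env_def)
  have m: "s ''m'' 0 = M" using g by (simp add: graph_ok_def)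
  let ?rest = "IfPos (Sub (Var ''F'') (Var ''D'')) (''feasible'' ::= Const 0)
        (save ;; bisect ;; ''r'' ::= Var ''hi'' ;; finish ;; report)"
  have "wp test_threshold (wp ?rest ?P) ?s u" if u: "u \<le> t + 20" for u
  proof (rule wp_mono[OF wp_test_threshold[OF g1(1) _ g1(2) k1, of M]])
    fix s2 t2
    assume h: "t2 \<le> u + 3100 * k * (N + M + 1) \<and> pseudoflow M (s2 ''x'') (s2 ''e'') (s2 ''F'' 0) \<and>
      (feas M \<longrightarrow> s2 ''F'' 0 * k \<le> M \<and> s2 ''F'' 0 * k\<^sup>2 \<le> 2 * N\<^sup>2)"
      and ag: "agree (writes test_threshold) s2 ?s"
    have env2: "solver_env L k s2" by (rule solver_env_agree[OF env ag]) (simp add: writes_test_threshold)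
    have f2: "s2 ''r'' 0 = M" "s2 ''perm'' = s ''perm''" using ag by (auto simp: agree_def writes_test_threshold)
    have D2: "s2 ''D'' 0 = 2 * (k * L)" and g2: "graph_ok s2" using env2 by (auto simp: solver_env_def)
    have t2: "t2 \<le> t + 20 + 3100 * W" using h u by (simp add: W_def mult.assoc)
    show "wp ?rest ?P s2 t2"
    proof (cases "s2 ''D'' 0 < s2 ''F'' 0")
      case True
      have "\<not> feas M"
        by (rule test_failure[OF k(3) _ _ L(2), of M "s2 ''F'' 0"]) (use h True D2 in auto)
      then have "solved (s2(''feasible'' := (s2 ''feasible'')(0 := 0)))" by (simp add: solved_def)
      moreover have "t2 + 20 \<le> t + 20000 * V" using t2 W WL by simp
      ultimately show ?thesis using True f2 unfolding V by simp
    next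
      case False
      have "pseudoflow (s2 ''r'' 0) (s2 ''x'') (s2 ''e'') (s2 ''F'' 0)" using h f2 by simp
      note sv = wp_save[OF g2 this]
      have "wp save (wp bisect (wp (''r'' ::= Var ''hi'') (wp finish (wp report ?P)))) s2 w" if w: "w \<le> t2 + 10" for w
      proof (rule wp_mono[OF sv])
        fix s3 t3
        assume h3: "t3 \<le> w + 50 * (N + M + 1) \<and> s3 ''hi'' 0 = s2 ''r'' 0 \<and> s3 ''R'' 0 = s2 ''F'' 0 \<and>
            pseudoflow (s2 ''r'' 0) (s3 ''y'') (s3 ''f'') (s2 ''F'' 0)"
          and ag3: "agree (writes save) s3 s2"
        have env3: "solver_env L k s3" by (rule solver_env_agree[OF env2 ag3]) (simp add: writes_save)
        then have "s3 ''D'' 0 = s2 ''D'' 0" using D2 by (simp add: solver_env_def)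
        then have br: "bracket 0 M s3"
          using h3 f2 False M_nonneg by (simp add: bracket_def)
        have f3: "s3 ''perm'' = s ''perm''" using ag3 f2 by (simp add: agree_def writes_save)
        have t3: "t3 \<le> t + 30 + 3150 * W" using h3 w t2 W WZ by simp
        show "wp bisect (wp (''r'' ::= Var ''hi'') (wp finish (wp report ?P))) s3 t3"
        proof (rule wp_mono[OF wp_bisect[OF env3 br]])
          fix s4 t4
          assume h4: "t4 \<le> t3 + 3400 * (k * (N + M + 1)) * L \<and> (\<exists>lo hi. bracket lo hi s4 \<and> hi \<le> lo)"
            and ag4: "agree (writes bisect) s4 s3"
          then obtain lo hi where br4: "bracket lo hi s4" "hi \<le> lo" by blast
          have env4: "solver_env L k s4" by (rule solver_env_agree[OF env3 ag4]) (simp add: writes_bisect)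
          then have D4: "s4 ''D'' 0 = 2 * (k * L)" by (simp add: solver_env_def)
          let ?s4 = "s4(''r'' := (s4 ''r'')(0 := hi))"
          have env5: "solver_env L k ?s4" by (rule solver_env_agree[OF env4, of "writes bisect"]) (auto simp: agree_def writes_bisect)
          then have g5: "graph_ok ?s4" by (simp add: solver_env_def)
          have t4: "t4 \<le> t + 30 + 3150 * W + 3400 * V" using h4 t3 by (simp add: V_def W_def mult.assoc)
          have "wp finish (wp report ?P) ?s4 v" if v: "v \<le> t4 + 10" for v
          proof (rule wp_mono[OF wp_finish[OF g5]])
            show "pseudoflow (?s4 ''r'' 0) (?s4 ''y'') (?s4 ''f'') (?s4 ''R'' 0)" "0 \<le> ?s4 ''r'' 0" "?s4 ''r'' 0 \<le> M"
              using br4 by (simp_all add: bracket_def)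
            show "\<not> feas r'" if "0 \<le> r'" "r' < ?s4 ''r'' 0" for r'
              using br4 that by (simp add: bracket_def)
            fix s5 t5
            assume h5: "t5 \<le> v + 2000 * (N + M + 1) * (?s4 ''R'' 0 + 1) \<and>
              (s5 ''R'' 0 = -1 \<and> \<not> feas M \<or>
               s5 ''R'' 0 = 0 \<and> pseudoflow (s5 ''r'' 0) (s5 ''y'') (s5 ''f'') 0 \<and>
                 0 \<le> s5 ''r'' 0 \<and> s5 ''r'' 0 \<le> M \<and> (\<forall>r'. 0 \<le> r' \<longrightarrow> r' < s5 ''r'' 0 \<longrightarrow> \<not> feas r'))"
              and ag5: "agree (writes finish) s5 ?s4"
            have perm5: "s5 ''perm'' = s ''perm''"
              using ag5 ag4 f3 by (simp add: agree_def writes_finish writes_bisect)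
            have "graph_ok s5" by (rule graph_ok_agree[OF g5 ag5]) (simp add: writes_finish)
            then have m5: "s5 ''m'' 0 = M" by (simp add: graph_ok_def)
            have "s5 ''R'' 0 = -1 \<and> \<not> feas M \<or> s5 ''R'' 0 = 0 \<and> optimal_threshold (s5 ''r'' 0) (s5 ''y'')"
              using h5 total_excess_eq_0[of "s5 ''y''"] by (auto simp: optimal_threshold_def pseudoflow_def)
            note rep = wp_report[OF m5 _ this, of t5]
            define P where "P = (N + M + 1) * (s4 ''R'' 0 + 1)"
            \<comment> \<open>Here the accepted excess, at most \<open>D = 2 k L\<close>, limits the
              number of searches.\<close>
            have "P \<le> (N + M + 1) * (2 * (k * L) + 1)"
              unfolding P_def
              using br4 D4 N_nonneg M_nonneg by (intro mult_left_mono) (auto simp: bracket_def)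
            also have "\<dots> = 2 * V + (N + M + 1)" by (simp add: V_def W_def algebra_simps)
            finally have t5': "P \<le> 2 * V + (N + M + 1)" .
            have "t5 \<le> v + 2000 * P" using conjunct1[OF h5] by (simp add: P_def algebra_simps)
            with t5' have t5: "t5 \<le> v + 2000 * (2 * V + (N + M + 1))" by simp
            show "wp report ?P s5 t5"
            proof (rule wp_mono[OF rep])
              show "inj_on (s5 ''perm'') {0..<M}" using perm perm5 by simp
              fix s6 t6
              assume h6: "t6 \<le> t5 + 50 * (N + M + 1) \<and> solved s6" and "agree (writes report) s6 s5"
              then have "s6 ''perm'' = s ''perm''" using perm5 by (simp add: agree_def report_def)
              moreover have "t6 \<le> t + 20000 * V" using conjunct1[OF h6] t5 v t4 W WL WZ by simp
              ultimately show "?P s6 t6" using h6 unfolding V by simp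
            qed
          qed
          then show "wp (''r'' ::= Var ''hi'') (wp finish (wp report ?P)) s4 t4"
            using br4 by (simp add: bracket_def)
        qed
      qed
      then show ?thesis using False by (simp add: wp_Seq_fun)
    qed
  qed simp
  then show ?thesis using k(2) m by (simp add: solve_def)
qed

end

section \<open>The time bound\<close>

definition log_length :: "nat \<Rightarrow> nat" where
  "log_length m = Suc (LEAST i. m < 2 ^ i)"

definition label_bound :: "nat \<Rightarrow> nat \<Rightarrow> nat" where
  "label_bound n m = (LEAST k. 1 \<le> k \<and> (m \<le> k\<^sup>2 * log_length m \<or> n\<^sup>2 \<le> k ^ 3 * log_length m))"

text \<open>The asymptotic claim ranges over all pairs in the size regime, including those with
  \<open>m > n^2\<close>, which no simple graph attains and for which \<open>log m\<close> need not
  be \<open>O(log n)\<close>; the value 0 disposes of them.\<close>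

definition time_bound :: "nat \<Rightarrow> nat \<Rightarrow> nat" where
  "time_bound n m = (if m \<le> n\<^sup>2 then 21000 * (label_bound n m * log_length m * (n + m + 1)) else 0)"

lemma log_length_unique:
  assumes "1 \<le> L" "int m < 2 ^ nat (L - 1)" "2 \<le> L \<longrightarrow> 2 ^ nat (L - 2) \<le> int m"
  shows "L = int (log_length m)"
proof -
  have "(LEAST i. m < 2 ^ i) = nat (L - 1)"
  proof (rule Least_equality)
    show "m < 2 ^ nat (L - 1)" using assms(2) by (metis of_nat_less_iff of_nat_numeral of_nat_power)
    fix i assume i: "m < 2 ^ i"
    show "nat (L - 1) \<le> i"
    proof (rule ccontr)
      assume "\<not> nat (L - 1) \<le> i"
      then have "i \<le> nat (L - 2)" "2 \<le> L" by auto
      have "2 ^ nat (L - 2) \<le> m"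
        using assms(3) \<open>2 \<le> L\<close> by (metis of_nat_le_iff of_nat_numeral of_nat_power)
      moreover have "(2::nat) ^ i \<le> 2 ^ nat (L - 2)"
        using \<open>i \<le> nat (L - 2)\<close> by (intro power_increasing) auto
      ultimately show False using i by simp
    qed
  qed
  then show ?thesis using assms(1) by (simp add: log_length_def)
qed

lemma label_bound_unique:
  assumes "balanced_k (int n) (int m) (int (log_length m)) k"
  shows "k = int (label_bound n m)"
proof -
  let ?L = "log_length m"
  have k: "1 \<le> k" "int m \<le> k\<^sup>2 * int ?L \<or> (int n)\<^sup>2 \<le> k ^ 3 * int ?L"
    "\<And>j. 1 \<le> j \<Longrightarrow> j < k \<Longrightarrow> j\<^sup>2 * int ?L < int m \<and> j ^ 3 * int ?L < (int n)\<^sup>2"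
    using assms by (auto simp: balanced_k_def)
  obtain k' where k': "k = int k'" using k(1) by (metis nonneg_int_cases order_trans zero_le_one)
  have "label_bound n m = k'"
    unfolding label_bound_def
  proof (rule Least_equality)
    show "1 \<le> k' \<and> (m \<le> k'\<^sup>2 * ?L \<or> n\<^sup>2 \<le> k' ^ 3 * ?L)"
      using k(1,2) unfolding k' by (simp flip: of_nat_power of_nat_mult)
    fix j assume j: "1 \<le> j \<and> (m \<le> j\<^sup>2 * ?L \<or> n\<^sup>2 \<le> j ^ 3 * ?L)"
    show "k' \<le> j"
    proof (rule ccontr)
      assume "\<not> k' \<le> j"
      then have "(int j)\<^sup>2 * int ?L < int m \<and> (int j) ^ 3 * int ?L < (int n)\<^sup>2"
        using j by (intro k(3)) (auto simp: k')
      then show False using j by (simp flip: of_nat_power of_nat_mult)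
    qed
  qed
  then show ?thesis using k' by simp
qed

lemma log_length_bounds:
  assumes "2 \<le> n" "m \<le> n\<^sup>2" "1 \<le> m"
  shows "1 \<le> log_length m" "real (log_length m) \<le> 4 * log 2 (real n)"
proof -
  show "1 \<le> log_length m" by (simp add: log_length_def)
  let ?i = "LEAST i. m < 2 ^ i"
  have "m < 2 ^ m" by simp
  then have i: "m < 2 ^ ?i" by (rule LeastI)
  then have "?i \<noteq> 0" using assms(3) by (metis One_nat_def leD power_0)
  then have "\<not> m < 2 ^ (?i - 1)" using not_less_Least[of "?i - 1" "\<lambda>i. m < 2 ^ i"] by simp
  then have "2 ^ (?i - 1) \<le> n\<^sup>2" using assms(2) by simp
  then have "(2::real) ^ (?i - 1) \<le> (real n)\<^sup>2" by (metis of_nat_le_iff of_nat_numeral of_nat_power)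
  then have "log 2 ((2::real) ^ (?i - 1)) \<le> log 2 ((real n)\<^sup>2)" by (intro log_mono) auto
  then have "real (?i - 1) \<le> 2 * log 2 (real n)" using assms(1) by (simp add: log_nat_power)
  moreover have "1 \<le> log 2 (real n)" using assms(1) by simp
  ultimately show "real (log_length m) \<le> 4 * log 2 (real n)"
    using \<open>?i \<noteq> 0\<close> by (simp add: log_length_def of_nat_diff)
qed

lemma label_bound_props:
  "1 \<le> label_bound n m"
  "1 < label_bound n m \<Longrightarrow> (label_bound n m - 1)\<^sup>2 * log_length m < m \<and> (label_bound n m - 1) ^ 3 * log_length m < n\<^sup>2"
proof -
  let ?P = "\<lambda>k. 1 \<le> k \<and> (m \<le> k\<^sup>2 * log_length m \<or> n\<^sup>2 \<le> k ^ 3 * log_length m)"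
  have "m \<le> (m + 1)\<^sup>2 * log_length m" by (simp add: log_length_def power2_eq_square)
  then have "?P (m + 1)" by simp
  then have "?P (Least ?P)" by (rule LeastI)
  then show "1 \<le> label_bound n m" by (simp add: label_bound_def)
  assume gt: "1 < label_bound n m"
  then have "label_bound n m - 1 < Least ?P" by (simp add: label_bound_def)
  then have "\<not> ?P (label_bound n m - 1)" by (rule not_less_Least)
  then show "(label_bound n m - 1)\<^sup>2 * log_length m < m \<and> (label_bound n m - 1) ^ 3 * log_length m < n\<^sup>2"
    using gt by auto
qed

text \<open>For \<open>k >= 2\<close> minimality bounds \<open>(k - 1)^2 L\<close> and
  \<open>(k - 1)^3 L\<close>; multiplying by \<open>L\<close> and \<open>L^2\<close> gives a perfect
  square and a perfect cube, and \<open>k <= 2 (k - 1)\<close> returns to \<open>k\<close>. For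
  \<open>k = 1\<close> only \<open>L <= 4 g\<close> has to be compared.\<close>

lemma product_bound:
  fixes k L m n g K :: real
  assumes k: "1 \<le> k" "k = 1 \<or> 2 \<le> k \<and> (k - 1)\<^sup>2 * L \<le> m \<and> (k - 1) ^ 3 * L \<le> n\<^sup>2"
    and L: "1 \<le> L" "L \<le> 4 * g" and g: "1 \<le> g" "g \<le> n" and n: "n \<le> K * m" and K: "1 \<le> K" and m: "1 \<le> m"
  shows "k * L \<le> 8 * K * sqrt (m * g)" "k * L \<le> 8 * (n * g) powr (2/3)"
proof -
  have gm: "1 \<le> m * g" using m g mult_mono[of 1 m 1 g] by simp
  have gn: "1 \<le> n * g" using g mult_mono[of 1 n 1 g] by simp
  have s0: "0 \<le> sqrt (m * g)" using gm by simp
  show "k * L \<le> 8 * K * sqrt (m * g)"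
  proof (cases "k = 1")
    case True
    \<comment> \<open>Uses \<open>g <= n <= K m\<close>: the logarithm is dominated by the number of
      arcs.\<close>
    have "g\<^sup>2 \<le> K * m * g" using g n by (simp add: power2_eq_square mult_right_mono)
    also have "\<dots> \<le> K\<^sup>2 * (m * g)"
      using K gm mult_right_mono[of K "K * K" "m * g"] by (simp add: power2_eq_square mult.assoc)
    also have "\<dots> = (K * sqrt (m * g))\<^sup>2" using gm by (simp add: power_mult_distrib)
    finally have "g \<le> K * sqrt (m * g)" by (rule power2_le_imp_le) (use K s0 in simp)
    moreover have "0 \<le> K * sqrt (m * g)" using K s0 by simp
    ultimately show ?thesis using True L by simp
  next
    case False
    then have k2: "2 \<le> k" "(k - 1)\<^sup>2 * L \<le> m" using k by auto
    have "((k - 1) * L)\<^sup>2 = ((k - 1)\<^sup>2 * L) * L" by (simp add: power2_eq_square)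
    also have "\<dots> \<le> m * (4 * g)" using k2 L m by (intro mult_mono) auto
    also have "\<dots> = (2 * sqrt (m * g))\<^sup>2" using gm by (simp add: power_mult_distrib)
    finally have "(k - 1) * L \<le> 2 * sqrt (m * g)" by (rule power2_le_imp_le) (use s0 in simp)
    moreover have "k * L \<le> 2 * ((k - 1) * L)"
      using mult_right_mono[of k "2 * (k - 1)" L] k2 L by simp
    ultimately have "k * L \<le> 4 * sqrt (m * g)" by linarith
    also have "\<dots> \<le> 8 * K * sqrt (m * g)" using K s0 by (intro mult_right_mono) auto
    finally show ?thesis .
  qed
  have cube: "((n * g) powr (2/3)) ^ 3 = (n * g)\<^sup>2"
  proof -
    have "((n * g) powr (2/3)) ^ 3 = ((n * g) powr (2/3)) powr 3"
      using gn by (simp add: powr_numeral)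
    also have "\<dots> = (n * g) powr 2" by (simp add: powr_powr)
    also have "\<dots> = (n * g)\<^sup>2" using gn by (simp add: powr_numeral)
    finally show ?thesis .
  qed
  have p0: "0 \<le> (n * g) powr (2/3)" by simp
  show "k * L \<le> 8 * (n * g) powr (2/3)"
  proof (cases "k = 1")
    case True
    have "g ^ 3 = g * g\<^sup>2" by (simp add: power2_eq_square power3_eq_cube)
    also have "\<dots> \<le> n\<^sup>2 * g\<^sup>2"
      using g mult_mono[of g n 1 n] by (intro mult_right_mono) (auto simp: power2_eq_square)
    finally have "g ^ 3 \<le> ((n * g) powr (2/3)) ^ 3" unfolding cube by (simp add: power_mult_distrib)
    \<comment> \<open>The instance 2 refers to the exponent \<open>Suc 2\<close>, so this compares
      cubes.\<close>
    then have "g \<le> (n * g) powr (2/3)" using p0 by (rule power_le_imp_le_base[of _ 2, simplified])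
    then show ?thesis using True L p0 by simp
  next
    case False
    then have k2: "2 \<le> k" "(k - 1) ^ 3 * L \<le> n\<^sup>2" using k by auto
    have "((k - 1) * L) ^ 3 = ((k - 1) ^ 3 * L) * L\<^sup>2" by (simp add: power2_eq_square power3_eq_cube)
    also have "\<dots> \<le> n\<^sup>2 * (4 * g)\<^sup>2" using k2 L g by (intro mult_mono power_mono) auto
    also have "\<dots> \<le> 64 * (n * g)\<^sup>2" by (simp add: power_mult_distrib)
    also have "\<dots> = (4 * (n * g) powr (2/3)) ^ 3" by (simp add: power_mult_distrib cube)
    finally have "(k - 1) * L \<le> 4 * (n * g) powr (2/3)"
      by (rule power_le_imp_le_base[of _ 2, simplified]) simp
    moreover have "k * L \<le> 2 * ((k - 1) * L)"
      using mult_right_mono[of k "2 * (k - 1)" L] k2 L by simp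
    ultimately show ?thesis by linarith
  qed
qed

lemma time_bound_asymptotic:
  "(\<lambda>(n, m). real (time_bound n m)) \<in> O[size_regime K](\<lambda>(n, m).
     min (real m * (real n * log 2 (real n)) powr (2/3))
         (real m powr (3/2) * sqrt (log 2 (real n))))"
proof -
  \<comment> \<open>\<open>K + 1\<close> meets the requirement of \<open>product_bound\<close> that
    the ratio be at least 1; \<open>K + 3\<close> comes from \<open>n <= (K + 1) m\<close>,
    \<open>m\<close> and \<open>1 <= m\<close>.\<close>
  let ?c = "21000 * 8 * (real K + 1) * (real K + 3)"
  have "real (time_bound n m) \<le> ?c * min (real m * (real n * log 2 (real n)) powr (2/3))
         (real m powr (3/2) * sqrt (log 2 (real n)))"
    if nm: "2 \<le> n" "n \<le> K * m" for n m
  proof (cases "m \<le> n\<^sup>2")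
    case False
    then show ?thesis using nm by (simp add: time_bound_def)
  next
    case True
    let ?g = "log 2 (real n)" and ?k = "label_bound n m" and ?L = "log_length m"
    let ?A = "(real n * ?g) powr (2/3)" and ?B = "sqrt (real m * ?g)"
    have m: "1 \<le> m" using nm by (cases m) auto
    have nK: "real n \<le> (real K + 1) * real m"
    proof -
      have "real n \<le> real (K * m)" using nm by (simp only: of_nat_le_iff)
      also have "\<dots> \<le> (real K + 1) * real m" by (simp add: algebra_simps)
      finally show ?thesis .
    qed
    have g: "1 \<le> ?g" "?g \<le> real n"
      using nm log2_of_power_le[of n n] less_exp[of n] by simp_all
    have kc: "real ?k = 1 \<or> 2 \<le> real ?k \<and> (real ?k - 1)\<^sup>2 * real ?L \<le> real m \<and> (real ?k - 1) ^ 3 * real ?L \<le> (real n)\<^sup>2"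
    proof (cases "1 < ?k")
      case k: True
      have "(?k - 1)\<^sup>2 * ?L \<le> m" "(?k - 1) ^ 3 * ?L \<le> n\<^sup>2" using label_bound_props(2)[OF k] by simp_all
      then have "real ((?k - 1)\<^sup>2 * ?L) \<le> real m" "real ((?k - 1) ^ 3 * ?L) \<le> real (n\<^sup>2)"
        by (simp_all only: of_nat_le_iff)
      then show ?thesis using k by (simp add: of_nat_diff)
    next
      case False
      then show ?thesis using label_bound_props(1)[of n m] by simp
    qed
    have prod: "real ?k * real ?L \<le> 8 * (real K + 1) * ?B" "real ?k * real ?L \<le> 8 * ?A"
      using product_bound[of "real ?k" "real ?L" "real m" "real n" ?g "real K + 1"]
        kc log_length_bounds[OF nm(1) True m] label_bound_props(1)[of n m] g nK m by simp_all
    have Z: "real (n + m + 1) \<le> (real K + 3) * real m"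
    proof -
      have "1 \<le> real m" using m by simp
      then show ?thesis using nK by (simp add: algebra_simps)
    qed
    have tb: "real (time_bound n m) = 21000 * (real ?k * real ?L * real (n + m + 1))"
      using True by (simp add: time_bound_def algebra_simps)
    have "real ?k * real ?L \<le> 8 * (real K + 1) * ?A"
    proof -
      have "8 * ?A \<le> 8 * (real K + 1) * ?A" by (intro mult_right_mono) auto
      then show ?thesis using prod(2) by linarith
    qed
    then have mn: "real ?k * real ?L \<le> 8 * (real K + 1) * min ?A ?B" using prod(1) by (simp add: min_def)
    have "real ?k * real ?L * real (n + m + 1) \<le> (8 * (real K + 1) * min ?A ?B) * ((real K + 3) * real m)"
    proof (rule mult_mono[OF mn Z])
      have "0 \<le> min ?A ?B" using g by simp
      then show "0 \<le> 8 * (real K + 1) * min ?A ?B" by simp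
    qed simp
    then have "real (time_bound n m) \<le> ?c * (real m * min ?A ?B)" unfolding tb by (simp add: algebra_simps)
    also have "real m * min ?A ?B = min (real m * ?A) (real m * ?B)" by (simp add: min_mult_distrib_left)
    also have "real m * ?B = real m powr (3/2) * sqrt ?g"
    proof -
      have "real m powr (3/2) = real m powr 1 * real m powr (1/2)" by (subst powr_add[symmetric]) simp
      then have "real m powr (3/2) = real m * sqrt (real m)" using m by (simp add: powr_half_sqrt)
      then show ?thesis by (simp add: real_sqrt_mult)
    qed
    finally show ?thesis .
  qed
  then show ?thesis
    unfolding size_regime_def
    by (intro bigoI[where c = ?c]) (auto simp: eventually_principal split: prod.split)
qed

section \<open>Correctness of the program\<close>

definition bnfp_program :: com where
  "bnfp_program = (powers ;; choose_k ;; merge_sort ;; build_graph ;; solve)"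

text \<open>\<open>A\<close> sends weight ranks to positions in the input list; injectivity of
  \<open>A\<close> and distinctness of the list exclude parallel arcs.\<close>

lemma unit_bnfp_network:
  assumes I: "is_bnfp I" and es: "distinct es" "set es = parcs (network I)"
    and V: "pverts (network I) = {..<card (pverts (network I))}"
    and A: "bij_betw A {0..<int (length es)} {0..<int (length es)}"
  shows "flow_network (int (card (pverts (network I)))) (int (length es))
    (\<lambda>j. int (fst (es ! nat (A j)))) (\<lambda>j. int (snd (es ! nat (A j)))) (\<lambda>v. net_supply I (nat v))"
proof
  let ?n = "card (pverts (network I))" and ?m = "length es"
  interpret G: pair_fin_digraph "network I" using I by (simp add: is_bnfp_def)
  have arc: "es ! nat (A j) \<in> parcs (network I)" "A j \<in> {0..<int ?m}" if "j \<in> {0..<int ?m}" for j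
  proof -
    show Aj: "A j \<in> {0..<int ?m}" using A that by (auto simp: bij_betw_def)
    then show "es ! nat (A j) \<in> parcs (network I)" using es(2) by (metis atLeastLessThan_iff nat_less_iff nth_mem)
  qed
  show "int (fst (es ! nat (A j))) \<in> {0..<int ?n}" "int (snd (es ! nat (A j))) \<in> {0..<int ?n}"
    if "j \<in> {0..<int ?m}" for j
  proof -
    obtain u w where uw: "es ! nat (A j) = (u, w)" by (cases "es ! nat (A j)")
    then have "(u, w) \<in> parcs (network I)" using arc(1)[OF that] by simp
    then have "u \<in> pverts (network I)" "w \<in> pverts (network I)" by (rule G.in_arcsD1, rule G.in_arcsD2)
    then have "u \<in> {..<?n}" "w \<in> {..<?n}" unfolding V[symmetric] .
    then show "int (fst (es ! nat (A j))) \<in> {0..<int ?n}" "int (snd (es ! nat (A j))) \<in> {0..<int ?n}"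
      using uw by simp_all
  qed
  show "i = j" if "i \<in> {0..<int ?m}" "j \<in> {0..<int ?m}" "int (fst (es ! nat (A i))) = int (fst (es ! nat (A j)))"
    "int (snd (es ! nat (A i))) = int (snd (es ! nat (A j)))" for i j
  proof -
    have "es ! nat (A i) = es ! nat (A j)" using that(3,4) by (simp add: prod_eq_iff)
    then have "nat (A i) = nat (A j)"
      using es(1) arc(2)[OF that(1)] arc(2)[OF that(2)] by (subst (asm) nth_eq_iff_index_eq) auto
    then have "A i = A j" using arc(2)[OF that(1)] arc(2)[OF that(2)] by (simp add: eq_nat_nat_iff)
    then show ?thesis using A that by (auto simp: bij_betw_def inj_on_def)
  qed
  have "(\<Sum>v\<in>{0..<int ?n}. net_supply I (nat v)) = (\<Sum>v\<in>{..<?n}. net_supply I v)"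
    by (rule sum.reindex_bij_witness[of _ int nat]) auto
  then show "(\<Sum>v\<in>{0..<int ?n}. net_supply I (nat v)) = 0"
    using I V by (simp add: is_bnfp_def)
qed auto

section \<open>From an optimal threshold to an optimal flow of the given instance\<close>

context
  fixes I :: "nat bnfp" and es :: "(nat \<times> nat) list" and A :: "int \<Rightarrow> int" and N M :: int
  assumes I: "is_bnfp I" "unit_capacity I" and es: "distinct es" "set es = parcs (network I)"
    and V: "pverts (network I) = {..<card (pverts (network I))}"
    and A: "bij_betw A {0..<M} {0..<M}"
    and M: "M = int (length es)" and N: "N = int (card (pverts (network I)))"
    and sorted: "\<And>i j. 0 \<le> i \<Longrightarrow> i \<le> j \<Longrightarrow> j < M \<Longrightarrow> weight I (es ! nat (A i)) \<le> weight I (es ! nat (A j))"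
begin

interpretation net: flow_network N M "\<lambda>j. int (fst (es ! nat (A j)))" "\<lambda>j. int (snd (es ! nat (A j)))"
  "\<lambda>v. net_supply I (nat v)"
  unfolding M N by (rule unit_bnfp_network) (use I es V A M in auto)

lemma bij_arcs: "bij_betw (\<lambda>j. es ! nat (A j)) {0..<M} (parcs (network I))"
proof -
  have "bij_betw (\<lambda>k. es ! k) {..<length es} (set es)" using es(1) by (rule bij_betw_nth) auto
  moreover have "bij_betw nat {0..<M} {..<length es}"
    by (rule bij_betw_byWitness[of _ int]) (auto simp: M)
  ultimately have "bij_betw ((\<lambda>k. es ! k) \<circ> nat \<circ> A) {0..<M} (set es)"
    using A bij_betw_trans by (metis comp_assoc)
  then show ?thesis by (simp add: es(2) comp_def)
qed

lemma inv_arc: "j \<in> {0..<M} \<Longrightarrow> the_inv_into {0..<M} (\<lambda>j. es ! nat (A j)) (es ! nat (A j)) = j"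
  using the_inv_into_f_f[OF bij_betw_imp_inj_on[OF bij_arcs]] .

text \<open>For threshold \<open>M\<close> the vanishing clause is void, so only the reindexing of
  arcs and vertices remains.\<close>

lemma feasible_flow_iff: "feasible_flow I x \<longleftrightarrow> net.real_flow M (\<lambda>j. x (es ! nat (A j)))"
proof -
  let ?a = "\<lambda>j. es ! nat (A j)"
  have fin: "finite (parcs (network I))" using es(2) by (metis List.finite_set)
  have "(\<Sum>j | (i, j) \<in> parcs (network I). x (i, j)) - (\<Sum>j | (j, i) \<in> parcs (network I). x (j, i))
      = (\<Sum>j\<in>{0..<M}. x (?a j) * of_int (net.incid j (int i)))" for i
  proof -
    have "(\<Sum>j | (i, j) \<in> parcs (network I). x (i, j)) = (\<Sum>e\<in>{e \<in> parcs (network I). fst e = i}. x e)"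
      by (rule sum.reindex_bij_witness[of _ snd "\<lambda>j. (i, j)"]) auto
    also have "\<dots> = (\<Sum>e\<in>parcs (network I). x e * of_bool (fst e = i))"
      using fin by (simp add: sum.inter_filter of_bool_def if_distrib cong: if_cong)
    also have "\<dots> = (\<Sum>j\<in>{0..<M}. x (?a j) * of_bool (fst (?a j) = i))"
      by (rule sum.reindex_bij_betw[OF bij_arcs, of "\<lambda>e. x e * of_bool (fst e = i)", symmetric])
    finally have out: "(\<Sum>j | (i, j) \<in> parcs (network I). x (i, j)) = (\<Sum>j\<in>{0..<M}. x (?a j) * of_bool (fst (?a j) = i))" .
    have "(\<Sum>j | (j, i) \<in> parcs (network I). x (j, i)) = (\<Sum>e\<in>{e \<in> parcs (network I). snd e = i}. x e)"
      by (rule sum.reindex_bij_witness[of _ fst "\<lambda>j. (j, i)"]) auto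
    also have "\<dots> = (\<Sum>e\<in>parcs (network I). x e * of_bool (snd e = i))"
      using fin by (simp add: sum.inter_filter of_bool_def if_distrib cong: if_cong)
    also have "\<dots> = (\<Sum>j\<in>{0..<M}. x (?a j) * of_bool (snd (?a j) = i))"
      by (rule sum.reindex_bij_betw[OF bij_arcs, of "\<lambda>e. x e * of_bool (snd e = i)", symmetric])
    finally have inn: "(\<Sum>j | (j, i) \<in> parcs (network I). x (j, i)) = (\<Sum>j\<in>{0..<M}. x (?a j) * of_bool (snd (?a j) = i))" .
    show ?thesis
      unfolding out inn sum_subtractf[symmetric] by (intro sum.cong) (auto simp: net.incid_def)
  qed
  note divergence = this
  have "(\<forall>i\<in>pverts (network I).
      (\<Sum>j | (i, j) \<in> parcs (network I). x (i, j)) - (\<Sum>j | (j, i) \<in> parcs (network I). x (j, i))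
          = real_of_int (net_supply I i)) \<longleftrightarrow>
    (\<forall>i<card (pverts (network I)). (\<Sum>j\<in>{0..<M}. x (?a j) * of_int (net.incid j (int i))) = real_of_int (net_supply I i))"
    unfolding divergence by (subst V) (simp add: Ball_def)
  also have "\<dots> \<longleftrightarrow> (\<forall>v\<in>{0..<N}. (\<Sum>j\<in>{0..<M}. x (?a j) * of_int (net.incid j v)) = real_of_int (net_supply I (nat v)))"
  proof
    assume h: "\<forall>i<card (pverts (network I)). (\<Sum>j\<in>{0..<M}. x (?a j) * of_int (net.incid j (int i))) = real_of_int (net_supply I i)"
    show "\<forall>v\<in>{0..<N}. (\<Sum>j\<in>{0..<M}. x (?a j) * of_int (net.incid j v)) = real_of_int (net_supply I (nat v))"
    proof
      fix v assume v: "v \<in> {0..<N}"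
      then have "nat v < card (pverts (network I))" "int (nat v) = v" using N by auto
      then show "(\<Sum>j\<in>{0..<M}. x (?a j) * of_int (net.incid j v)) = real_of_int (net_supply I (nat v))"
        using h[rule_format, of "nat v"] by simp
    qed
  next
    assume h: "\<forall>v\<in>{0..<N}. (\<Sum>j\<in>{0..<M}. x (?a j) * of_int (net.incid j v)) = real_of_int (net_supply I (nat v))"
    show "\<forall>i<card (pverts (network I)). (\<Sum>j\<in>{0..<M}. x (?a j) * of_int (net.incid j (int i))) = real_of_int (net_supply I i)"
      using bspec[OF h, of "int i" for i] N by simp
  qed
  finally have cons: "(\<forall>i\<in>pverts (network I).
      (\<Sum>j | (i, j) \<in> parcs (network I). x (i, j)) - (\<Sum>j | (j, i) \<in> parcs (network I). x (j, i))
          = real_of_int (net_supply I i)) \<longleftrightarrow>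
    (\<forall>v\<in>{0..<N}. (\<Sum>j\<in>{0..<M}. x (?a j) * of_int (net.incid j v)) = real_of_int (net_supply I (nat v)))" .
  have "(\<forall>e\<in>parcs (network I). 0 \<le> x e \<and> x e \<le> real_of_int (capacity I e)) \<longleftrightarrow>
      (\<forall>e\<in>parcs (network I). 0 \<le> x e \<and> x e \<le> 1)"
    using I(2) by (simp add: unit_capacity_def)
  also have "\<dots> \<longleftrightarrow> (\<forall>j\<in>{0..<M}. 0 \<le> x (?a j) \<and> x (?a j) \<le> 1)"
    unfolding bij_betw_imp_surj_on[OF bij_arcs, symmetric] by simp
  finally show ?thesis
    unfolding feasible_flow_def net.real_flow_def cons by simp
qed

text \<open>If \<open>z\<close> had a smaller bottleneck, some arc \<open>j < r\<close> used by
  \<open>x\<close> would be heavier than everything \<open>z\<close> uses. By sortedness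
  \<open>z\<close> vanishes from rank \<open>j\<close> on, so \<open>j\<close> would be a feasible
  threshold below \<open>r\<close>. Ties are harmless, as the comparison is strict.\<close>

lemma optimal_threshold_optimal:
  assumes opt: "net.optimal_threshold r y" and x: "\<And>j. j \<in> {0..<M} \<Longrightarrow> x (es ! nat (A j)) = real_of_int (y j)"
  shows "optimal_flow I x"
proof -
  let ?a = "\<lambda>j. es ! nat (A j)"
  have y: "y j = 0 \<or> y j = 1 \<and> j < r" if "j \<in> {0..<M}" for j
    using opt that by (auto simp: net.optimal_threshold_def net.unit_flow_def)
  have "net.real_flow M (\<lambda>j. x (?a j))"
    unfolding net.real_flow_def
  proof (intro conjI ballI)
    fix v assume "v \<in> {0..<N}"
    then have "(\<Sum>j\<in>{0..<M}. y j * net.incid j v) = net_supply I (nat v)"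
      using opt by (simp add: net.optimal_threshold_def net.excess_def)
    then have "(\<Sum>j\<in>{0..<M}. real_of_int (y j) * real_of_int (net.incid j v)) = real_of_int (net_supply I (nat v))"
      by (simp flip: of_int_mult of_int_sum)
    then show "(\<Sum>j\<in>{0..<M}. x (?a j) * of_int (net.incid j v)) = real_of_int (net_supply I (nat v))"
      using x by (simp add: sum.cong[of "{0..<M}" "{0..<M}" "\<lambda>j. x (?a j) * of_int (net.incid j v)"
            "\<lambda>j. of_int (y j) * of_int (net.incid j v)"])
  next
    fix j assume "j \<in> {0..<M}"
    then show "0 \<le> x (?a j)" "x (?a j) \<le> 1" using x[of j] y[of j] by auto
  qed auto
  then have feas: "feasible_flow I x" by (simp add: feasible_flow_iff)
  have "bottleneck I x \<le> bottleneck I z" if z: "feasible_flow I z" for z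
  proof (rule ccontr)
    assume "\<not> bottleneck I x \<le> bottleneck I z"
    then have "bottleneck I z < bottleneck I x" by simp
    then obtain e where e: "e \<in> parcs (network I)" "0 < x e" "bottleneck I z < ereal (real_of_int (weight I e))"
      unfolding bottleneck_def[of I x] by (auto simp: less_SUP_iff)
    then obtain j where j: "j \<in> {0..<M}" "e = ?a j"
      using bij_betw_imp_surj_on[OF bij_arcs] by blast
    then have "j < r" using y[of j] x[of j] e(2) by auto
    have "z (?a i) = 0" if i: "i \<in> {j..<M}" for i
    proof (rule ccontr)
      have i': "i \<in> {0..<M}" using i j(1) by auto
      then have arc: "?a i \<in> parcs (network I)" using bij_arcs by (auto simp: bij_betw_def)
      assume "z (?a i) \<noteq> 0"
      then have "0 < z (?a i)" using z arc by (force simp: feasible_flow_def)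
      then have "ereal (real_of_int (weight I (?a i))) \<le> bottleneck I z"
        unfolding bottleneck_def using arc by (intro SUP_upper) auto
      also have "\<dots> < ereal (real_of_int (weight I (?a j)))" using e(3) j(2) by simp
      finally have "weight I (?a i) < weight I (?a j)" by simp
      moreover have "weight I (?a j) \<le> weight I (?a i)" using sorted[of j i] i j(1) by simp
      ultimately show False by simp
    qed
    then have "net.real_flow j (\<lambda>i. z (?a i))" using z by (simp add: feasible_flow_iff net.real_flow_def)
    then have "net.feas j" by (auto simp: net.feas_def)
    then show False using opt \<open>j < r\<close> j(1) by (auto simp: net.optimal_threshold_def)
  qed
  then show ?thesis using feas by (simp add: optimal_flow_def)
qed

lemma solved_output:
  assumes solved: "net.solved s" and perm: "\<And>j. j \<in> {0..<M} \<Longrightarrow> s ''perm'' j = A j"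
  shows "output_state I es s"
proof (cases "\<exists>y. feasible_flow I y")
  case False
  \<comment> \<open>This excludes the alternative with flag 1, since it would produce a feasible
    flow.\<close>
  have "\<not> net.optimal_threshold r y" for r y
  proof
    assume "net.optimal_threshold r y"
    then have "optimal_flow I (\<lambda>e. real_of_int (y (the_inv_into {0..<M} (\<lambda>j. es ! nat (A j)) e)))"
      by (rule optimal_threshold_optimal) (simp only: inv_arc)
    then show False using False by (auto simp: optimal_flow_def)
  qed
  then show ?thesis using False solved by (simp add: output_state_def net.solved_def)
next
  case True
  then have "net.feas M" by (auto simp: feasible_flow_iff net.feas_def)
  then obtain r y where s: "s ''feasible'' 0 = 1" and opt: "net.optimal_threshold r y"
    and flow: "\<And>j. j \<in> {0..<M} \<Longrightarrow> s ''flow'' (s ''perm'' j) = y j"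
    using solved by (auto simp: net.solved_def)
  let ?inv = "the_inv_into {0..<M} (\<lambda>j. es ! nat (A j))"
  let ?x = "\<lambda>e. real_of_int (y (?inv e))"
  have "optimal_flow I ?x" by (rule optimal_threshold_optimal[OF opt]) (simp only: inv_arc)
  moreover have "?x (es ! k) = real_of_int (s ''flow'' (int k))" if "k < length es" for k
  proof -
    have "int k \<in> A ` {0..<M}" using A that M by (simp add: bij_betw_def)
    then obtain j where j: "j \<in> {0..<M}" "A j = int k" by auto
    then have "?inv (es ! k) = j" using inv_arc[OF j(1)] by simp
    then show ?thesis using flow[OF j(1)] perm[OF j(1)] j(2) by simp
  qed
  ultimately show ?thesis using True s by (auto simp: output_state_def)
qed

end

text \<open>Sorting tracks only the image of the permutation; finiteness supplies
  injectivity.\<close>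

lemma surj_imp_bij_interval:
  assumes "A ` {0..<m} = {0..<m::int}"
  shows "bij_betw A {0..<m} {0..<m}"
  using assms by (simp add: bij_betw_def eq_card_imp_inj_on)

lemma bnfp_program_correct:
  assumes I: "is_bnfp I" "unit_capacity I" and inp: "input_state I es s"
  shows "wp bnfp_program (\<lambda>s' t'. output_state I es s' \<and>
    t' \<le> int (time_bound (card (pverts (network I))) (card (parcs (network I))))) s 0"
    (is "wp _ ?P s 0")
proof -
  define n m where "n = card (pverts (network I))" and "m = card (parcs (network I))"
  define N M where "N = int n" and "M = int m"
  interpret G: pair_fin_digraph "network I" using I by (simp add: is_bnfp_def)
  have V: "pverts (network I) = {..<n}" using inp unfolding input_state_def n_def by (rule conjunct1)
  note inp' = conjunct2[OF inp[unfolded input_state_def], folded n_def m_def]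
  have es: "distinct es" "set es = parcs (network I)" and sn: "s ''n'' 0 = N" and sm: "s ''m'' 0 = M"
    using inp' by (simp_all add: N_def M_def)
  have len: "length es = m" using distinct_card[OF es(1)] es(2) by (simp add: m_def)
  have sup: "s ''supply'' (int i) = net_supply I i" if "i < n" for i
    using inp' that V by simp
  have arcs: "s ''tail'' (int k) = int (fst (es ! k))" "s ''head'' (int k) = int (snd (es ! k))"
    "s ''weight'' (int k) = weight I (es ! k)" if "k < m" for k
    using inp' that len by simp_all
  \<comment> \<open>Arcs are pairs of vertices, so \<open>m <= n^2\<close> and the nonzero branch of
    \<open>time_bound\<close> applies.\<close>
  have "parcs (network I) \<subseteq> {..<n} \<times> {..<n}" using G.in_arcsD1 G.in_arcsD2 V by auto
  then have "m \<le> card ({..<n} \<times> {..<n})" unfolding m_def by (intro card_mono) auto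
  then have mn: "m \<le> n\<^sup>2" by (simp add: power2_eq_square)
  have nonneg: "0 \<le> N" "0 \<le> M" by (simp_all add: N_def M_def)
  show ?thesis
    unfolding bnfp_program_def wp_Seq
  proof (rule wp_mono[OF wp_powers[where s = s and t = 0, OF sm nonneg(2)]])
    fix s1 t1
    assume "\<exists>L. s1 ''L'' 0 = L \<and> 1 \<le> L \<and> (\<forall>i\<in>{0..<L}. s1 ''pow'' i = 2 ^ nat i) \<and>
      M < 2 ^ nat (L - 1) \<and> (2 \<le> L \<longrightarrow> 2 ^ nat (L - 2) \<le> M) \<and> t1 \<le> 0 + 40 * L"
      and ag1: "agree (writes powers) s1 s"
    then obtain L where L: "s1 ''L'' 0 = L" "1 \<le> L" "\<And>i. i \<in> {0..<L} \<Longrightarrow> s1 ''pow'' i = 2 ^ nat i"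
      "M < 2 ^ nat (L - 1)" "2 \<le> L \<longrightarrow> 2 ^ nat (L - 2) \<le> M" and t1: "t1 \<le> 40 * L" by auto
    have Llen: "L = int (log_length m)"
      by (rule log_length_unique[OF L(2) L(4,5)[unfolded M_def]])
    have f1: "s1 ''n'' = s ''n''" "s1 ''m'' = s ''m''" "s1 ''supply'' = s ''supply''" "s1 ''tail'' = s ''tail''"
      "s1 ''head'' = s ''head''" "s1 ''weight'' = s ''weight''"
      using ag1 by (simp_all add: agree_def writes_powers)
    have n1: "s1 ''n'' 0 = N" "s1 ''m'' 0 = M" using f1 sn sm by simp_all
    show "wp choose_k (wp merge_sort (wp build_graph (wp solve ?P))) s1 t1"
    proof (rule wp_mono[OF wp_choose_k[where s = s1 and t = t1, OF n1(1) nonneg(1) n1(2) nonneg(2) L(1,2)]])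
      fix s2 t2
      assume "\<exists>k. s2 ''k'' 0 = k \<and> s2 ''k1'' 0 = k * L \<and> balanced_k N M L k \<and> t2 \<le> t1 + 100 * (N + k + 1)"
        and ag2: "agree (writes choose_k) s2 s1"
      then obtain k where k: "s2 ''k'' 0 = k" "s2 ''k1'' 0 = k * L" "balanced_k N M L k" and t2: "t2 \<le> t1 + 100 * (N + k + 1)"
        by auto
      have klen: "k = int (label_bound n m)"
        using k(3) by (intro label_bound_unique) (simp add: N_def M_def Llen)
      have k1: "1 \<le> k" using k(3) by (simp add: balanced_k_def)
      have f2: "s2 ''n'' = s ''n''" "s2 ''m'' = s ''m''" "s2 ''supply'' = s ''supply''" "s2 ''tail'' = s ''tail''"
        "s2 ''head'' = s ''head''" "s2 ''weight'' = s ''weight''" "s2 ''L'' = s1 ''L''" "s2 ''pow'' = s1 ''pow''"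
        using ag2 f1 by (simp_all add: agree_def writes_choose_k)
      have s2: "s2 ''m'' 0 = M" "s2 ''L'' 0 = L" "s2 ''weight'' = s ''weight''"
        "\<And>i. i \<in> {0..<L} \<Longrightarrow> s2 ''pow'' i = 2 ^ nat i"
        using f2 sm L by simp_all
      show "wp merge_sort (wp build_graph (wp solve ?P)) s2 t2"
      proof (rule wp_mono[OF wp_merge_sort[where s = s2 and t = t2, OF s2(1,2,3) nonneg(2) L(2) s2(4) L(4)]], assumption)
        fix s3 t3
        assume h3: "t3 \<le> t2 + 300 * (M + 1) * L \<and> s3 ''perm'' ` {0..<M} = {0..<M} \<and>
          (\<forall>a b. 0 \<le> a \<longrightarrow> a \<le> b \<longrightarrow> b < M \<longrightarrow> s ''weight'' (s3 ''perm'' a) \<le> s ''weight'' (s3 ''perm'' b))"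
          and ag3: "agree (writes merge_sort) s3 s2"
        define A where "A = s3 ''perm''"
        have A: "bij_betw A {0..<M} {0..<M}" using h3 by (intro surj_imp_bij_interval) (simp add: A_def)
        have Aj: "0 \<le> A j" "nat (A j) < m" "int (nat (A j)) = A j" if "j \<in> {0..<M}" for j
        proof -
          have "A j \<in> {0..<M}" using bij_betw_apply[OF A that] .
          then show "0 \<le> A j" "nat (A j) < m" "int (nat (A j)) = A j" by (auto simp: M_def)
        qed
        have f3: "s3 ''n'' = s ''n''" "s3 ''m'' = s ''m''" "s3 ''supply'' = s ''supply''" "s3 ''tail'' = s ''tail''"
          "s3 ''head'' = s ''head''" "s3 ''L'' = s2 ''L''" "s3 ''pow'' = s2 ''pow''" "s3 ''k'' = s2 ''k''" "s3 ''k1'' = s2 ''k1''"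
          using ag3 f2 by (simp_all add: agree_def writes_merge_sort)
        have sorted: "weight I (es ! nat (A i)) \<le> weight I (es ! nat (A j))" if "0 \<le> i" "i \<le> j" "j < M" for i j
        proof -
          have ij: "i \<in> {0..<M}" "j \<in> {0..<M}" using that by auto
          have "s ''weight'' (A i) \<le> s ''weight'' (A j)" using h3 that unfolding A_def by blast
          then show ?thesis
            using arcs(3)[OF Aj(2)[OF ij(1)]] arcs(3)[OF Aj(2)[OF ij(2)]]
            unfolding Aj(3)[OF ij(1)] Aj(3)[OF ij(2)] by simp
        qed
        note inst = I es V[unfolded n_def] A M_def[folded len] N_def[unfolded n_def] sorted
        interpret net: flow_network N M "\<lambda>j. int (fst (es ! nat (A j)))" "\<lambda>j. int (snd (es ! nat (A j)))"
          "\<lambda>v. net_supply I (nat v)"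
          unfolding M_def N_def n_def len[symmetric]
          by (rule unit_bnfp_network) (use I es V A len in \<open>auto simp: M_def n_def\<close>)
        have s3: "s3 ''n'' 0 = N" "s3 ''m'' 0 = M" using f3 sn sm by simp_all
        have sup3: "s3 ''supply'' v = net_supply I (nat v)" if "v \<in> {0..<N}" for v
          using sup[of "nat v"] that f3(3) by (auto simp: N_def)
        have arcs3: "s3 ''tail'' (s3 ''perm'' j) = int (fst (es ! nat (A j))) \<and> s3 ''head'' (s3 ''perm'' j) = int (snd (es ! nat (A j)))"
          if "j \<in> {0..<M}" for j
          using arcs(1,2)[OF Aj(2)[OF that]] unfolding f3 A_def[symmetric] Aj(3)[OF that] by simp
        show "wp build_graph (wp solve ?P) s3 t3"
        proof (rule wp_mono[OF net.wp_build_graph[where s = s3 and t = t3, OF s3(2,1) sup3 arcs3]], assumption, assumption)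
          fix s4 t4
          assume h4: "t4 \<le> t3 + 200 * (N + M + 1) \<and> net.graph_ok s4" and ag4: "agree (writes build_graph) s4 s3"
          have f4: "s4 ''L'' = s2 ''L''" "s4 ''pow'' = s2 ''pow''" "s4 ''k'' = s2 ''k''" "s4 ''k1'' = s2 ''k1''" "s4 ''perm'' = A"
            using ag4 f3 by (simp_all add: agree_def writes_build_graph A_def)
          have s4: "s4 ''k'' 0 = k" "s4 ''k1'' 0 = k * L" "s4 ''L'' 0 = L" "s4 ''perm'' = A"
            using f4 k s2 by simp_all
          have pow4: "s4 ''pow'' i = 2 ^ nat i" if "i \<in> {0..<L}" for i
            using f4 s2(4)[OF that] by simp
          have inj: "inj_on (s4 ''perm'') {0..<M}" using A s4 by (simp add: bij_betw_def)
          show "wp solve ?P s4 t4"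
          proof (rule wp_mono[OF net.wp_solve[where s = s4 and t = t4, OF conjunct2[OF h4] s4(1,2) k(3) s4(3) L(2) pow4 L(4) inj]], assumption)
            fix s5 t5
            assume h5: "t5 \<le> t4 + 20000 * (k * (N + M + 1)) * L \<and> net.solved s5 \<and> s5 ''perm'' = s4 ''perm''"
            have "output_state I es s5"
              by (rule solved_output[OF inst]) (use h5 s4 in auto)
            moreover have "t5 \<le> int (time_bound n m)"
            \<comment> \<open>Everything before \<open>solve\<close> is charged to
              \<open>X = k L Z\<close> as well: \<open>L\<close>, \<open>k\<close>, \<open>Z\<close>
              and the sorting term \<open>Y\<close> are each at most \<open>X\<close>, and their
              constants total less than 1000.\<close>
            proof -
              define Z where "Z = N + M + 1"
              have Z: "1 \<le> Z" "M + 1 \<le> Z" "N + 1 \<le> Z" using nonneg by (simp_all add: Z_def)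
              have kL: "1 \<le> k * L" using mult_mono[of 1 k 1 L] k1 L(2) by simp
              define X where "X = k * L * Z"
              have "L * 1 \<le> k * L * Z" using k1 L(2) Z mult_right_mono[of 1 k L] by (intro mult_mono) auto
              moreover have "1 * Z \<le> k * L * Z" using kL Z by (intro mult_right_mono) auto
              moreover have "k * 1 \<le> k * L * Z" using k1 L(2) Z mult_left_mono[of 1 L k] by (intro mult_mono) auto
              moreover have "(M + 1) * L \<le> k * L * Z"
              proof -
                have "L * (M + 1) \<le> (k * L) * Z"
                  using k1 L(2) Z nonneg mult_right_mono[of 1 k L] by (intro mult_mono) auto
                then show ?thesis by (simp add: mult.commute)
              qed
              moreover define Y where "Y = (M + 1) * L"
              ultimately have X: "L \<le> X" "Z \<le> X" "k \<le> X" "Y \<le> X" by (simp_all add: X_def)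
              have "t3 \<le> t2 + 300 * Y" using conjunct1[OF h3] by (simp add: Y_def algebra_simps)
              moreover have "t4 \<le> t3 + 200 * Z" using h4 by (simp add: Z_def)
              moreover have "t5 \<le> t4 + 20000 * X" using h5 by (simp add: X_def Z_def algebra_simps)
              ultimately have "t5 \<le> 21000 * X" using t1 t2 X Z by simp
              also have "21000 * X = int (time_bound n m)"
                using mn by (simp add: time_bound_def X_def Z_def klen Llen N_def M_def algebra_simps)
              finally show ?thesis .
            qed
            ultimately show "?P s5 t5" by (simp add: n_def m_def)
          qed
        qed
      qed
    qed
  qed
qed

theorem theorem4p5:
  shows "\<exists>(P :: com) (T :: nat \<Rightarrow> nat \<Rightarrow> nat).
    solves_within P {I. is_bnfp I \<and> unit_capacity I} T \<and>
    (\<forall>K. (\<lambda>(n, m). real (T n m)) \<in> O[size_regime K](\<lambda>(n, m).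
       min (real m * (real n * log 2 (real n)) powr (2/3))
           (real m powr (3/2) * sqrt (log 2 (real n)))))"
proof (intro exI conjI allI)
  show "solves_within bnfp_program {I. is_bnfp I \<and> unit_capacity I} time_bound"
    unfolding solves_within_def
  proof (intro ballI allI impI)
    fix I es s
    assume "I \<in> {I. is_bnfp I \<and> unit_capacity I}" "input_state I es s"
    then obtain u s' where "exec bnfp_program s u s'" "output_state I es s'"
      "0 + int u \<le> int (time_bound (card (pverts (network I))) (card (parcs (network I))))"
      using bnfp_program_correct[of I es s] by (auto simp: wp_def)
    then show "\<exists>t s'. exec bnfp_program s t s' \<and> output_state I es s' \<and>
        t \<le> time_bound (card (pverts (network I))) (card (parcs (network I)))"
      by auto
  qed
qed (rule time_bound_asymptotic)

end
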